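(* Let $\mathcal{C}$ be a permutation class containing $12$ and $21$, given by its finite basis $B$, and whose set $\mathcal{S}_{\mathcal{C}}$ of simple permutations is finite and given. Let $B^\star$ be the set of non-simple permutations of $B$. There is an algorithm which, given $B$ and $\mathcal{S}_{\mathcal{C}}$, computes a finite combinatorial system of equations, each a true equality of sets of the form $\mathcal{D}_0=\mathit{1}_{[1\in\mathcal{D}_0]}\uplus\biguplus\pi[\mathcal{D}_1,\dots,\mathcal{D}_n]$ (a finite disjoint union; each $\pi$ is $\oplus$, $\ominus$ or simple, $n=|\pi|$), where $\mathit{1}_{[1\in\mathcal{D}_0]}$ is $\{1\}$ if the permutation $1$ belongs to $\mathcal{D}_0$ and $\emptyset$ otherwise, and where each $\mathcal{D}_i$ is a restriction $\hat{\mathcal{C}}^\delta\langle E\rangle(A)$ with $\delta\in\{\,\cdot\,,+,-\}$ and $E$ and $A$ containing only normalized blocks of elements of $B^\star$. Moreover $\mathcal{C}$ is the left part of an equation of the system, and every $\mathcal{D}_i$ appearing in the system is the left part of one equation of the system. In particular this system is a combinatorial specification of $\mathcal{C}$.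
   Context: A permutation of size $n$ is a bijection of $\{1,\dots,n\}$; $\pi\preccurlyeq\sigma$ means some subsequence of $\sigma$ is order-isomorphic to $\pi$ ($\sigma$ contains $\pi$), otherwise $\sigma$ avoids $\pi$. A permutation class is a pattern-closed set of permutations of size $\ge1$; its basis is the set of minimal permutations not in it. An interval of $\gamma$ is a nonempty set of consecutive indices whose values are consecutive integers; a normalized block of $\gamma$ is the permutation order-isomorphic to the restriction of $\gamma$ to an interval. A simple permutation has size $\ge4$ and only trivial intervals. The substitution $\sigma[\pi^1,\dots,\pi^n]$ replaces the $i$-th entry of $\sigma$ by a block of consecutive values order-isomorphic to $\pi^i$, blocks ordered by value as in $\sigma$; $\oplus=12$, $\ominus=21$; for sets, $\pi[\mathcal{D}_1,\dots,\mathcal{D}_n]=\{\pi[\sigma_1,\dots,\sigma_n]:\sigma_i\in\mathcal{D}_i\}$. $\hat{\mathcal{C}}$ is the substitution closure of $\mathcal{C}$: $\bigcup_k\mathcal{C}^k$ with $\mathcal{C}^1=\mathcal{C}$, $\mathcal{C}^{k+1}=\{\sigma[\pi^1,\dots,\pi^{|\sigma|}]:\sigma\in\mathcal{C},\pi^i\in\mathcal{C}^k\}$. For a set $\mathcal{A}$ of permutations, $\mathcal{A}^+$ (resp. $\mathcal{A}^-$) is the set of its elements not of the form $\oplus[\pi^1,\pi^2]$ (resp. $\ominus[\pi^1,\pi^2]$), and $\mathcal{A}\langle E\rangle(A)$ is the set of elements of $\mathcal{A}$ that avoid every pattern of $E$ and contain every pattern of $A$. A restriction is a set $\hat{\mathcal{C}}^\delta\langle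 E\rangle(A)$ with $\hat{\mathcal{C}}^\delta\in\{\hat{\mathcal{C}},\hat{\mathcal{C}}^+,\hat{\mathcal{C}}^-\}$. A combinatorial specification is a system of such equations in which all unions are disjoint and every set on a right-hand side is defined by an equation of the system. *)

theory Defs
  imports "HOL-Library.Sublist" "HOL-Library.Nat_Bijection"
begin

section \<open>Permutations and patterns\<close>

text \<open>
  Permutations are written in one-line notation, as lists of the values \<open>1, \<dots>, n\<close>.
  Positions are list indices and hence start at 0.
\<close>

definition is_perm :: "nat list \<Rightarrow> bool" where
  "is_perm p \<longleftrightarrow> p \<noteq> [] \<and> distinct p \<and> set p = {1..length p}"

definition order_iso :: "nat list \<Rightarrow> nat list \<Rightarrow> bool" where
  "order_iso xs ys \<longleftrightarrow> length xs = length ys \<and>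
     (\<forall>i<length xs. \<forall>j<length xs. xs ! i < xs ! j \<longleftrightarrow> ys ! i < ys ! j)"

definition pattern_of :: "nat list \<Rightarrow> nat list \<Rightarrow> bool"  (infix \<open>\<preceq>\<close> 50) where
  "p \<preceq> s \<longleftrightarrow> (\<exists>ys. subseq ys s \<and> order_iso p ys)"

definition perm_class :: "nat list set \<Rightarrow> bool" where
  "perm_class C \<longleftrightarrow> (\<forall>s\<in>C. is_perm s) \<and> (\<forall>s\<in>C. \<forall>p. is_perm p \<and> p \<preceq> s \<longrightarrow> p \<in> C)"

definition class_basis :: "nat list set \<Rightarrow> nat list set" where
  "class_basis C =
     {b. is_perm b \<and> b \<notin> C \<and> (\<forall>p. is_perm p \<and> p \<preceq> b \<and> p \<noteq> b \<longrightarrow> p \<in> C)}"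

text \<open>The set of indices \<open>{i..<j}\<close> is an interval of \<open>g\<close>.\<close>

definition perm_interval :: "nat list \<Rightarrow> nat \<Rightarrow> nat \<Rightarrow> bool" where
  "perm_interval g i j \<longleftrightarrow> i < j \<and> j \<le> length g \<and>
     (\<exists>v. (\<lambda>k. g ! k) ` {i..<j} = {v..<v + (j - i)})"

definition normalized_blocks :: "nat list \<Rightarrow> nat list set" where
  "normalized_blocks g =
     {d. is_perm d \<and> (\<exists>i j. perm_interval g i j \<and> order_iso d (take (j - i) (drop i g)))}"

definition simple_perm :: "nat list \<Rightarrow> bool" where
  "simple_perm s \<longleftrightarrow> is_perm s \<and> 4 \<le> length s \<and>
     (\<forall>i j. perm_interval s i j \<longrightarrow> j = Suc i \<or> (i = 0 \<and> j = length s))"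

definition simples :: "nat list set \<Rightarrow> nat list set" where
  "simples C = {s \<in> C. simple_perm s}"


section \<open>Substitution\<close>

text \<open>The block replacing the \<open>i\<close>-th entry is shifted by the total size of the blocks below it.\<close>

definition inflate :: "nat list \<Rightarrow> nat list list \<Rightarrow> nat list" where
  "inflate s ps = concat (map
     (\<lambda>i. map (\<lambda>x. x + (\<Sum>j | j < length s \<and> s ! j < s ! i. length (ps ! j))) (ps ! i))
     [0..<length s])"

definition inflate_sets :: "nat list \<Rightarrow> nat list set list \<Rightarrow> nat list set" where
  "inflate_sets s Ds = {inflate s ps | ps. list_all2 (\<in>) ps Ds}"

text \<open>The exponent is shifted: \<open>subst_pow C k\<close> is the set \<open>C\<^sup>k\<^sup>+\<^sup>1\<close>.\<close>

primrec subst_pow :: "nat list set \<Rightarrow> nat \<Rightarrow> nat list set" where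
  "subst_pow C 0 = C"
| "subst_pow C (Suc k) =
     {inflate s ps | s ps. s \<in> C \<and> length ps = length s \<and> set ps \<subseteq> subst_pow C k}"

definition subst_closure :: "nat list set \<Rightarrow> nat list set" where
  "subst_closure C = (\<Union>k. subst_pow C k)"

definition oplus_indec :: "nat list set \<Rightarrow> nat list set" where
  "oplus_indec A = {s \<in> A. \<not> (\<exists>p q. is_perm p \<and> is_perm q \<and> s = inflate [1, 2] [p, q])}"

definition ominus_indec :: "nat list set \<Rightarrow> nat list set" where
  "ominus_indec A = {s \<in> A. \<not> (\<exists>p q. is_perm p \<and> is_perm q \<and> s = inflate [2, 1] [p, q])}"


section \<open>Restrictions and systems of equations\<close>

text \<open>
  Restrictions and equations are formal expressions, so that they can be the output of an
  algorithm; the sets they denote depend on the class \<open>C\<close>.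
\<close>

datatype sign = Unsigned | Plus | Minus

datatype restriction =
  Restriction (sign_of: sign) (avoided: "nat list set") (required: "nat list set")

fun signed_closure :: "nat list set \<Rightarrow> sign \<Rightarrow> nat list set" where
  "signed_closure C Unsigned = subst_closure C"
| "signed_closure C Plus = oplus_indec (subst_closure C)"
| "signed_closure C Minus = ominus_indec (subst_closure C)"

definition restriction_set :: "nat list set \<Rightarrow> restriction \<Rightarrow> nat list set" where
  "restriction_set C D = {s \<in> signed_closure C (sign_of D).
     (\<forall>p\<in>avoided D. \<not> p \<preceq> s) \<and> (\<forall>p\<in>required D. p \<preceq> s)}"

text \<open>
  \<open>has_one\<close> tells whether the summand \<open>{1}\<close> is present; a pair \<open>(p, [D\<^sub>1, \<dots>, D\<^sub>n])\<close> among the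
  summands stands for \<open>p[D\<^sub>1, \<dots>, D\<^sub>n]\<close>.
\<close>

datatype equation =
  Equation (lhs: restriction) (has_one: bool) (summands: "(nat list \<times> restriction list) list")

definition rhs_restrictions :: "equation \<Rightarrow> restriction set" where
  "rhs_restrictions e = (\<Union>(p, Ds)\<in>set (summands e). set Ds)"

definition system_restrictions :: "equation list \<Rightarrow> restriction set" where
  "system_restrictions sys = (\<Union>e\<in>set sys. insert (lhs e) (rhs_restrictions e))"

definition rhs_sets :: "nat list set \<Rightarrow> equation \<Rightarrow> nat list set list" where
  "rhs_sets C e = (if has_one e then {[1]} else {}) #
     map (\<lambda>(p, Ds). inflate_sets p (map (restriction_set C) Ds)) (summands e)"

definition well_formed_equation :: "nat list set \<Rightarrow> equation \<Rightarrow> bool" where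
  "well_formed_equation C e \<longleftrightarrow>
     (has_one e \<longleftrightarrow> [1] \<in> restriction_set C (lhs e)) \<and>
     (\<forall>(p, Ds)\<in>set (summands e).
        (p = [1, 2] \<or> p = [2, 1] \<or> simple_perm p) \<and> length Ds = length p)"

text \<open>
  Disjointness is required between summands at different positions, so that a repeated
  nonempty summand is not allowed.
\<close>

definition equation_holds :: "nat list set \<Rightarrow> equation \<Rightarrow> bool" where
  "equation_holds C e \<longleftrightarrow>
     restriction_set C (lhs e) = \<Union>(set (rhs_sets C e)) \<and>
     (\<forall>i<length (rhs_sets C e). \<forall>j<length (rhs_sets C e).
        i \<noteq> j \<longrightarrow> rhs_sets C e ! i \<inter> rhs_sets C e ! j = {})"

definition combinatorial_specification :: "nat list set \<Rightarrow> equation list \<Rightarrow> bool" where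
  "combinatorial_specification C sys \<longleftrightarrow>
     (\<forall>e\<in>set sys. well_formed_equation C e \<and> equation_holds C e) \<and>
     (\<exists>e\<in>set sys. restriction_set C (lhs e) = C) \<and>
     (\<forall>e\<in>set sys. rhs_restrictions e \<subseteq> lhs ` set sys)"


section \<open>Algorithms\<close>

text \<open>Algorithms are programs for partial \<open>\<mu>\<close>-recursive functions, with big-step evaluation.\<close>

datatype recf =
    Zero
  | Succ
  | Proj nat
  | Comp recf "recf list"
  | PrimRec recf recf
  | Mu recf

inductive rec_eval :: "recf \<Rightarrow> nat list \<Rightarrow> nat \<Rightarrow> bool" where
  zero: "rec_eval Zero xs 0"
| succ: "rec_eval Succ [x] (Suc x)"
| proj: "i < length xs \<Longrightarrow> rec_eval (Proj i) xs (xs ! i)"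
| comp: "list_all2 (\<lambda>g z. rec_eval g xs z) gs zs \<Longrightarrow> rec_eval f zs y \<Longrightarrow>
         rec_eval (Comp f gs) xs y"
| prim_0: "rec_eval f xs y \<Longrightarrow> rec_eval (PrimRec f g) (0 # xs) y"
| prim_Suc: "rec_eval (PrimRec f g) (n # xs) r \<Longrightarrow> rec_eval g (n # r # xs) y \<Longrightarrow>
         rec_eval (PrimRec f g) (Suc n # xs) y"
| mu: "rec_eval f (n # xs) 0 \<Longrightarrow> (\<forall>m<n. \<exists>k>0. rec_eval f (m # xs) k) \<Longrightarrow>
         rec_eval (Mu f) xs n"

text \<open>
  The input and output of an algorithm are coded as natural numbers. A finite set is given by
  the code of any list enumerating it.
\<close>

definition encode_perms :: "nat list list \<Rightarrow> nat" where
  "encode_perms ps = list_encode (map list_encode ps)"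

definition decode_perms :: "nat \<Rightarrow> nat list list" where
  "decode_perms n = map list_decode (list_decode n)"

definition decode_sign :: "nat \<Rightarrow> sign" where
  "decode_sign n = (if n = 0 then Unsigned else if n = 1 then Plus else Minus)"

definition decode_restriction :: "nat \<Rightarrow> restriction" where
  "decode_restriction n = (let (d, m) = prod_decode n; (e, a) = prod_decode m in
     Restriction (decode_sign d) (set (decode_perms e)) (set (decode_perms a)))"

definition decode_summand :: "nat \<Rightarrow> nat list \<times> restriction list" where
  "decode_summand n = (let (p, ds) = prod_decode n in
     (list_decode p, map decode_restriction (list_decode ds)))"

definition decode_equation :: "nat \<Rightarrow> equation" where
  "decode_equation n = (let (l, m) = prod_decode n; (b, ts) = prod_decode m in
     Equation (decode_restriction l) (b \<noteq> 0) (map decode_summand (list_decode ts)))"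

definition decode_system :: "nat \<Rightarrow> equation list" where
  "decode_system n = map decode_equation (list_decode n)"

end

theory Submission
  imports Defs
begin

text \<open>
  Let \<open>N\<close> be the finite set of all normalized blocks of the non-simple basis elements. It is closed
  under taking blocks, and \<open>C\<close> consists of the permutations in the substitution closure that avoid
  the non-simple basis elements, all of which lie in \<open>N\<close>. Restrictions that fix, for every element
  of \<open>N\<close>, whether it is contained or avoided (atoms) partition the closure. An occurrence
  of an element of \<open>N\<close> in an inflation \<open>q[p\<^sub>1, \<dots>, p\<^sub>n]\<close> splits it into blocks, which again belong to
  \<open>N\<close>, so the atoms of \<open>p\<^sub>1, \<dots>, p\<^sub>n\<close> determine the atom of the inflation. Hence every restriction
  with patterns in \<open>N\<close> is the union of the sets \<open>q[D\<^sub>1, \<dots>, D\<^sub>n]\<close> over suitable tuples of atoms, and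
  uniqueness of the substitution decomposition makes the union disjoint. The system consists of the
  equations for all such restrictions; it needs no search, only finite enumeration and tests.
\<close>

section \<open>Computable functions\<close>

text \<open>The shifts in \<open>inflate\<close> are awkward to reason about, so inflations are
  handled as \<open>layered\<close> lists of labelled words, in which only the relative order of the
  blocks counts; this survives passing to subwords and relabelling values, as occurrences of
  patterns demand. The pieces of an occurrence may be empty, so they are indexed by all entries of
  the quotient, and only the nonempty ones must standardize into \<open>N\<close>. A decomposition
  with quotient \<open>[1, 2]\<close> or \<open>[2, 1]\<close> becomes unique once its first
  component is indecomposable; this is the origin of the signs on right-hand sides, and it turns a
  sign on the left into the exclusion of one quotient. Avoiding the non-simple basis elements
  suffices because every simple permutation of the closure already lies in \<open>C\<close>.
  Containment is never tested on the components themselves, which range over infinite sets, but on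
  their recorded sets of contained blocks. Computability is proved by rules that follow the syntax
  of the definitions, all of which quantify over explicit finite lists.\<close>

definition nat_computable :: "nat \<Rightarrow> (nat list \<Rightarrow> nat) \<Rightarrow> bool" where
  "nat_computable k F \<longleftrightarrow> (\<exists>r. \<forall>xs. length xs = k \<longrightarrow> rec_eval r xs (F xs))"

lemma nat_computable_cong:
  "nat_computable k F \<Longrightarrow> (\<And>xs. length xs = k \<Longrightarrow> F xs = G xs) \<Longrightarrow> nat_computable k G"
  unfolding nat_computable_def by metis

lemma nat_computable_nth: "i < k \<Longrightarrow> nat_computable k (\<lambda>xs. xs ! i)"
  unfolding nat_computable_def by (blast intro: rec_eval.proj)

lemma nat_computable_compose1:
  assumes "nat_computable 1 G" "nat_computable k F"
  shows "nat_computable k (\<lambda>xs. G [F xs])"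
proof -
  obtain g where g: "\<And>xs. length xs = 1 \<Longrightarrow> rec_eval g xs (G xs)"
    using assms(1) unfolding nat_computable_def by blast
  obtain f where f: "\<And>xs. length xs = k \<Longrightarrow> rec_eval f xs (F xs)"
    using assms(2) unfolding nat_computable_def by blast
  have "rec_eval (Comp g [f]) xs (G [F xs])" if "length xs = k" for xs
    using g[of "[F xs]"] f[OF that] by (auto intro!: rec_eval.comp[where zs = "[F xs]"])
  then show ?thesis unfolding nat_computable_def by blast
qed

lemma nat_computable_compose2:
  assumes "nat_computable 2 G" "nat_computable k F1" "nat_computable k F2"
  shows "nat_computable k (\<lambda>xs. G [F1 xs, F2 xs])"
proof -
  obtain g where g: "\<And>xs. length xs = 2 \<Longrightarrow> rec_eval g xs (G xs)"
    using assms(1) unfolding nat_computable_def by blast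
  obtain f1 where f1: "\<And>xs. length xs = k \<Longrightarrow> rec_eval f1 xs (F1 xs)"
    using assms(2) unfolding nat_computable_def by blast
  obtain f2 where f2: "\<And>xs. length xs = k \<Longrightarrow> rec_eval f2 xs (F2 xs)"
    using assms(3) unfolding nat_computable_def by blast
  have "rec_eval (Comp g [f1, f2]) xs (G [F1 xs, F2 xs])" if "length xs = k" for xs
    using g[of "[F1 xs, F2 xs]"] f1[OF that] f2[OF that]
    by (auto intro!: rec_eval.comp[where zs = "[F1 xs, F2 xs]"])
  then show ?thesis unfolding nat_computable_def by blast
qed

lemma nat_computable_compose3:
  assumes "nat_computable 3 G" "nat_computable k F1" "nat_computable k F2" "nat_computable k F3"
  shows "nat_computable k (\<lambda>xs. G [F1 xs, F2 xs, F3 xs])"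
proof -
  obtain g where g: "\<And>xs. length xs = 3 \<Longrightarrow> rec_eval g xs (G xs)"
    using assms(1) unfolding nat_computable_def by blast
  obtain f1 where f1: "\<And>xs. length xs = k \<Longrightarrow> rec_eval f1 xs (F1 xs)"
    using assms(2) unfolding nat_computable_def by blast
  obtain f2 where f2: "\<And>xs. length xs = k \<Longrightarrow> rec_eval f2 xs (F2 xs)"
    using assms(3) unfolding nat_computable_def by blast
  obtain f3 where f3: "\<And>xs. length xs = k \<Longrightarrow> rec_eval f3 xs (F3 xs)"
    using assms(4) unfolding nat_computable_def by blast
  have "rec_eval (Comp g [f1, f2, f3]) xs (G [F1 xs, F2 xs, F3 xs])" if "length xs = k" for xs
    using g[of "[F1 xs, F2 xs, F3 xs]"] f1[OF that] f2[OF that] f3[OF that]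
    by (auto intro!: rec_eval.comp[where zs = "[F1 xs, F2 xs, F3 xs]"])
  then show ?thesis unfolding nat_computable_def by blast
qed

text \<open>\<open>PrimRec\<close> recurses on its first argument and hands the step the counter,
  the previous value and the parameters in this order; hence the split into \<open>hd xs\<close> and
  \<open>tl xs\<close>.\<close>

lemma nat_computable_rec_nat:
  assumes "nat_computable k F" "nat_computable (Suc (Suc k)) G"
  shows "nat_computable (Suc k) (\<lambda>xs. rec_nat (F (tl xs)) (\<lambda>n r. G (n # r # tl xs)) (hd xs))"
proof -
  obtain f where f: "\<And>xs. length xs = k \<Longrightarrow> rec_eval f xs (F xs)"
    using assms(1) unfolding nat_computable_def by blast
  obtain g where g: "\<And>xs. length xs = Suc (Suc k) \<Longrightarrow> rec_eval g xs (G xs)"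
    using assms(2) unfolding nat_computable_def by blast
  have "rec_eval (PrimRec f g) (n # xs) (rec_nat (F xs) (\<lambda>n r. G (n # r # xs)) n)"
    if "length xs = k" for n xs
  proof (induction n)
    case 0
    then show ?case using f[OF that] by (auto intro: rec_eval.prim_0)
  next
    case (Suc n)
    show ?case using rec_eval.prim_Suc[OF Suc g] that by simp
  qed
  then have "rec_eval (PrimRec f g) xs (rec_nat (F (tl xs)) (\<lambda>n r. G (n # r # tl xs)) (hd xs))"
    if "length xs = Suc k" for xs
    using that by (cases xs) auto
  then show ?thesis unfolding nat_computable_def by blast
qed

lemma nat_computable_Suc: "nat_computable 1 (\<lambda>xs. Suc (xs ! 0))"
proof -
  have "rec_eval Succ xs (Suc (xs ! 0))" if "length xs = 1" for xs
    using that by (auto simp: length_Suc_conv intro: rec_eval.succ)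
  then show ?thesis unfolding nat_computable_def by blast
qed

lemma nat_computable_const: "nat_computable k (\<lambda>xs. c)"
proof (induction c)
  case 0
  then show ?case unfolding nat_computable_def by (blast intro: rec_eval.zero)
next
  case (Suc c)
  from nat_computable_compose1[OF nat_computable_Suc this] show ?case by simp
qed

lemma nat_computable_Suc_comp: "nat_computable k F \<Longrightarrow> nat_computable k (\<lambda>xs. Suc (F xs))"
  using nat_computable_compose1[OF nat_computable_Suc, of k F] by simp

lemma length_eq_2_cases:
  assumes "length xs = 2"
  obtains a b where "xs = [a, b]"
  using assms by (auto simp: length_Suc_conv numeral_eq_Suc)

lemma nat_computable_add: "nat_computable 2 (\<lambda>xs. xs ! 0 + xs ! 1)"
proof (rule nat_computable_cong)
  show "nat_computable 2 (\<lambda>xs. rec_nat (tl xs ! 0) (\<lambda>n r. Suc ((n # r # tl xs) ! 1)) (hd xs))"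
    using nat_computable_rec_nat[OF nat_computable_nth[of 0 1]
        nat_computable_Suc_comp[OF nat_computable_nth[of 1 "Suc (Suc 1)"]]]
    by (simp add: numeral_2_eq_2)
  fix xs :: "nat list"
  assume "length xs = 2"
  then obtain a b where xs: "xs = [a, b]" by (rule length_eq_2_cases)
  have "rec_nat b (\<lambda>n. Suc) a = a + b" by (induction a) auto
  then show "rec_nat (tl xs ! 0) (\<lambda>n r. Suc ((n # r # tl xs) ! 1)) (hd xs) = xs ! 0 + xs ! 1"
    by (simp add: xs)
qed

lemma nat_computable_pred: "nat_computable 1 (\<lambda>xs. xs ! 0 - 1)"
proof (rule nat_computable_cong)
  show "nat_computable 1 (\<lambda>xs. rec_nat 0 (\<lambda>n r. (n # r # tl xs) ! 0) (hd xs))"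
    using nat_computable_rec_nat[OF nat_computable_const[of 0 0]
        nat_computable_nth[of 0 "Suc (Suc 0)"]] by simp
  fix xs :: "nat list"
  assume "length xs = 1"
  then obtain a where xs: "xs = [a]" by (auto simp: length_Suc_conv)
  show "rec_nat 0 (\<lambda>n r. (n # r # tl xs) ! 0) (hd xs) = xs ! 0 - 1"
    by (cases a) (auto simp: xs)
qed

lemma nat_computable_diff: "nat_computable 2 (\<lambda>xs. xs ! 0 - xs ! 1)"
proof (rule nat_computable_cong)
  have "nat_computable (Suc (Suc 1)) (\<lambda>xs. xs ! 1 - 1)"
    using nat_computable_compose1[OF nat_computable_pred nat_computable_nth[of 1 "Suc (Suc 1)"]]
    by simp
  from nat_computable_rec_nat[OF nat_computable_nth[of 0 1] this]
  have *: "nat_computable 2 (\<lambda>xs. rec_nat (tl xs ! 0) (\<lambda>n r. (n # r # tl xs) ! 1 - 1) (hd xs))"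
    by (simp add: numeral_2_eq_2)
  \<comment> \<open>Truncated subtraction recurses on the subtrahend, while \<open>PrimRec\<close>
    recurses on the first argument, so the two arguments are swapped by composition.\<close>
  show "nat_computable 2 (\<lambda>xs. rec_nat (tl [xs ! 1, xs ! 0] ! 0)
     (\<lambda>n r. (n # r # tl [xs ! 1, xs ! 0]) ! 1 - 1) (hd [xs ! 1, xs ! 0]))"
    by (rule nat_computable_compose2[OF *]) (simp_all add: nat_computable_nth)
  fix xs :: "nat list"
  have "rec_nat b (\<lambda>n r. r - Suc 0) a = b - a" for a b by (induction a) auto
  then show "rec_nat (tl [xs ! 1, xs ! 0] ! 0)
     (\<lambda>n r. (n # r # tl [xs ! 1, xs ! 0]) ! 1 - 1) (hd [xs ! 1, xs ! 0]) = xs ! 0 - xs ! 1"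
    by simp
qed

lemma nat_computable_if_zero: "nat_computable 3 (\<lambda>xs. if xs ! 0 = 0 then xs ! 1 else xs ! 2)"
proof (rule nat_computable_cong)
  \<comment> \<open>A recursion that ignores the previous value is a case distinction: the step sees
    counter, previous value and the two branches, so index 3 is the branch for nonzero
    arguments.\<close>
  show "nat_computable 3
    (\<lambda>xs. rec_nat (tl xs ! 0) (\<lambda>n r. (n # r # tl xs) ! 3) (hd xs))"
    using nat_computable_rec_nat[OF nat_computable_nth[of 0 2]
        nat_computable_nth[of 3 "Suc (Suc 2)"]] by (simp add: eval_nat_numeral)
  fix xs :: "nat list"
  assume "length xs = 3"
  then obtain a b c where xs: "xs = [a, b, c]" by (auto simp: length_Suc_conv numeral_eq_Suc)
  show "rec_nat (tl xs ! 0) (\<lambda>n r. (n # r # tl xs) ! 3) (hd xs)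
    = (if xs ! 0 = 0 then xs ! 1 else xs ! 2)"
    by (cases a) (auto simp: xs)
qed

section \<open>Triangular numbers, pairing and unpairing\<close>

lemma nat_computable_triangle: "nat_computable 1 (\<lambda>xs. triangle (xs ! 0))"
proof (rule nat_computable_cong)
  have "nat_computable (Suc (Suc 0)) (\<lambda>xs. [xs ! 1, Suc (xs ! 0)] ! 0 + [xs ! 1, Suc (xs ! 0)] ! 1)"
    by (rule nat_computable_compose2[OF nat_computable_add])
      (simp_all add: nat_computable_nth nat_computable_Suc_comp)
  from nat_computable_rec_nat[OF nat_computable_const[of 0 0] this]
  show "nat_computable 1 (\<lambda>xs. rec_nat 0 (\<lambda>n r. r + Suc n) (hd xs))" by simp
  fix xs :: "nat list"
  assume "length xs = 1"
  moreover have "rec_nat 0 (\<lambda>n r. r + Suc n) a = triangle a" for a by (induction a) auto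
  ultimately show "rec_nat 0 (\<lambda>n r. r + Suc n) (hd xs) = triangle (xs ! 0)"
    by (cases xs) auto
qed

lemma nat_computable_prod_encode: "nat_computable 2 (\<lambda>xs. prod_encode (xs ! 0, xs ! 1))"
proof -
  have "nat_computable 2 (\<lambda>xs. triangle (xs ! 0 + xs ! 1))"
    using nat_computable_compose1[OF nat_computable_triangle nat_computable_add] by simp
  from nat_computable_compose2[OF nat_computable_add this nat_computable_nth[of 0 2]]
  show ?thesis by (simp add: prod_encode_def)
qed

text \<open>The sum of the two components of \<open>prod_decode n\<close> is the largest \<open>k\<close> with
  \<open>triangle k \<le> n\<close>; unlike the components themselves it satisfies a primitive recursion
  without an auxiliary pair.\<close>

definition triangle_root :: "nat \<Rightarrow> nat" where
  "triangle_root n = rec_nat 0 (\<lambda>n r. if triangle (Suc r) - Suc n = 0 then Suc r else r) n"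

lemma triangle_root_bounds: "triangle (triangle_root n) \<le> n \<and> n < triangle (Suc (triangle_root n))"
  by (induction n) (auto simp: triangle_root_def)

lemma triangle_mono: "m \<le> n \<Longrightarrow> triangle m \<le> triangle n"
  by (induction n) (auto simp: le_Suc_eq)

text \<open>\<open>prod_encode (a, b)\<close> is \<open>triangle (a + b) + a\<close>, which stays
  below the next triangular number since \<open>a\<close> is at most \<open>a + b\<close>; the
  bounds on \<open>triangle_root\<close> then leave one value.\<close>

lemma triangle_root_prod_encode: "triangle_root (prod_encode (a, b)) = a + b"
proof -
  let ?n = "prod_encode (a, b)"
  have *: "triangle (a + b) \<le> ?n" "?n < triangle (Suc (a + b))"
    by (auto simp: prod_encode_def)
  have "\<not> triangle_root ?n < a + b"
    using triangle_mono[of "Suc (triangle_root ?n)" "a + b"] triangle_root_bounds[of ?n] * by auto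
  moreover have "\<not> a + b < triangle_root ?n"
    using triangle_mono[of "Suc (a + b)" "triangle_root ?n"] triangle_root_bounds[of ?n] * by auto
  ultimately show ?thesis by linarith
qed

lemma nat_computable_triangle_root: "nat_computable 1 (\<lambda>xs. triangle_root (xs ! 0))"
proof (rule nat_computable_cong)
  let ?c = "Suc (Suc 0)"
  have 1: "nat_computable ?c (\<lambda>xs. Suc (xs ! 1))" "nat_computable ?c (\<lambda>xs. Suc (xs ! 0))"
    "nat_computable ?c (\<lambda>xs. xs ! 1)"
    by (simp_all add: nat_computable_nth nat_computable_Suc_comp)
  have 2: "nat_computable ?c (\<lambda>xs. triangle (Suc (xs ! 1)))"
    using nat_computable_compose1[OF nat_computable_triangle 1(1)] by simp
  have 3: "nat_computable ?c (\<lambda>xs. triangle (Suc (xs ! 1)) - Suc (xs ! 0))"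
    using nat_computable_compose2[OF nat_computable_diff 2 1(2)] by simp
  have "nat_computable ?c (\<lambda>xs. if triangle (Suc (xs ! 1)) - Suc (xs ! 0) = 0 then Suc (xs ! 1)
      else xs ! 1)"
    using nat_computable_compose3[OF nat_computable_if_zero 3 1(1) 1(3)]
    by (simp del: triangle_Suc diff_is_0_eq add: numeral_2_eq_2 cong: if_cong)
  from nat_computable_rec_nat[OF nat_computable_const[of 0 0] this]
  show "nat_computable 1 (\<lambda>xs. triangle_root (hd xs))"
    by (simp add: triangle_root_def cong: if_cong)
  fix xs :: "nat list"
  assume "length xs = 1"
  then show "triangle_root (hd xs) = triangle_root (xs ! 0)" by (cases xs) auto
qed

text \<open>A code exceeds the triangular number of its diagonal by exactly its first
  component.\<close>

lemma nat_computable_fst_prod_decode: "nat_computable 1 (\<lambda>xs. fst (prod_decode (xs ! 0)))"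
proof (rule nat_computable_cong)
  have "nat_computable 1 (\<lambda>xs. triangle (triangle_root (xs ! 0)))"
    using nat_computable_compose1[OF nat_computable_triangle nat_computable_triangle_root] by simp
  from nat_computable_compose2[OF nat_computable_diff nat_computable_nth[of 0 1] this]
  show "nat_computable 1 (\<lambda>xs. xs ! 0 - triangle (triangle_root (xs ! 0)))" by simp
  fix xs :: "nat list"
  obtain a b where ab: "xs ! 0 = prod_encode (a, b)" by (metis prod_decode_inverse surj_pair)
  show "xs ! 0 - triangle (triangle_root (xs ! 0)) = fst (prod_decode (xs ! 0))"
    unfolding ab triangle_root_prod_encode prod_encode_inverse by (simp add: prod_encode_def)
qed

lemma nat_computable_snd_prod_decode: "nat_computable 1 (\<lambda>xs. snd (prod_decode (xs ! 0)))"
proof (rule nat_computable_cong)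
  from nat_computable_compose2[OF nat_computable_diff
      nat_computable_triangle_root nat_computable_fst_prod_decode]
  show "nat_computable 1 (\<lambda>xs. triangle_root (xs ! 0) - fst (prod_decode (xs ! 0)))" by simp
  fix xs :: "nat list"
  obtain a b where ab: "xs ! 0 = prod_encode (a, b)" by (metis prod_decode_inverse surj_pair)
  show "triangle_root (xs ! 0) - fst (prod_decode (xs ! 0)) = snd (prod_decode (xs ! 0))"
    unfolding ab triangle_root_prod_encode by simp
qed

text \<open>The second axiom makes \<open>hd\<close> of the empty list harmless: the code that is read off
  there is still the code of some value, so that programs terminate on it.\<close>

class encodable =
  fixes enc :: "'a \<Rightarrow> nat"
  assumes enc_inject: "enc x = enc y \<Longrightarrow> x = y"
    and enc_surj_0: "\<exists>x. enc x = 0"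

instantiation nat :: encodable
begin
definition enc_nat :: "nat \<Rightarrow> nat" where "enc_nat n = n"
instance by standard (auto simp: enc_nat_def)
end

instantiation bool :: encodable
begin
definition enc_bool :: "bool \<Rightarrow> nat" where "enc_bool b = (if b then 1 else 0)"
instance by standard (auto simp: enc_bool_def split: if_splits)
end

instantiation prod :: (encodable, encodable) encodable
begin
definition enc_prod :: "'a \<times> 'b \<Rightarrow> nat" where "enc_prod p = prod_encode (enc (fst p), enc (snd p))"
instance
proof
  show "x = y" if "enc x = enc y" for x y :: "'a \<times> 'b"
    using that by (auto simp: enc_prod_def prod_eq_iff dest: enc_inject)
  obtain a :: 'a and b :: 'b where "enc a = 0" "enc b = 0" using enc_surj_0 by metis
  then have "enc (a, b) = 0" by (simp add: enc_prod_def prod_encode_def)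
  then show "\<exists>x :: 'a \<times> 'b. enc x = 0" by blast
qed
end

instantiation list :: (encodable) encodable
begin
definition enc_list :: "'a list \<Rightarrow> nat" where "enc_list xs = list_encode (map enc xs)"
instance
proof
  show "x = y" if "enc x = enc y" for x y :: "'a list"
  proof -
    have "inj (enc :: 'a \<Rightarrow> nat)" by (rule injI) (rule enc_inject)
    moreover have "map enc x = map enc y" using that by (simp add: enc_list_def list_encode_eq)
    ultimately show ?thesis by (simp add: inj_map_eq_map)
  qed
  have "enc ([] :: 'a list) = 0" by (simp add: enc_list_def)
  then show "\<exists>x :: 'a list. enc x = 0" by blast
qed
end

text \<open>Programs are unary here: several arguments travel as one coded pair, so that a single
  notion covers functions between all encodable types and the variable \<open>x\<close> can serve as
  an environment for nested binders.\<close>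

definition computable :: "('a :: encodable \<Rightarrow> 'b :: encodable) \<Rightarrow> bool" where
  "computable f \<longleftrightarrow> (\<exists>r. \<forall>x. rec_eval r [enc x] (enc (f x)))"

text \<open>The rules collected here follow the syntax of a term, one per operation, so a definition
  is shown computable by unfolding it and applying them.\<close>

named_theorems comp_intros

lemma computable_ident [comp_intros]: "computable (\<lambda>x. x)"
  unfolding computable_def using rec_eval.proj[of 0] by (metis length_Cons nth_Cons_0 zero_less_Suc)

lemma computable_const [comp_intros]: "computable (\<lambda>x. c)"
  using nat_computable_const[of 1 "enc c"] unfolding computable_def nat_computable_def
  by (metis One_nat_def length_Cons list.size(3))

lemma computable_compose:
  assumes "computable g" "computable f" shows "computable (\<lambda>x. g (f x))"
proof -
  obtain r s where "\<And>x. rec_eval r [enc x] (enc (g x))" "\<And>x. rec_eval s [enc x] (enc (f x))"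
    using assms unfolding computable_def by blast
  then have "rec_eval (Comp r [s]) [enc x] (enc (g (f x)))" for x
    by (intro rec_eval.comp[where zs = "[enc (f x)]"]) auto
  then show ?thesis unfolding computable_def by blast
qed

lemma computable_via_nat1:
  assumes "nat_computable 1 F" "computable f" "\<And>x. enc (g x) = F [enc (f x)]"
  shows "computable g"
proof -
  obtain r s where "\<And>xs. length xs = 1 \<Longrightarrow> rec_eval r xs (F xs)"
    "\<And>x. rec_eval s [enc x] (enc (f x))"
    using assms unfolding computable_def nat_computable_def by blast
  then have "rec_eval (Comp r [s]) [enc x] (enc (g x))" for x
    unfolding assms(3) by (intro rec_eval.comp[where zs = "[enc (f x)]"]) auto
  then show ?thesis unfolding computable_def by blast
qed

lemma computable_via_nat2:
  assumes "nat_computable 2 F" "computable f1" "computable f2"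
    "\<And>x. enc (g x) = F [enc (f1 x), enc (f2 x)]"
  shows "computable g"
proof -
  obtain r s1 s2 where "\<And>xs. length xs = 2 \<Longrightarrow> rec_eval r xs (F xs)"
    "\<And>x. rec_eval s1 [enc x] (enc (f1 x))" "\<And>x. rec_eval s2 [enc x] (enc (f2 x))"
    using assms unfolding computable_def nat_computable_def by metis
  then have "rec_eval (Comp r [s1, s2]) [enc x] (enc (g x))" for x
    unfolding assms(4) by (intro rec_eval.comp[where zs = "[enc (f1 x), enc (f2 x)]"]) auto
  then show ?thesis unfolding computable_def by blast
qed

lemma computable_if [comp_intros]:
  assumes "computable b" "computable f" "computable g"
  shows "computable (\<lambda>x. if b x then f x else g x)"
proof -
  obtain r s1 s2 s3 where
    "\<And>xs. length xs = 3 \<Longrightarrow> rec_eval r xs (if xs ! 0 = 0 then xs ! 1 else xs ! 2)"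
    "\<And>x. rec_eval s1 [enc x] (enc (b x))" "\<And>x. rec_eval s2 [enc x] (enc (f x))"
    "\<And>x. rec_eval s3 [enc x] (enc (g x))"
    using assms nat_computable_if_zero unfolding computable_def nat_computable_def by metis
  note r = this
  \<comment> \<open>\<open>False\<close> has code 0, where the program \<open>r\<close> returns its
    second argument; hence the branch of \<open>g\<close> comes before that of
    \<open>f\<close>.\<close>
  have "rec_eval (Comp r [s1, s3, s2]) [enc x] (enc (if b x then f x else g x))" for x
    using r(1)[of "[enc (b x), enc (g x), enc (f x)]"] r(2-)
    by (intro rec_eval.comp[where zs = "[enc (b x), enc (g x), enc (f x)]"])
      (auto simp: enc_bool_def)
  then show ?thesis unfolding computable_def by blast
qed

lemma computable_Pair [comp_intros]:
  "computable f \<Longrightarrow> computable g \<Longrightarrow> computable (\<lambda>x. (f x, g x))"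
  by (erule (1) computable_via_nat2[OF nat_computable_prod_encode]) (simp add: enc_prod_def)

lemma computable_fst [comp_intros]: "computable f \<Longrightarrow> computable (\<lambda>x. fst (f x))"
  by (erule computable_via_nat1[OF nat_computable_fst_prod_decode]) (simp add: enc_prod_def)

lemma computable_snd [comp_intros]: "computable f \<Longrightarrow> computable (\<lambda>x. snd (f x))"
  by (erule computable_via_nat1[OF nat_computable_snd_prod_decode]) (simp add: enc_prod_def)

text \<open>Used to derive a rule for each defined function of two arguments from the computability
  of its uncurried form.\<close>

lemma computable_compose2:
  assumes "computable (\<lambda>p. f (fst p) (snd p))" "computable g" "computable h"
  shows "computable (\<lambda>x. f (g x) (h x))"
  using computable_compose[OF assms(1) computable_Pair[OF assms(2,3)]] by simp

lemma computable_compose3: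
  assumes "computable (\<lambda>p. f (fst p) (fst (snd p)) (snd (snd p)))"
    "computable g" "computable h" "computable k"
  shows "computable (\<lambda>x. f (g x) (h x) (k x))"
  using computable_compose[OF assms(1) computable_Pair[OF assms(2) computable_Pair[OF assms(3,4)]]]
  by simp

lemma computable_Suc [comp_intros]: "computable f \<Longrightarrow> computable (\<lambda>x. Suc (f x))"
  by (erule computable_via_nat1[OF nat_computable_Suc]) (simp add: enc_nat_def)

lemma computable_enc: "computable f \<Longrightarrow> computable (\<lambda>x. enc (f x))"
  unfolding computable_def enc_nat_def by simp

section \<open>Truth values, comparison and equality\<close>

lemma computable_Not [comp_intros]: "computable P \<Longrightarrow> computable (\<lambda>x. \<not> P x)"
  using computable_if[OF _ computable_const[of False] computable_const[of True], of P]
  by (simp add: if_bool_eq_conj)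

lemma computable_conj [comp_intros]: "computable P \<Longrightarrow> computable Q \<Longrightarrow> computable (\<lambda>x. P x \<and> Q x)"
  using computable_if[OF _ _ computable_const[of False], of P Q]
  by (simp add: if_bool_eq_disj)

lemma computable_disj [comp_intros]: "computable P \<Longrightarrow> computable Q \<Longrightarrow> computable (\<lambda>x. P x \<or> Q x)"
  using computable_Not[OF computable_conj[OF computable_Not computable_Not], of P Q] by simp

lemma computable_imp [comp_intros]: "computable P \<Longrightarrow> computable Q \<Longrightarrow> computable (\<lambda>x. P x \<longrightarrow> Q x)"
  using computable_disj[OF computable_Not, of P Q] by simp

text \<open>\<open>Suc (f x) - g x\<close> vanishes exactly when \<open>f x < g x\<close>;
  subtracting it from 1 gives the code of the truth value.\<close>

lemma computable_less [comp_intros]: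
  assumes "computable f" "computable g" shows "computable (\<lambda>x. f x < (g x :: nat))"
proof -
  have 1: "computable (\<lambda>x. Suc (f x) - g x)"
    by (rule computable_via_nat2[OF nat_computable_diff computable_Suc[OF assms(1)] assms(2)])
      (simp add: enc_nat_def)
  have "nat_computable 1 (\<lambda>xs. 1 - xs ! 0)"
    using nat_computable_compose2[OF nat_computable_diff nat_computable_const[of 1 1]
        nat_computable_nth[of 0 1]] by simp
  then show ?thesis
    by (rule computable_via_nat1[OF _ 1]) (auto simp: enc_nat_def enc_bool_def)
qed

text \<open>Codes are injective, so equality in any encodable type reduces to two comparisons of
  numbers, without recursion on the type.\<close>

lemma computable_eq [comp_intros]:
  assumes "computable f" "computable g" shows "computable (\<lambda>x. f x = g x)"
proof -
  have "computable (\<lambda>x. \<not> enc (f x) < enc (g x) \<and> \<not> enc (g x) < enc (f x))"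
    by (intro comp_intros computable_enc assms)
  moreover have "(\<not> enc (f x) < enc (g x) \<and> \<not> enc (g x) < enc (f x)) \<longleftrightarrow> f x = g x" for x
    by (metis enc_inject nat_neq_iff)
  ultimately show ?thesis by simp
qed

lemma computable_rec_nat:
  assumes "computable f" "computable (\<lambda>p. g (fst p) (fst (snd p)) (snd (snd p)))" "computable h"
  shows "computable (\<lambda>x. rec_nat (f x) (g x) (h x))"
proof -
  obtain rf rg rh rp where
    rf: "\<And>x. rec_eval rf [enc x] (enc (f x))" and
    rg: "\<And>p. rec_eval rg [enc p] (enc (g (fst p) (fst (snd p)) (snd (snd p))))" and
    rh: "\<And>x. rec_eval rh [enc x] (enc (h x))" and
    rp: "\<And>xs. length xs = 2 \<Longrightarrow> rec_eval rp xs (prod_encode (xs ! 0, xs ! 1))"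
    using assms nat_computable_prod_encode unfolding computable_def nat_computable_def by metis
  \<comment> \<open>\<open>PrimRec\<close> supplies counter, previous value and parameter as three
    arguments, whereas \<open>rg\<close> reads a single code of the triple \<open>(x, n, r)\<close>;
    \<open>G\<close> repacks them.\<close>
  define G where "G = Comp rg [Comp rp [Proj 2, Comp rp [Proj 0, Proj 1]]]"
  have G: "rec_eval G [n, enc r, enc x] (enc (g x n r))" for n r x
  proof -
    have 1: "rec_eval (Comp rp [Proj 0, Proj 1]) [n, enc r, enc x] (enc (n, r))"
      using rp[of "[n, enc r]"] rec_eval.proj[of 0 "[n, enc r, enc x]"]
        rec_eval.proj[of 1 "[n, enc r, enc x]"]
      by (intro rec_eval.comp[where zs = "[n, enc r]"]) (auto simp: enc_prod_def enc_nat_def)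
    have "rec_eval (Comp rp [Proj 2, Comp rp [Proj 0, Proj 1]]) [n, enc r, enc x] (enc (x, n, r))"
      using 1 rp[of "[enc x, enc (n, r)]"] rec_eval.proj[of 2 "[n, enc r, enc x]"]
      by (intro rec_eval.comp[where zs = "[enc x, enc (n, r)]"]) (auto simp: enc_prod_def)
    then show ?thesis
      unfolding G_def using rg[of "(x, n, r)"]
      by (intro rec_eval.comp[where zs = "[enc (x, n, r)]"]) auto
  qed
  have P: "rec_eval (PrimRec rf G) [n, enc x] (enc (rec_nat (f x) (g x) n))" for n x
  proof (induction n)
    case 0
    then show ?case using rf by (auto intro: rec_eval.prim_0)
  next
    case (Suc n)
    show ?case using rec_eval.prim_Suc[OF Suc G] by simp
  qed
  have "rec_eval (Comp (PrimRec rf G) [rh, Proj 0]) [enc x] (enc (rec_nat (f x) (g x) (h x)))" for x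
    using P[of "h x" x] rh[of x] rec_eval.proj[of 0 "[enc x]"]
    by (intro rec_eval.comp[where zs = "[h x, enc x]"]) (auto simp: enc_nat_def)
  then show ?thesis unfolding computable_def by blast
qed

lemma computable_Cons [comp_intros]:
  assumes "computable f" "computable g" shows "computable (\<lambda>x. f x # g x)"
  by (rule computable_via_nat2[OF nat_computable_Suc_comp[OF nat_computable_prod_encode] assms])
    (simp add: enc_list_def)

text \<open>The empty list has code 0, and predecessor and first projection send 0 to 0. The default
  is therefore the value that the program for the head really produces there.\<close>

definition head0 :: "'a :: encodable list \<Rightarrow> 'a" where
  "head0 xs = (if xs = [] then (SOME x. enc x = 0) else hd xs)"

lemma prod_decode_0: "prod_decode 0 = (0, 0)"
  using prod_encode_inverse[of "(0, 0)"] by (simp add: prod_encode_def)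

lemma computable_head0:
  assumes "computable f" shows "computable (\<lambda>x. head0 (f x))"
proof -
  have F: "nat_computable 1 (\<lambda>xs. fst (prod_decode (xs ! 0 - 1)))"
    using nat_computable_compose1[OF nat_computable_fst_prod_decode nat_computable_pred] by simp
  have z: "enc (SOME x :: 'b. enc x = 0) = 0" by (rule someI_ex) (rule enc_surj_0)
  show ?thesis
  proof (rule computable_via_nat1[OF F assms])
    show "enc (head0 (f x)) = fst (prod_decode ([enc (f x)] ! 0 - 1))" for x
      by (cases "f x") (auto simp: head0_def z enc_list_def prod_decode_0)
  qed
qed

lemma computable_tl: assumes "computable f" shows "computable (\<lambda>x. tl (f x))"
proof -
  have F: "nat_computable 1 (\<lambda>xs. snd (prod_decode (xs ! 0 - 1)))"
    using nat_computable_compose1[OF nat_computable_snd_prod_decode nat_computable_pred] by simp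
  show ?thesis
  proof (rule computable_via_nat1[OF F assms])
    show "enc (tl (f x)) = snd (prod_decode ([enc (f x)] ! 0 - 1))" for x
      by (cases "f x") (auto simp: enc_list_def prod_decode_0)
  qed
qed

text \<open>Supplies an iteration count for folds: the code of a list is available as a number
  before its length is known to be computable.\<close>

lemma length_le_enc: "length xs \<le> enc xs"
proof (induction xs)
  case (Cons x xs)
  then show ?case
    using le_prod_encode_2[of "enc xs" "enc x"] by (simp add: enc_list_def)
qed simp

text \<open>The recursion runs on a state of remaining list and accumulator, with the code of the
  list as number of rounds. This is at least the length, and the surplus rounds leave a state with
  empty list unchanged.\<close>

lemma computable_foldl:
  assumes "computable a" "computable (\<lambda>p. g (fst p) (fst (snd p)) (snd (snd p)))" "computable l"
  shows "computable (\<lambda>x. foldl (g x) (a x) (l x))"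
proof -
  let ?step = "\<lambda>x (n :: nat) st. if fst st = [] then st
    else (tl (fst st), g x (snd st) (head0 (fst st)))"
  have g: "computable (\<lambda>x. g (u x) (v x) (w x))" if "computable u" "computable v" "computable w"
    for u :: "_ \<Rightarrow> 'a" and v w
    using computable_compose[OF assms(2) computable_Pair[OF that(1) computable_Pair[OF that(2,3)]]]
    by simp
  have c: "computable (\<lambda>x. snd (rec_nat (l x, a x) (?step x) (enc (l x))))"
    by (intro comp_intros computable_rec_nat g computable_head0 computable_tl computable_enc assms)
  have it: "snd (rec_nat (xs, b) (?step x) n) = foldl (g x) b xs" if "length xs \<le> n" for xs b n x
  proof -
    have "rec_nat (xs, b) (?step x) k = (drop k xs, foldl (g x) b (take k xs))" for k
    proof (induction k)
      case (Suc k)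
      show ?case
      proof (cases "k < length xs")
        case True
        then have "drop k xs \<noteq> []" by simp
        moreover have "head0 (drop k xs) = xs ! k" using True by (simp add: head0_def hd_drop_conv_nth)
        ultimately show ?thesis
          using Suc True by (simp add: take_Suc_conv_app_nth drop_Suc tl_drop)
      qed (use Suc in auto)
    qed simp
    then show ?thesis using that by simp
  qed
  show ?thesis using c unfolding it[OF length_le_enc] .
qed

section \<open>List operations and bounded quantifiers as folds\<close>

lemma computable_rev [comp_intros]:
  assumes "computable l" shows "computable (\<lambda>x. rev (l x))"
proof -
  have "foldl (\<lambda>a y. y # a) [] xs = rev xs" for xs :: "'b list"
    by (simp add: foldl_conv_fold fold_Cons_rev)
  moreover have "computable (\<lambda>x. foldl (\<lambda>a y. y # a) [] (l x))"
    by (intro comp_intros computable_foldl assms)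
  ultimately show ?thesis by simp
qed

lemma computable_foldr [comp_intros]:
  assumes "computable (\<lambda>p. g (fst p) (fst (snd p)) (snd (snd p)))" "computable l" "computable a"
  shows "computable (\<lambda>x. foldr (g x) (l x) (a x))"
proof -
  have g: "computable (\<lambda>x. g (u x) (v x) (w x))" if "computable u" "computable v" "computable w"
    for u :: "_ \<Rightarrow> 'a" and v w
    using computable_compose[OF assms(1) computable_Pair[OF that(1) computable_Pair[OF that(2,3)]]]
    by simp
  have "computable (\<lambda>x. foldl (\<lambda>b y. g x y b) (a x) (rev (l x)))"
    by (intro comp_intros computable_foldl g assms)
  then show ?thesis by (simp add: foldl_conv_foldr)
qed

lemma computable_map [comp_intros]:
  assumes "computable (\<lambda>p. f (fst p) (snd p))" "computable l"
  shows "computable (\<lambda>x. map (f x) (l x))"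
proof -
  have f: "computable (\<lambda>x. f (u x) (v x))" if "computable u" "computable v" for u :: "_ \<Rightarrow> 'a" and v
    using computable_compose[OF assms(1) computable_Pair[OF that]] by simp
  have "computable (\<lambda>x. foldr (\<lambda>y ys. f x y # ys) (l x) [])"
    by (intro comp_intros f assms)
  moreover have "foldr (\<lambda>y ys. f x y # ys) xs [] = map (f x) xs" for x xs
    by (induction xs) auto
  ultimately show ?thesis by simp
qed

lemma computable_filter [comp_intros]:
  assumes "computable (\<lambda>p. f (fst p) (snd p))" "computable l"
  shows "computable (\<lambda>x. filter (f x) (l x))"
proof -
  have f: "computable (\<lambda>x. f (u x) (v x))" if "computable u" "computable v" for u :: "_ \<Rightarrow> 'a" and v
    using computable_compose[OF assms(1) computable_Pair[OF that]] by simp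
  have "computable (\<lambda>x. foldr (\<lambda>y ys. if f x y then y # ys else ys) (l x) [])"
    by (intro comp_intros f assms)
  moreover have "foldr (\<lambda>y ys. if f x y then y # ys else ys) xs [] = filter (f x) xs" for x xs
    by (induction xs) auto
  ultimately show ?thesis by simp
qed

lemma computable_Ball_set [comp_intros]:
  assumes "computable (\<lambda>p. f (fst p) (snd p))" "computable l"
  shows "computable (\<lambda>x. \<forall>y\<in>set (l x). f x y)"
proof -
  have f: "computable (\<lambda>x. f (u x) (v x))" if "computable u" "computable v" for u :: "_ \<Rightarrow> 'a" and v
    using computable_compose[OF assms(1) computable_Pair[OF that]] by simp
  have "computable (\<lambda>x. foldr (\<lambda>y b. f x y \<and> b) (l x) True)"
    by (intro comp_intros f assms)
  moreover have "foldr (\<lambda>y b. f x y \<and> b) xs True \<longleftrightarrow> (\<forall>y\<in>set xs. f x y)" for x xs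
    by (induction xs) auto
  ultimately show ?thesis by simp
qed

lemma computable_Bex_set [comp_intros]:
  assumes "computable (\<lambda>p. f (fst p) (snd p))" "computable l"
  shows "computable (\<lambda>x. \<exists>y\<in>set (l x). f x y)"
  using computable_Not[OF computable_Ball_set[OF computable_Not[OF assms(1)] assms(2)]] by simp

lemma computable_in_set [comp_intros]:
  assumes "computable f" "computable l" shows "computable (\<lambda>x. f x \<in> set (l x))"
proof -
  have "computable (\<lambda>x. \<exists>y\<in>set (l x). f x = y)"
    by (intro comp_intros assms computable_compose[OF assms(1)])
  then show ?thesis by simp
qed

lemma computable_append [comp_intros]:
  assumes "computable f" "computable g" shows "computable (\<lambda>x. f x @ g x)"
proof -
  have "computable (\<lambda>x. foldr (\<lambda>y ys. y # ys) (f x) (g x))"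
    by (intro comp_intros assms)
  moreover have "foldr (\<lambda>y ys. y # ys) xs ys = xs @ ys" for xs ys :: "'b list"
    by (induction xs) auto
  ultimately show ?thesis by simp
qed

lemma computable_concat [comp_intros]:
  assumes "computable f" shows "computable (\<lambda>x. concat (f x))"
  unfolding concat_conv_foldr by (intro comp_intros assms)

lemma computable_length [comp_intros]:
  assumes "computable f" shows "computable (\<lambda>x. length (f x))"
proof -
  have "computable (\<lambda>x. foldr (\<lambda>_. Suc) (f x) 0)"
    by (intro comp_intros assms)
  moreover have "foldr (\<lambda>_. Suc) xs 0 = length xs" for xs :: "'b list"
    by (induction xs) auto
  ultimately show ?thesis by simp
qed

lemma computable_remdups [comp_intros]:
  assumes "computable f" shows "computable (\<lambda>x. remdups (f x))"
proof -
  have "computable (\<lambda>x. foldr (\<lambda>y ys. if y \<in> set ys then ys else y # ys) (f x) [])"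
    by (intro comp_intros assms)
  moreover have "foldr (\<lambda>y ys. if y \<in> set ys then ys else y # ys) xs [] = remdups xs"
    for xs :: "'b list"
    by (induction xs) auto
  ultimately show ?thesis by simp
qed

lemma computable_subseqs [comp_intros]:
  assumes "computable f" shows "computable (\<lambda>x. subseqs (f x))"
proof -
  have "computable (\<lambda>x. foldr (\<lambda>y yss. map (\<lambda>ys. y # ys) yss @ yss) (f x) [[]])"
    by (intro comp_intros assms)
  moreover have "foldr (\<lambda>y yss. map (\<lambda>ys. y # ys) yss @ yss) xs [[]] = subseqs xs"
    for xs :: "'b list"
    by (induction xs) (auto simp: Let_def)
  ultimately show ?thesis by simp
qed

lemma computable_product [comp_intros]:
  assumes "computable f" "computable g" shows "computable (\<lambda>x. List.product (f x) (g x))"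
  unfolding product_concat_map
  by (intro comp_intros assms computable_compose[OF assms(2)])

section \<open>Order isomorphism and standardization\<close>

lemma order_iso_map:
  assumes "\<And>x y. x \<in> set s \<Longrightarrow> y \<in> set s \<Longrightarrow> x < y \<longleftrightarrow> f x < f y"
  shows "order_iso s (map f s)"
  using assms by (simp add: order_iso_def)

text \<open>Turns a condition on positions into a strictly monotone relabelling of values, the form
  in which words are transported later. Repeated entries cause no conflict: positions with equal
  entries on one side are incomparable, hence equal, on the other.\<close>

lemma order_iso_imp_map:
  assumes "order_iso s t"
  shows "\<exists>f. t = map f s \<and> (\<forall>x\<in>set s. \<forall>y\<in>set s. x < y \<longleftrightarrow> f x < f y)"
proof -
  define idx where "idx x = (SOME i. i < length s \<and> s ! i = x)" for x
  have idx: "idx x < length s \<and> s ! idx x = x" if "x \<in> set s" for x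
    unfolding idx_def by (rule someI_ex) (use that in \<open>auto simp: in_set_conv_nth\<close>)
  have len: "length t = length s"
    and less: "\<And>i j. i < length s \<Longrightarrow> j < length s \<Longrightarrow> s ! i < s ! j \<longleftrightarrow> t ! i < t ! j"
    using assms by (auto simp: order_iso_def)
  have "t = map (\<lambda>x. t ! idx x) s"
  proof (rule nth_equalityI)
    fix i assume i: "i < length t"
    let ?k = "idx (s ! i)"
    have k: "?k < length s" "s ! ?k = s ! i" using idx[of "s ! i"] i len by auto
    have "\<not> t ! i < t ! ?k" "\<not> t ! ?k < t ! i"
      using less[of i ?k] less[of ?k i] k i len by auto
    then show "t ! i = map (\<lambda>x. t ! idx x) s ! i" using i len by simp
  qed (simp add: len)
  moreover have "x < y \<longleftrightarrow> t ! idx x < t ! idx y" if "x \<in> set s" "y \<in> set s" for x y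
    using idx[OF that(1)] idx[OF that(2)] less by metis
  ultimately show ?thesis by blast
qed

lemma order_iso_refl [simp]: "order_iso s s"
  by (simp add: order_iso_def)

lemma order_iso_sym: "order_iso s t \<Longrightarrow> order_iso t s"
  by (simp add: order_iso_def)

lemma order_iso_trans: "order_iso s t \<Longrightarrow> order_iso t u \<Longrightarrow> order_iso s u"
  by (simp add: order_iso_def)

lemma order_iso_length: "order_iso s t \<Longrightarrow> length s = length t"
  by (simp add: order_iso_def)

lemma order_iso_distinct: "order_iso s t \<Longrightarrow> distinct s \<Longrightarrow> distinct t"
  unfolding order_iso_def distinct_conv_nth by (metis nat_neq_iff)

text \<open>Replaces each entry by its rank, counted from 1. On nonempty words with distinct entries
  this picks the unique permutation of the order-isomorphism class.\<close>

definition standardize :: "nat list \<Rightarrow> nat list" where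
  "standardize xs = map (\<lambda>x. Suc (length (filter (\<lambda>y. y < x) xs))) xs"

lemma length_standardize [simp]: "length (standardize xs) = length xs"
  by (simp add: standardize_def)

lemma standardize_eq_Nil [simp]: "standardize xs = [] \<longleftrightarrow> xs = []"
  by (simp add: standardize_def)

lemma order_iso_standardize: "order_iso xs (standardize xs)"
  unfolding standardize_def
proof (rule order_iso_map)
  fix x y assume "x \<in> set xs" "y \<in> set xs"
  let ?I = "\<lambda>x. {i. i < length xs \<and> xs ! i < x}"
  have L: "length (filter (\<lambda>y. y < x) xs) = card (?I x)" for x
    by (rule length_filter_conv_card)
  have "card (?I x) < card (?I y)" if "x < y"
  proof (rule psubset_card_mono)
    obtain i where "i < length xs" "xs ! i = x" using \<open>x \<in> set xs\<close> by (auto simp: in_set_conv_nth)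
    then have "i \<in> ?I y - ?I x" using that by simp
    moreover have "?I x \<subseteq> ?I y" using that by auto
    ultimately show "?I x \<subset> ?I y" by blast
  qed simp
  moreover have "card (?I y) \<le> card (?I x)" if "\<not> x < y"
    by (rule card_mono) (use that in auto)
  ultimately show "x < y \<longleftrightarrow> Suc (length (filter (\<lambda>y. y < x) xs)) < Suc (length (filter (\<lambda>z. z < y) xs))"
    unfolding L by linarith
qed

lemma standardize_cong: "order_iso xs ys \<Longrightarrow> standardize xs = standardize ys"
proof -
  assume "order_iso xs ys"
  then obtain f where f: "ys = map f xs" "\<forall>x\<in>set xs. \<forall>y\<in>set xs. x < y \<longleftrightarrow> f x < f y"
    using order_iso_imp_map by blast
  have "filter (\<lambda>y. f y < f x) xs = filter (\<lambda>y. y < x) xs" if "x \<in> set xs" for x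
    by (rule filter_cong) (use f(2) that in auto)
  then show ?thesis by (simp add: f(1) standardize_def filter_map o_def)
qed

lemma is_perm_standardize:
  assumes "distinct xs" "xs \<noteq> []" shows "is_perm (standardize xs)"
proof -
  have d: "distinct (standardize xs)"
    using order_iso_distinct[OF order_iso_standardize assms(1)] .
  have "set (standardize xs) \<subseteq> {1..length xs}"
    by (auto simp: standardize_def Suc_le_eq intro: length_filter_less)
  moreover have "card (set (standardize xs)) = card {1..length xs}"
    using distinct_card[OF d] by simp
  ultimately have "set (standardize xs) = {1..length xs}" by (simp add: card_subset_eq)
  then show ?thesis using d assms(2) by (simp add: is_perm_def)
qed

lemma standardize_perm:
  assumes "is_perm p" shows "standardize p = p"
  unfolding standardize_def
proof (rule map_idI)
  fix x assume x: "x \<in> set p"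
  have "length (filter (\<lambda>y. y < x) p) = card {y \<in> set p. y < x}"
    using assms distinct_card[of "filter (\<lambda>y. y < x) p"] by (simp add: is_perm_def Int_def)
  also have "{y \<in> set p. y < x} = {1..<x}"
    using assms x by (auto simp: is_perm_def)
  finally show "Suc (length (filter (\<lambda>y. y < x) p)) = x"
    using assms x by (auto simp: is_perm_def)
qed

lemma is_permD: "is_perm p \<Longrightarrow> distinct p" "is_perm p \<Longrightarrow> p \<noteq> []"
  by (auto simp: is_perm_def)

lemma is_perm_1 [simp]: "is_perm [1]" "is_perm [Suc 0]"
  by (auto simp: is_perm_def)

lemma is_perm_12 [simp]: "is_perm [1, 2]" "is_perm [2, 1]" "is_perm [Suc 0, 2]" "is_perm [2, Suc 0]"
  by (auto simp: is_perm_def atLeastAtMost_def atLeast_def atMost_def)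

lemma is_perm_length_1: "is_perm p \<Longrightarrow> length p = 1 \<Longrightarrow> p = [1]"
proof -
  assume "is_perm p" "length p = 1"
  moreover then obtain x where "p = [x]" by (cases p) auto
  ultimately show ?thesis by (simp add: is_perm_def)
qed

lemma order_iso_perm: "order_iso p xs \<Longrightarrow> is_perm p \<Longrightarrow> p = standardize xs"
  using standardize_cong standardize_perm by metis

lemma order_iso_perm_eq: "order_iso p q \<Longrightarrow> is_perm p \<Longrightarrow> is_perm q \<Longrightarrow> p = q"
  using standardize_cong standardize_perm by metis

section \<open>Containment up to order isomorphism\<close>

lemma subseq_order_iso:
  assumes "subseq ys s" "order_iso s t"
  shows "\<exists>zs. subseq zs t \<and> order_iso ys zs"
proof -
  obtain f where f: "t = map f s" "\<forall>x\<in>set s. \<forall>y\<in>set s. x < y \<longleftrightarrow> f x < f y"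
    using order_iso_imp_map[OF assms(2)] by blast
  have "subseq (map f ys) t" unfolding f(1) by (rule subseq_map) (rule assms(1))
  moreover have "order_iso ys (map f ys)"
    by (rule order_iso_map) (use f(2) assms(1) in \<open>auto dest: list_emb_set\<close>)
  ultimately show ?thesis by blast
qed

lemma pattern_order_iso: "p \<preceq> s \<Longrightarrow> order_iso s t \<Longrightarrow> p \<preceq> t"
  unfolding pattern_of_def using subseq_order_iso order_iso_trans by metis

lemma pattern_order_iso_left: "p \<preceq> s \<Longrightarrow> order_iso p q \<Longrightarrow> q \<preceq> s"
  unfolding pattern_of_def using order_iso_sym order_iso_trans by metis

lemma pattern_subseq: "subseq p s \<Longrightarrow> p \<preceq> s"
  unfolding pattern_of_def using order_iso_refl by blast

lemma pattern_trans: "p \<preceq> q \<Longrightarrow> q \<preceq> s \<Longrightarrow> p \<preceq> s"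
  unfolding pattern_of_def
  by (metis subseq_order_iso order_iso_trans subseq_order.order_trans)

lemma pattern_length: "p \<preceq> s \<Longrightarrow> length p \<le> length s"
  unfolding pattern_of_def using list_emb_length order_iso_length by metis

lemma pattern_length_eq: "p \<preceq> s \<Longrightarrow> length p = length s \<Longrightarrow> is_perm p \<Longrightarrow> is_perm s \<Longrightarrow> p = s"
  unfolding pattern_of_def by (metis order_iso_length order_iso_perm_eq subseq_same_length)

section \<open>Substitution as a layered list of blocks\<close>

text \<open>Labels play the role of quotient entries: blocks compare as wholes in the way their
  labels do. Blocks may be empty and values need not be consecutive, so the notion also fits the
  pieces of an occurrence.\<close>

definition layered :: "(nat \<times> nat list) list \<Rightarrow> bool" where
  "layered zs \<longleftrightarrow> (\<forall>z\<in>set zs. \<forall>z'\<in>set zs. fst z < fst z' \<longrightarrow>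
     (\<forall>x\<in>set (snd z). \<forall>y\<in>set (snd z'). x < y))"

lemma layered_mono: "layered zs \<Longrightarrow> set zs' \<subseteq> set zs \<Longrightarrow> layered zs'"
  unfolding layered_def by blast

lemma layeredD:
  "layered zs \<Longrightarrow> (a, w) \<in> set zs \<Longrightarrow> (b, v) \<in> set zs \<Longrightarrow> a < b \<Longrightarrow> x \<in> set w \<Longrightarrow> y \<in> set v \<Longrightarrow> x < y"
  unfolding layered_def by (drule (1) bspec, drule (1) bspec) simp

lemma layered_zip_nth:
  assumes "length ws = length q"
  shows "layered (zip q ws) \<longleftrightarrow> (\<forall>i<length q. \<forall>j<length q. q ! i < q ! j \<longrightarrow>
     (\<forall>x\<in>set (ws ! i). \<forall>y\<in>set (ws ! j). x < y))"
proof
  assume l: "layered (zip q ws)"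
  have "(q ! i, ws ! i) \<in> set (zip q ws)" if "i < length q" for i
    using that assms by (auto simp: set_zip)
  then show "\<forall>i<length q. \<forall>j<length q. q ! i < q ! j \<longrightarrow>
     (\<forall>x\<in>set (ws ! i). \<forall>y\<in>set (ws ! j). x < y)"
    using layeredD[OF l] by blast
qed (use assms in \<open>auto simp: layered_def set_zip\<close>)

text \<open>The monotone maps of the single blocks glue to one map: blocks with distinct labels
  share no entry, so \<open>idx\<close> recovers the block of a value, and between different blocks
  the labels decide the order on both sides.\<close>

lemma layered_order_iso_concat:
  assumes "layered (zip q ws)" "layered (zip q vs)" "distinct q"
    "length ws = length q" "list_all2 order_iso ws vs"
  shows "order_iso (concat ws) (concat vs)"
proof -
  let ?n = "length q"
  have len: "length vs = ?n" using assms(4,5) by (auto dest: list_all2_lengthD)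
  have oi: "order_iso (ws ! i) (vs ! i)" if "i < ?n" for i
    using assms(4,5) that by (auto simp: list_all2_conv_all_nth)
  have "\<exists>f. vs ! i = map f (ws ! i) \<and>
      (\<forall>x\<in>set (ws ! i). \<forall>y\<in>set (ws ! i). x < y \<longleftrightarrow> f x < f y)" if "i < ?n" for i
    using order_iso_imp_map[OF oi[OF that]] .
  then obtain f where f: "\<And>i. i < ?n \<Longrightarrow> vs ! i = map (f i) (ws ! i)"
      "\<And>i x y. i < ?n \<Longrightarrow> x \<in> set (ws ! i) \<Longrightarrow> y \<in> set (ws ! i) \<Longrightarrow> x < y \<longleftrightarrow> f i x < f i y"
    by metis
  note lw = assms(1)[unfolded layered_zip_nth[OF assms(4)], rule_format]
  note lv = assms(2)[unfolded layered_zip_nth[OF len], rule_format]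
  define idx where "idx x = (SOME i. i < ?n \<and> x \<in> set (ws ! i))" for x
  have idx: "idx x = i" if "i < ?n" "x \<in> set (ws ! i)" for i x
    unfolding idx_def
  proof (rule some_equality)
    fix j assume j: "j < ?n \<and> x \<in> set (ws ! j)"
    show "j = i"
    proof (rule ccontr)
      assume "j \<noteq> i"
      then have "q ! i < q ! j \<or> q ! j < q ! i"
        using assms(3) j that by (metis nat_neq_iff nth_eq_iff_index_eq)
      then show False using lw[of i j x x] lw[of j i x x] j that by blast
    qed
  qed (use that in simp)
  define F where "F x = f (idx x) x" for x
  have "vs = map (map F) ws"
  proof (rule nth_equalityI)
    fix i assume "i < length vs"
    then show "vs ! i = map (map F) ws ! i"
      using len assms(4) idx f(1) by (auto simp: F_def)
  qed (simp add: len assms(4))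
  then have v: "concat vs = map F (concat ws)" by (simp add: map_concat)
  have "x < y \<longleftrightarrow> F x < F y" if xy: "x \<in> set (concat ws)" "y \<in> set (concat ws)" for x y
  proof -
    obtain i j where i: "i < ?n" "x \<in> set (ws ! i)" and j: "j < ?n" "y \<in> set (ws ! j)"
      using xy assms(4) by (auto simp: in_set_conv_nth[of _ ws])
    have F: "F x = f i x" "F y = f j y" using idx i j by (auto simp: F_def)
    have Fv: "F x \<in> set (vs ! i)" "F y \<in> set (vs ! j)" using F f(1) i j by auto
    consider "i = j" | "q ! i < q ! j" | "q ! j < q ! i"
      using assms(3) i j by (metis nat_neq_iff nth_eq_iff_index_eq)
    then show ?thesis
    proof cases
      case 1
      then show ?thesis using f(2) i j F by simp
    next
      case 2
      then show ?thesis using lw[of i j x y] lv[of i j "F x" "F y"] i j Fv len by simp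
    next
      case 3
      then show ?thesis using lw[of j i y x] lv[of j i "F y" "F x"] i j Fv len
        by (meson not_less_iff_gr_or_eq)
    qed
  qed
  then show ?thesis unfolding v by (rule order_iso_map)
qed

text \<open>An entry common to two blocks with different labels would be smaller than
  itself.\<close>

lemma distinct_concat_layered:
  "length q = length ws \<Longrightarrow> distinct q \<Longrightarrow> layered (zip q ws) \<Longrightarrow> \<forall>w\<in>set ws. distinct w \<Longrightarrow>
    distinct (concat ws)"
proof (induction q ws rule: list_induct2)
  case (Cons a q w ws)
  have "layered (zip q ws)" using Cons.prems(2) by (rule layered_mono) auto
  then have "distinct (concat ws)" using Cons by simp
  moreover have "x \<notin> set v" if x: "x \<in> set w" "v \<in> set ws" for x v
  proof
    assume xv: "x \<in> set v"
    obtain b where b: "(b, v) \<in> set (zip q ws)"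
      using x(2) Cons.hyps by (metis in_set_impl_in_set_zip2)
    have "b \<in> set q" using b by (rule set_zip_leftD)
    then have "a < b \<or> b < a" using Cons.prems(1) by (metis distinct.simps(2) nat_neq_iff)
    then show False
      using layeredD[OF Cons.prems(2), of a w b v x x] layeredD[OF Cons.prems(2), of b v a w x x]
        x xv b by auto
  qed
  ultimately show ?case using Cons.prems(3) by auto
qed simp

text \<open>Translates the arithmetic of \<open>inflate\<close> into a layered list once and for
  all. The original components are the standardizations of the shifted blocks, so nothing is lost in
  passing to \<open>ws\<close>.\<close>

lemma inflate_blocks:
  assumes q: "is_perm q" and len: "length ps = length q" and ps: "\<forall>p\<in>set ps. is_perm p"
  obtains ws where "inflate q ps = concat ws" "length ws = length q" "layered (zip q ws)"
    "ps = map standardize ws" "[] \<notin> set ws" "is_perm (inflate q ps)"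
proof -
  let ?n = "length q"
  define sh where "sh i = (\<Sum>j | j < ?n \<and> q ! j < q ! i. length (ps ! j))" for i
  define ws where "ws = map (\<lambda>i. map (\<lambda>x. x + sh i) (ps ! i)) [0..<?n]"
  have inf: "inflate q ps = concat ws" by (simp add: inflate_def ws_def sh_def)
  have lws: "length ws = ?n" by (simp add: ws_def)
  have nth: "ws ! i = map (\<lambda>x. x + sh i) (ps ! i)" if "i < ?n" for i
    using that by (simp add: ws_def)
  have perm: "is_perm (ps ! i)" if "i < ?n" for i using that ps len by simp
  have rng: "sh i < x \<and> x \<le> sh i + length (ps ! i)" if "i < ?n" "x \<in> set (ws ! i)" for i x
    using that perm[OF that(1)] by (auto simp: nth is_perm_def)
  \<comment> \<open>\<open>J\<close> is any index set containing \<open>i\<close> and all entries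
    below it. The set of entries below a larger entry gives the layering; the set of all indices
    bounds the values by the total length.\<close>
  have step: "sh i + length (ps ! i) \<le> sum (\<lambda>j. length (ps ! j)) J"
    if "i < ?n" "finite J" "insert i {j. j < ?n \<and> q ! j < q ! i} \<subseteq> J" for i J
  proof -
    have "sh i + length (ps ! i) = sum (\<lambda>j. length (ps ! j)) (insert i {j. j < ?n \<and> q ! j < q ! i})"
      by (subst sum.insert) (auto simp: sh_def)
    also have "\<dots> \<le> sum (\<lambda>j. length (ps ! j)) J" by (rule sum_mono2) (use that in auto)
    finally show ?thesis .
  qed
  have lay: "layered (zip q ws)"
    unfolding layered_zip_nth[OF lws]
  proof (intro allI impI ballI)
    fix i j x y
    assume *: "i < ?n" "j < ?n" "q ! i < q ! j" "x \<in> set (ws ! i)" "y \<in> set (ws ! j)"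
    have "sh i + length (ps ! i) \<le> sh j"
      unfolding sh_def[of j] by (rule step) (use * in auto)
    then show "x < y" using rng[OF *(1,4)] rng[OF *(2,5)] by linarith
  qed
  have dw: "\<forall>w\<in>set ws. distinct w"
    using perm by (auto simp: ws_def distinct_map is_perm_def)
  have ne: "[] \<notin> set ws"
    using perm by (auto simp: ws_def is_perm_def)
  have d: "distinct (concat ws)"
    by (rule distinct_concat_layered[of q]) (use lws q lay dw in \<open>auto simp: is_perm_def\<close>)
  have "map length ws = map length ps"
    by (rule nth_equalityI) (auto simp: lws len nth)
  then have tot: "length (concat ws) = (\<Sum>j<?n. length (ps ! j))"
    using len by (simp add: length_concat sum_list_sum_nth atLeast0LessThan)
  have "set (concat ws) \<subseteq> {1..length (concat ws)}"
  proof
    fix x assume "x \<in> set (concat ws)"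
    then obtain i where i: "i < ?n" "x \<in> set (ws ! i)"
      using lws by (auto simp: in_set_conv_nth[of _ ws])
    have "sh i + length (ps ! i) \<le> length (concat ws)"
      unfolding tot by (rule step) (use i in auto)
    then show "x \<in> {1..length (concat ws)}" using rng[OF i] by auto
  qed
  then have "set (concat ws) = {1..length (concat ws)}"
    using distinct_card[OF d] by (intro card_subset_eq) auto
  moreover have "concat ws \<noteq> []"
  proof -
    have "ws \<noteq> []" using lws q by (auto simp: is_perm_def)
    then show ?thesis using ne by (cases ws) auto
  qed
  ultimately have "is_perm (inflate q ps)" using d by (simp add: is_perm_def inf)
  moreover have "ps = map standardize ws"
  proof (rule nth_equalityI)
    fix i assume "i < length ps"
    then have i: "i < ?n" using len by simp
    have "order_iso (ps ! i) (ws ! i)" unfolding nth[OF i] by (rule order_iso_map) simp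
    from order_iso_perm[OF this perm[OF i]]
    show "ps ! i = map standardize ws ! i" using i lws by simp
  qed (simp add: len lws)
  ultimately show ?thesis using that inf lws lay ne by blast
qed

lemma is_perm_inflate:
  "is_perm q \<Longrightarrow> length ps = length q \<Longrightarrow> \<forall>p\<in>set ps. is_perm p \<Longrightarrow> is_perm (inflate q ps)"
  by (rule inflate_blocks) auto

lemma length_inflate_ge:
  assumes "is_perm q" "length ps = length q" "\<forall>p\<in>set ps. is_perm p"
  shows "length q \<le> length (inflate q ps)"
proof -
  obtain ws where ws: "inflate q ps = concat ws" "length ws = length q" "[] \<notin> set ws"
    using assms by (rule inflate_blocks)
  have "length ws \<le> length (concat ws)" using ws(3)
  proof (induction ws)
    case (Cons w ws)
    then show ?case by (cases w) auto
  qed simp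
  then show ?thesis using ws by simp
qed

text \<open>Converse to \<open>inflate_blocks\<close>: the given word and the inflation are layered
  over the same quotient with order-isomorphic blocks, hence order-isomorphic, and order-isomorphic
  permutations coincide.\<close>

lemma concat_eq_inflate:
  assumes "is_perm q" "length ws = length q" "layered (zip q ws)" "is_perm (concat ws)" "[] \<notin> set ws"
  shows "concat ws = inflate q (map standardize ws)"
proof -
  have "distinct w" if "w \<in> set ws" for w
    using assms(4) that by (auto simp: is_perm_def distinct_concat_iff)
  then have p: "\<forall>p\<in>set (map standardize ws). is_perm p"
    using assms(5) by (auto intro!: is_perm_standardize)
  obtain vs where vs: "inflate q (map standardize ws) = concat vs" "length vs = length q"
    "layered (zip q vs)" "map standardize ws = map standardize vs"
    "is_perm (inflate q (map standardize ws))"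
    by (rule inflate_blocks[OF assms(1) _ p]) (use assms(2) in auto)
  have "list_all2 order_iso ws vs"
    unfolding list_all2_conv_all_nth
  proof (intro conjI allI impI)
    fix i assume "i < length ws"
    then have "standardize (ws ! i) = standardize (vs ! i)"
      using vs(2,4) assms(2) by (metis nth_map)
    then show "order_iso (ws ! i) (vs ! i)"
      by (metis order_iso_standardize order_iso_sym order_iso_trans)
  qed (use vs(2) assms(2) in simp)
  then have "order_iso (concat ws) (concat vs)"
    using assms vs by (intro layered_order_iso_concat[of q]) (auto simp: is_perm_def)
  then show ?thesis using order_iso_perm_eq assms(4) vs(1,5) by metis
qed

text \<open>Labels and values are replaced by their ranks independently, which preserves the
  layering; this reduces the claim to permutations.\<close>

lemma standardize_concat_eq_inflate:
  assumes "distinct q" "q \<noteq> []" "length ws = length q" "layered (zip q ws)" "distinct (concat ws)"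
    "[] \<notin> set ws"
  shows "standardize (concat ws) = inflate (standardize q) (map standardize ws)"
proof -
  obtain f where f: "standardize q = map f q" "\<forall>x\<in>set q. \<forall>y\<in>set q. x < y \<longleftrightarrow> f x < f y"
    using order_iso_imp_map[OF order_iso_standardize] by blast
  obtain g where g: "standardize (concat ws) = map g (concat ws)"
    "\<forall>x\<in>set (concat ws). \<forall>y\<in>set (concat ws). x < y \<longleftrightarrow> g x < g y"
    using order_iso_imp_map[OF order_iso_standardize] by blast
  define vs where "vs = map (map g) ws"
  have c: "concat vs = standardize (concat ws)" by (simp add: g(1) vs_def map_concat)
  have st: "map standardize ws = map standardize vs"
  proof -
    have "order_iso w (map g w)" if "w \<in> set ws" for w
      by (rule order_iso_map) (use g(2) that in auto)
    then show ?thesis by (auto simp: vs_def intro: standardize_cong)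
  qed
  have lay: "layered (zip (standardize q) vs)"
    unfolding layered_def
  proof (intro ballI impI)
    fix z z' x y
    assume z: "z \<in> set (zip (standardize q) vs)" and z': "z' \<in> set (zip (standardize q) vs)"
      and l: "fst z < fst z'" and xy: "x \<in> set (snd z)" "y \<in> set (snd z')"
    from z obtain a w where a: "(a, w) \<in> set (zip q ws)" "z = (f a, map g w)"
      by (auto simp: f(1) vs_def zip_map_map)
    from z' obtain b v where b: "(b, v) \<in> set (zip q ws)" "z' = (f b, map g v)"
      by (auto simp: f(1) vs_def zip_map_map)
    have ab: "a < b" using l a b f(2) by (auto dest: set_zip_leftD)
    have wv: "w \<in> set ws" "v \<in> set ws" using a b by (auto dest: set_zip_rightD)
    obtain x' y' where x': "x' \<in> set w" "x = g x'" "y' \<in> set v" "y = g y'" using xy a b by auto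
    then have "x' < y'" using layeredD[OF assms(4) a(1) b(1) ab] by blast
    then show "x < y" using x' wv g(2) by auto
  qed
  have "concat vs = inflate (standardize q) (map standardize vs)"
  proof (rule concat_eq_inflate)
    show "is_perm (standardize q)" using assms by (simp add: is_perm_standardize)
    have "concat ws \<noteq> []" using assms by (cases ws) auto
    then show "is_perm (concat vs)" unfolding c using assms(5) by (simp add: is_perm_standardize)
  qed (use lay assms(3,6) in \<open>auto simp: vs_def\<close>)
  then show ?thesis using c st by simp
qed

text \<open>One representative per block is a copy of the quotient. Thus the cutting into blocks
  alone determines the quotient, which is what the uniqueness proof recovers it from.\<close>

lemma quotient_eq_standardize:
  assumes "is_perm q" "length ws = length q" "layered (zip q ws)" "[] \<notin> set ws"
  shows "q = standardize (map hd ws)"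
proof (rule order_iso_perm[OF _ assms(1)])
  note l = assms(3)[unfolded layered_zip_nth[OF assms(2)], rule_format]
  have h: "hd (ws ! i) \<in> set (ws ! i)" if "i < length q" for i
    using that assms(2,4) by (metis hd_in_set nth_mem)
  have "q ! i < q ! j \<longleftrightarrow> hd (ws ! i) < hd (ws ! j)" if ij: "i < length q" "j < length q" for i j
  proof -
    have "q ! i < q ! j \<or> i = j \<or> q ! j < q ! i"
      using assms(1) ij by (metis is_permD(1) nat_neq_iff nth_eq_iff_index_eq)
    then show ?thesis using l[of i j] l[of j i] h ij by (metis not_less_iff_gr_or_eq)
  qed
  then show "order_iso q (map hd ws)" using assms(2) by (simp add: order_iso_def)
qed

section \<open>Intervals and simple quotients\<close>

text \<open>An interval as a factor that no outside entry separates. This form makes sense for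
  arbitrary words, is invariant under monotone relabelling and can be tested directly.\<close>

definition is_block :: "nat list \<Rightarrow> nat list \<Rightarrow> nat list \<Rightarrow> bool" where
  "is_block us xs vs \<longleftrightarrow> xs \<noteq> [] \<and>
     (\<forall>x\<in>set (us @ vs). (\<forall>y\<in>set xs. x < y) \<or> (\<forall>y\<in>set xs. y < x))"

lemma is_block_map:
  assumes "\<forall>x\<in>set (us @ xs @ vs). \<forall>y\<in>set (us @ xs @ vs). x < y \<longleftrightarrow> f x < f y" "is_block us xs vs"
  shows "is_block (map f us) (map f xs) (map f vs)"
  unfolding is_block_def
proof (intro conjI ballI)
  show "map f xs \<noteq> []" using assms(2) by (simp add: is_block_def)
  fix x assume "x \<in> set (map f us @ map f vs)"
  then obtain x' where x': "x' \<in> set (us @ vs)" "x = f x'" by auto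
  then have "(\<forall>y\<in>set xs. x' < y) \<or> (\<forall>y\<in>set xs. y < x')"
    using assms(2) by (simp add: is_block_def)
  then show "(\<forall>y\<in>set (map f xs). x < y) \<or> (\<forall>y\<in>set (map f xs). y < x)"
    using assms(1) x' by auto
qed

text \<open>A permutation takes every value between the minimum and the maximum of
  \<open>xs\<close>, and such a value cannot sit outside a block; so the values of a block fill an
  integer interval.\<close>

lemma interval_values_iff_block:
  assumes g: "is_perm g" "g = us @ xs @ vs" and ne: "xs \<noteq> []"
  shows "(\<exists>v. set xs = {v..<v + length xs}) \<longleftrightarrow> is_block us xs vs"
proof
  assume "\<exists>v. set xs = {v..<v + length xs}"
  then obtain v where v: "set xs = {v..<v + length xs}" by blast
  have "x \<notin> set xs" if "x \<in> set (us @ vs)" for x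
    using that g by (auto simp: is_perm_def)
  then show "is_block us xs vs" using ne unfolding is_block_def v by fastforce
next
  assume b: "is_block us xs vs"
  let ?m = "Min (set xs)" and ?M = "Max (set xs)"
  have mem: "?m \<in> set xs" "?M \<in> set xs" using ne by simp_all
  have bounds: "?m \<le> x" "x \<le> ?M" if "x \<in> set xs" for x using that by simp_all
  have "set xs = {?m..?M}"
  proof
    show "{?m..?M} \<subseteq> set xs"
    proof
      fix x assume x: "x \<in> {?m..?M}"
      have "?m \<in> {1..length g}" "?M \<in> {1..length g}"
        using mem g by (auto simp: is_perm_def)
      then have "x \<in> set g" using x g by (auto simp: is_perm_def)
      moreover have "x \<notin> set (us @ vs)"
      proof
        assume "x \<in> set (us @ vs)"
        then have "(\<forall>y\<in>set xs. x < y) \<or> (\<forall>y\<in>set xs. y < x)" using b by (simp add: is_block_def)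
        then show False using mem x by (metis atLeastAtMost_iff not_less)
      qed
      ultimately show "x \<in> set xs" using g by auto
    qed
  qed (use bounds in auto)
  moreover have "card (set xs) = length xs"
    using g by (intro distinct_card) (auto simp: is_perm_def)
  ultimately have "length xs = Suc ?M - ?m" by (metis card_atLeastAtMost)
  then have "?m + length xs = Suc ?M" using bounds(1)[OF mem(2)] by linarith
  then have "{?m..?M} = {?m..<?m + length xs}" by (simp only: atLeastLessThanSuc_atLeastAtMost)
  then show "\<exists>v. set xs = {v..<v + length xs}" using \<open>set xs = {?m..?M}\<close> by blast
qed

lemma image_nth_append:
  "(\<lambda>k. (us @ xs @ vs) ! k) ` {length us..<length us + length xs} = set xs"
proof (intro set_eqI iffI)
  fix x assume "x \<in> (\<lambda>k. (us @ xs @ vs) ! k) ` {length us..<length us + length xs}"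
  then show "x \<in> set xs" by (auto simp: nth_append)
next
  fix x assume "x \<in> set xs"
  then obtain k where "k < length xs" "xs ! k = x" by (auto simp: in_set_conv_nth)
  then show "x \<in> (\<lambda>k. (us @ xs @ vs) ! k) ` {length us..<length us + length xs}"
    by (intro image_eqI[of _ _ "length us + k"]) (auto simp: nth_append)
qed

lemma perm_interval_append:
  assumes "is_perm (us @ xs @ vs)"
  shows "perm_interval (us @ xs @ vs) (length us) (length us + length xs) \<longleftrightarrow> is_block us xs vs"
  using interval_values_iff_block[OF assms refl]
  by (auto simp: perm_interval_def image_nth_append is_block_def)

lemma perm_interval_iff:
  assumes "is_perm g"
  shows "perm_interval g i j \<longleftrightarrow> (\<exists>us xs vs. g = us @ xs @ vs \<and> i = length us \<and>
     j = length us + length xs \<and> is_block us xs vs)"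
proof
  assume pi: "perm_interval g i j"
  let ?us = "take i g" and ?xs = "take (j - i) (drop i g)" and ?vs = "drop j g"
  have ij: "i < j" "j \<le> length g" using pi by (auto simp: perm_interval_def)
  have g: "g = ?us @ ?xs @ ?vs"
    using ij by (metis append_take_drop_id drop_drop le_add_diff_inverse2 less_imp_le_nat)
  moreover have l: "i = length ?us" "j = length ?us + length ?xs" using ij by auto
  moreover have "is_block ?us ?xs ?vs"
    using perm_interval_append[of ?us ?xs ?vs] assms pi g l by metis
  ultimately show "\<exists>us xs vs. g = us @ xs @ vs \<and> i = length us \<and>
     j = length us + length xs \<and> is_block us xs vs" by blast
next
  assume "\<exists>us xs vs. g = us @ xs @ vs \<and> i = length us \<and>
     j = length us + length xs \<and> is_block us xs vs"
  then show "perm_interval g i j" using perm_interval_append assms by blast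
qed

lemma normalized_blocks_eq:
  assumes "is_perm g"
  shows "normalized_blocks g = {standardize xs | us xs vs. g = us @ xs @ vs \<and> is_block us xs vs}"
proof (intro set_eqI iffI)
  fix d assume "d \<in> normalized_blocks g"
  then obtain i j where d: "is_perm d" "perm_interval g i j" "order_iso d (take (j - i) (drop i g))"
    by (auto simp: normalized_blocks_def)
  then obtain us xs vs where *: "g = us @ xs @ vs" "i = length us" "j = length us + length xs"
    "is_block us xs vs" using perm_interval_iff[OF assms] by blast
  then have "d = standardize xs" using order_iso_perm[OF d(3,1)] by simp
  then show "d \<in> {standardize xs | us xs vs. g = us @ xs @ vs \<and> is_block us xs vs}" using * by blast
next
  fix d assume "d \<in> {standardize xs | us xs vs. g = us @ xs @ vs \<and> is_block us xs vs}"
  then obtain us xs vs where *: "d = standardize xs" "g = us @ xs @ vs" "is_block us xs vs" by blast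
  have "distinct xs" "xs \<noteq> []" using * assms by (auto simp: is_perm_def is_block_def)
  then have "is_perm d" using * is_perm_standardize by blast
  moreover have "perm_interval g (length us) (length us + length xs)"
    using perm_interval_append * assms by blast
  moreover have "order_iso d (take (length us + length xs - length us) (drop (length us) g))"
    using * order_iso_sym[OF order_iso_standardize] by simp
  ultimately show "d \<in> normalized_blocks g" unfolding normalized_blocks_def by blast
qed

text \<open>Simplicity without the requirement to be a permutation, so that it applies to label
  words before they are standardized.\<close>

definition simple_word :: "nat list \<Rightarrow> bool" where
  "simple_word q \<longleftrightarrow> 4 \<le> length q \<and>
     (\<forall>us xs vs. q = us @ xs @ vs \<and> is_block us xs vs \<longrightarrow> length xs = 1 \<or> us = [] \<and> vs = [])"

lemma simple_perm_iff: "simple_perm s \<longleftrightarrow> is_perm s \<and> simple_word s"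
proof (cases "is_perm s")
  case True
  have "(\<forall>i j. perm_interval s i j \<longrightarrow> j = Suc i \<or> i = 0 \<and> j = length s) \<longleftrightarrow>
    (\<forall>us xs vs. s = us @ xs @ vs \<and> is_block us xs vs \<longrightarrow> length xs = 1 \<or> us = [] \<and> vs = [])"
    (is "?L \<longleftrightarrow> ?R")
  proof
    assume L: ?L
    show ?R
    proof (intro allI impI)
      fix us xs vs assume *: "s = us @ xs @ vs \<and> is_block us xs vs"
      then have "perm_interval s (length us) (length us + length xs)"
        using perm_interval_iff[OF True] by blast
      then have "length us + length xs = Suc (length us) \<or>
        length us = 0 \<and> length us + length xs = length s" using L by blast
      then show "length xs = 1 \<or> us = [] \<and> vs = []" using * by auto
    qed
  next
    assume R: ?R
    show ?L
    proof (intro allI impI)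
      fix i j assume "perm_interval s i j"
      then obtain us xs vs where *: "s = us @ xs @ vs" "i = length us" "j = length us + length xs"
        "is_block us xs vs" using perm_interval_iff[OF True] by blast
      then have "length xs = 1 \<or> us = [] \<and> vs = []" using R by blast
      then show "j = Suc i \<or> i = 0 \<and> j = length s" using * by auto
    qed
  qed
  then show ?thesis using True by (simp add: simple_perm_def simple_word_def)
qed (simp add: simple_perm_def)

lemma simple_word_order_iso:
  assumes "order_iso q r" "simple_word q" shows "simple_word r"
  unfolding simple_word_def
proof (intro conjI allI impI)
  show "4 \<le> length r" using assms order_iso_length by (simp add: simple_word_def)
  fix us xs vs assume *: "r = us @ xs @ vs \<and> is_block us xs vs"
  obtain f where f: "q = map f r" "\<forall>x\<in>set r. \<forall>y\<in>set r. x < y \<longleftrightarrow> f x < f y"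
    using order_iso_imp_map[OF order_iso_sym[OF assms(1)]] by blast
  have "is_block (map f us) (map f xs) (map f vs)" using f(2) * by (intro is_block_map) auto
  moreover have "q = map f us @ map f xs @ map f vs" using f(1) * by simp
  ultimately have "length (map f xs) = 1 \<or> map f us = [] \<and> map f vs = []"
    using assms(2) unfolding simple_word_def by blast
  then show "length xs = 1 \<or> us = [] \<and> vs = []" by simp
qed

section \<open>Decompositions of a word into labelled nonempty blocks\<close>

definition block_decomp :: "(nat \<times> nat list) list \<Rightarrow> bool" where
  "block_decomp zs \<longleftrightarrow> distinct (map fst zs) \<and> layered zs \<and> [] \<notin> set (map snd zs)"

text \<open>Blocks whose labels form an interval of the quotient can be merged, since no other block
  lies between them in value. This shortens a decomposition as long as its quotient has a proper
  interval with several entries.\<close>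

lemma block_decomp_contract:
  assumes zs: "block_decomp zs" and q: "map fst zs = us @ xs @ vs" and b: "is_block us xs vs"
  shows "\<exists>zs'. block_decomp zs' \<and> concat (map snd zs') = concat (map snd zs) \<and>
    length zs' = length us + 1 + length vs"
proof -
  obtain zu zx zv where z: "zs = zu @ zx @ zv" "us = map fst zu" "xs = map fst zx" "vs = map fst zv"
  proof -
    obtain zu zr where 1: "zs = zu @ zr" "us = map fst zu" "xs @ vs = map fst zr"
      using q by (auto simp: map_eq_append_conv)
    moreover obtain zx zv where "zr = zx @ zv" "xs = map fst zx" "vs = map fst zv"
      using 1(3)[symmetric] by (auto simp: map_eq_append_conv)
    ultimately show ?thesis using that by blast
  qed
  have lay: "layered zs" and dist: "distinct (map fst zs)" and ne: "[] \<notin> set (map snd zs)"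
    using zs by (auto simp: block_decomp_def)
  have xne: "zx \<noteq> []" using b z by (auto simp: is_block_def)
  \<comment> \<open>Any label of the interval would serve: an outside label compares with all of
    them in the same way.\<close>
  define n where "n = (hd xs, concat (map snd zx))"
  define zs' where "zs' = zu @ [n] @ zv"
  have hd: "hd xs \<in> set xs" using b by (simp add: is_block_def)
  have blk: "(\<forall>y\<in>set xs. fst z < y) \<or> (\<forall>y\<in>set xs. y < fst z)" if "z \<in> set zu \<union> set zv" for z
    using that b z by (auto simp: is_block_def)
  have "layered zs'"
    unfolding layered_def
  proof (intro ballI impI)
    fix z z' x y
    assume *: "z \<in> set zs'" "z' \<in> set zs'" "fst z < fst z'" "x \<in> set (snd z)" "y \<in> set (snd z')"
    consider "z \<in> set zu \<union> set zv" "z' \<in> set zu \<union> set zv"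
      | "z \<in> set zu \<union> set zv" "z' = n" | "z = n" "z' \<in> set zu \<union> set zv" | "z = n" "z' = n"
      using *(1,2) by (auto simp: zs'_def)
    then show "x < y"
    proof cases
      case 1
      then show ?thesis using layeredD[OF lay, of "fst z" "snd z" "fst z'" "snd z'" x y] * z by auto
    next
      case 2
      then obtain w where w: "w \<in> set zx" "y \<in> set (snd w)" using * by (auto simp: n_def)
      have "fst z < hd xs" using * 2 by (simp add: n_def)
      then have "\<forall>y\<in>set xs. fst z < y" using blk[OF 2(1)] hd by (meson less_asym)
      then have "fst z < fst w" using w z by simp
      then show ?thesis
        using layeredD[OF lay, of "fst z" "snd z" "fst w" "snd w" x y] * z w 2 by auto
    next
      case 3
      then obtain w where w: "w \<in> set zx" "x \<in> set (snd w)" using * by (auto simp: n_def)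
      have "hd xs < fst z'" using * 3 by (simp add: n_def)
      then have "\<forall>y\<in>set xs. y < fst z'" using blk[OF 3(2)] hd by (meson less_asym)
      then have "fst w < fst z'" using w z by simp
      then show ?thesis
        using layeredD[OF lay, of "fst w" "snd w" "fst z'" "snd z'" x y] * z w 3 by auto
    next
      case 4
      then show ?thesis using * by simp
    qed
  qed
  moreover have "distinct (map fst zs')"
    using dist hd z by (auto simp: zs'_def n_def)
  moreover have "concat (map snd zx) \<noteq> []"
    using xne ne z by (cases zx) auto
  ultimately have "block_decomp zs'" using ne z by (auto simp: block_decomp_def zs'_def n_def)
  moreover have "concat (map snd zs') = concat (map snd zs)" by (simp add: zs'_def n_def z)
  ultimately show ?thesis using z by (intro exI[of _ zs']) (simp add: zs'_def)
qed

text \<open>A quotient of least size \<open>\<ge> 2\<close> cannot be contracted any further; size 3 is excluded because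
  every permutation of size 3 has an interval of size 2.\<close>

lemma block_decomp_exists:
  assumes "distinct s" "2 \<le> length s"
  shows "\<exists>zs. block_decomp zs \<and> concat (map snd zs) = s \<and>
    (length zs = 2 \<or> simple_word (map fst zs))"
proof -
  let ?P = "\<lambda>zs. block_decomp zs \<and> concat (map snd zs) = s \<and> 2 \<le> length zs"
  \<comment> \<open>The finest decomposition, every entry being its own block and its own label,
    starts the minimization.\<close>
  let ?z0 = "map (\<lambda>x. (x, [x])) s"
  have "concat (map snd ?z0) = s" by (induction s) auto
  moreover have "layered ?z0" by (auto simp: layered_def)
  ultimately have "?P ?z0" using assms by (auto simp: block_decomp_def o_def)
  then obtain zs where zs: "?P zs" and least: "\<forall>zs'. ?P zs' \<longrightarrow> length zs \<le> length zs'"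
    using ex_has_least_nat[of ?P ?z0 length] by blast
  have no_block: "length xs = 1 \<or> us = [] \<and> vs = []"
    if q: "map fst zs = us @ xs @ vs" and b: "is_block us xs vs" for us xs vs
  proof (rule ccontr)
    assume c: "\<not> (length xs = 1 \<or> us = [] \<and> vs = [])"
    obtain zs' where z': "block_decomp zs'" "concat (map snd zs') = s"
      "length zs' = length us + 1 + length vs"
      using block_decomp_contract[OF _ q b] zs by metis
    have "length us \<noteq> 0 \<or> length vs \<noteq> 0" using c by simp
    then have "2 \<le> length zs'" using z'(3) by linarith
    then have "length zs \<le> length zs'" using least z' by blast
    moreover have "length zs = length us + length xs + length vs"
      using q by (metis add.assoc length_append length_map)
    moreover have "length xs \<noteq> 0" using b by (simp add: is_block_def)
    ultimately show False using c z'(3) by linarith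
  qed
  have "length zs \<noteq> 3"
  proof
    assume "length zs = 3"
    then have "length (map fst zs) = 3" by simp
    then obtain a b c where q: "map fst zs = [a, b, c]"
      by (auto simp: length_Suc_conv numeral_eq_Suc)
    have d: "distinct [a, b, c]" using zs q by (metis block_decomp_def)
    \<comment> \<open>If \<open>c\<close> is extremal, the first two entries form an interval;
      otherwise \<open>c\<close> is the median, \<open>a\<close> is extremal, and the last two
      do.\<close>
    have "is_block [] [a, b] [c] \<or> is_block [a] [b, c] []"
      using d by (auto simp: is_block_def)
    then show False using no_block[of "[]" "[a, b]" "[c]"] no_block[of "[a]" "[b, c]" "[]"] q by auto
  qed
  then have "length zs = 2 \<or> 4 \<le> length zs" using zs by linarith
  then show ?thesis using zs no_block by (auto simp: simple_word_def)
qed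

section \<open>Intervals of an inflation with simple quotient\<close>

lemma concat_eq_append_split_left:
  "concat (map snd zs) = us @ vs \<Longrightarrow> vs \<noteq> [] \<Longrightarrow>
    \<exists>z1 a w1 w2 z2. zs = z1 @ (a, w1 @ w2) # z2 \<and> us = concat (map snd z1) @ w1 \<and> w2 \<noteq> [] \<and>
      vs = w2 @ concat (map snd z2)"
proof (induction zs arbitrary: us)
  case (Cons z zs)
  obtain a w where z: "z = (a, w)" by (cases z)
  from Cons.prems(1) have "w @ concat (map snd zs) = us @ vs" by (simp add: z)
  then obtain e where "w = us @ e \<and> e @ concat (map snd zs) = vs \<or>
      w @ e = us \<and> concat (map snd zs) = e @ vs"
    unfolding append_eq_append_conv2 by blast
  then consider us' where "us = w @ us'" "concat (map snd zs) = us' @ vs"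
    | w2 where "w = us @ w2" "w2 \<noteq> []" "vs = w2 @ concat (map snd zs)"
    by (cases "e = []") auto
  then show ?case
  proof cases
    case 1
    then obtain z1 b w1 w2 z2 where "zs = z1 @ (b, w1 @ w2) # z2 \<and> us' = concat (map snd z1) @ w1 \<and>
      w2 \<noteq> [] \<and> vs = w2 @ concat (map snd z2)" using Cons.IH Cons.prems(2) by blast
    then show ?thesis using 1 z
      by (intro exI[of _ "z # z1"] exI[of _ b] exI[of _ w1] exI[of _ w2] exI[of _ z2]) simp
  next
    case 2
    then show ?thesis using z
      by (intro exI[of _ "[]"] exI[of _ a] exI[of _ us] exI[of _ w2] exI[of _ zs]) simp
  qed
qed simp

text \<open>The two splitting lemmas differ when the cut falls on a block boundary: the previous one
  returns the block of the first entry after the cut, this one the block of the last entry before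
  it. Applied to the ends of an interval they give the first and last block that it meets.\<close>

lemma concat_eq_append_split_right:
  "concat (map snd zs) = us @ vs \<Longrightarrow> us \<noteq> [] \<Longrightarrow>
    \<exists>z1 a w1 w2 z2. zs = z1 @ (a, w1 @ w2) # z2 \<and> us = concat (map snd z1) @ w1 \<and> w1 \<noteq> [] \<and>
      vs = w2 @ concat (map snd z2)"
proof (induction zs arbitrary: us)
  case (Cons z zs)
  obtain a w where z: "z = (a, w)" by (cases z)
  from Cons.prems(1) have "w @ concat (map snd zs) = us @ vs" by (simp add: z)
  then obtain e where "w = us @ e \<and> e @ concat (map snd zs) = vs \<or>
      w @ e = us \<and> concat (map snd zs) = e @ vs"
    unfolding append_eq_append_conv2 by blast
  then consider us' where "us = w @ us'" "us' \<noteq> []" "concat (map snd zs) = us' @ vs"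
    | w2 where "w = us @ w2" "vs = w2 @ concat (map snd zs)"
    by (cases "e = []") auto
  then show ?case
  proof cases
    case 1
    then obtain z1 b w1 w2 z2 where "zs = z1 @ (b, w1 @ w2) # z2 \<and> us' = concat (map snd z1) @ w1 \<and>
      w1 \<noteq> [] \<and> vs = w2 @ concat (map snd z2)" using Cons.IH by blast
    then show ?thesis using 1 z
      by (intro exI[of _ "z # z1"] exI[of _ b] exI[of _ w1] exI[of _ w2] exI[of _ z2]) simp
  next
    case 2
    then show ?thesis using z Cons.prems(2)
      by (intro exI[of _ "[]"] exI[of _ a] exI[of _ us] exI[of _ w2] exI[of _ zs]) simp
  qed
qed simp

text \<open>The quotient entries whose blocks meet an interval of the inflation form an interval of the
  quotient. If the quotient is simple and all blocks are met, then an entry outside the interval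
  would make the first or the last quotient entry extremal, and the others an interval.\<close>

lemma interval_of_simple_inflation:
  assumes zs: "block_decomp zs" and simp: "simple_word (map fst zs)"
    and c: "concat (map snd zs) = us @ xs @ vs" and b: "is_block us xs vs"
  shows "us = [] \<and> vs = [] \<or> (\<exists>z\<in>set zs. set xs \<subseteq> set (snd z))"
proof -
  have xne: "xs \<noteq> []" using b by (simp add: is_block_def)
  have lay: "layered zs" and dist: "distinct (map fst zs)" and ne: "[] \<notin> set (map snd zs)"
    using zs by (auto simp: block_decomp_def)
  obtain z1 a w1 w2 zr where s1: "zs = z1 @ (a, w1 @ w2) # zr" "us = concat (map snd z1) @ w1"
    "w2 \<noteq> []" "xs @ vs = w2 @ concat (map snd zr)"
    using concat_eq_append_split_left[OF c] xne by blast
  from s1(4) obtain e where "xs = w2 @ e \<and> e @ vs = concat (map snd zr) \<or>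
      xs @ e = w2 \<and> vs = e @ concat (map snd zr)"
    unfolding append_eq_append_conv2 by blast
  then consider e where "w2 = xs @ e"
    | xs' where "xs = w2 @ xs'" "xs' \<noteq> []" "concat (map snd zr) = xs' @ vs"
    by (cases "e = []") auto
  then show ?thesis
  proof cases
    case 1
    then show ?thesis using s1(1) by auto
  next
    case 2
    obtain zm d w3 w4 z2 where s2: "zr = zm @ (d, w3 @ w4) # z2" "xs' = concat (map snd zm) @ w3"
      "w3 \<noteq> []" "vs = w4 @ concat (map snd z2)"
      using concat_eq_append_split_right[OF 2(3,2)] by blast
    let ?T = "(a, w1 @ w2) # zm @ [(d, w3 @ w4)]"
    have zeq: "zs = z1 @ ?T @ z2" using s1 s2 by simp
    have xeq: "xs = w2 @ concat (map snd zm) @ w3" using 2 s2 by simp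
    have nm: "snd t \<noteq> []" if "t \<in> set zs" for t using that ne by force
    have touch: "\<exists>u\<in>set (snd t). u \<in> set xs" if t: "t \<in> set ?T" for t
    proof -
      consider "t = (a, w1 @ w2)" | "t \<in> set zm" | "t = (d, w3 @ w4)" using t by auto
      then show ?thesis
      proof cases
        case 1
        then show ?thesis using s1(3) xeq by (intro bexI[of _ "hd w2"]) auto
      next
        case 2
        then have "hd (snd t) \<in> set (snd t)" using nm[of t] zeq by simp
        then show ?thesis using 2 xeq by auto
      next
        case 3
        then show ?thesis using s2(3) xeq by (intro bexI[of _ "hd w3"]) auto
      qed
    qed
    \<comment> \<open>An entry \<open>y\<close> outside the interval is below or above all of
      \<open>xs\<close>. As every block of \<open>?T\<close> contains an entry of \<open>xs\<close>,
      the layering transfers this comparison to the labels. The list \<open>T\<close> is kept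
      variable because the end cases use all blocks but one.\<close>
    have sep: "(\<forall>t\<in>set T. fst z < fst t) \<or> (\<forall>t\<in>set T. fst t < fst z)"
      if "z \<in> set zs" "y \<in> set (snd z)" "y \<in> set (us @ vs)" "set T \<subseteq> set ?T" "fst z \<notin> fst ` set T"
      for z y T
    proof -
      have TS: "set T \<subseteq> set zs" using that(4) zeq by auto
      have ord: "fst z < fst t" if "t \<in> set T" "\<forall>x\<in>set xs. y < x" for t
      proof (rule ccontr)
        assume "\<not> fst z < fst t"
        then have "fst t < fst z" using \<open>fst z \<notin> fst ` set T\<close> that(1) by (metis image_eqI nat_neq_iff)
        moreover obtain u where "u \<in> set (snd t)" "u \<in> set xs" using touch \<open>t \<in> set T\<close> \<open>set T \<subseteq> set ?T\<close> by blast
        ultimately have "u < y" using layeredD[OF lay, of "fst t" "snd t" "fst z" "snd z" u y] TS that(1)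
            \<open>z \<in> set zs\<close> \<open>y \<in> set (snd z)\<close> by auto
        then show False using that(2) \<open>u \<in> set xs\<close> by (meson less_asym)
      qed
      have ord': "fst t < fst z" if "t \<in> set T" "\<forall>x\<in>set xs. x < y" for t
      proof (rule ccontr)
        assume "\<not> fst t < fst z"
        then have "fst z < fst t" using \<open>fst z \<notin> fst ` set T\<close> that(1) by (metis image_eqI nat_neq_iff)
        moreover obtain u where "u \<in> set (snd t)" "u \<in> set xs" using touch \<open>t \<in> set T\<close> \<open>set T \<subseteq> set ?T\<close> by blast
        ultimately have "y < u" using layeredD[OF lay, of "fst z" "snd z" "fst t" "snd t" y u] TS that(1)
            \<open>z \<in> set zs\<close> \<open>y \<in> set (snd z)\<close> by auto
        then show False using that(2) \<open>u \<in> set xs\<close> by (meson less_asym)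
      qed
      have "(\<forall>x\<in>set xs. y < x) \<or> (\<forall>x\<in>set xs. x < y)"
        using b that(3) by (simp add: is_block_def)
      then show ?thesis using ord ord' by blast
    qed
    have trivial: "length xs0 = 1 \<or> us0 = [] \<and> vs0 = []"
      if "map fst zs = us0 @ xs0 @ vs0" "is_block us0 xs0 vs0" for us0 xs0 vs0
      using simp that unfolding simple_word_def by blast
    have "is_block (map fst z1) (map fst ?T) (map fst z2)"
      unfolding is_block_def
    proof (intro conjI ballI)
      fix x assume "x \<in> set (map fst z1 @ map fst z2)"
      then obtain z where z: "z \<in> set z1 \<union> set z2" "x = fst z" by auto
      then have zz: "z \<in> set zs" using zeq by auto
      have y: "hd (snd z) \<in> set (snd z)" using nm[OF zz] by simp
      have "hd (snd z) \<in> set (us @ vs)" using y z s1(2) s2(4) by auto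
      moreover have "fst z \<notin> fst ` set ?T"
      proof -
        have "fst ` (set z1 \<union> set z2) \<inter> fst ` set ?T = {}" using dist unfolding zeq by auto
        then show ?thesis using z(1) by blast
      qed
      ultimately have "(\<forall>t\<in>set ?T. fst z < fst t) \<or> (\<forall>t\<in>set ?T. fst t < fst z)"
        using sep[OF zz y, of ?T] by blast
      then show "(\<forall>y\<in>set (map fst ?T). x < y) \<or> (\<forall>y\<in>set (map fst ?T). y < x)" using z by auto
    qed simp
    then have "length (map fst ?T) = 1 \<or> map fst z1 = [] \<and> map fst z2 = []"
      by (intro trivial) (auto simp: zeq)
    then have z12: "z1 = []" "z2 = []" by auto
    have len: "2 \<le> length zm" using simp by (simp add: simple_word_def zeq z12)
    have "w1 = []"
    proof (rule ccontr)
      assume w1: "w1 \<noteq> []"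
      let ?S = "zm @ [(d, w3 @ w4)]"
      have "(\<forall>t\<in>set ?S. a < fst t) \<or> (\<forall>t\<in>set ?S. fst t < a)"
        using sep[of "(a, w1 @ w2)" "hd w1" ?S] w1 s1(2) dist by (auto simp: zeq)
      then have "is_block [a] (map fst ?S) []" by (auto simp: is_block_def)
      then show False using trivial[of "[a]" "map fst ?S" "[]"] len by (simp add: zeq z12)
    qed
    moreover have "w4 = []"
    proof (rule ccontr)
      assume w4: "w4 \<noteq> []"
      let ?S = "(a, w1 @ w2) # zm"
      have "(\<forall>t\<in>set ?S. d < fst t) \<or> (\<forall>t\<in>set ?S. fst t < d)"
        using sep[of "(d, w3 @ w4)" "hd w4" ?S] w4 s2(4) dist by (auto simp: zeq)
      then have "is_block [] (map fst ?S) [d]" by (auto simp: is_block_def)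
      then show False using trivial[of "[]" "map fst ?S" "[d]"] len by (simp add: zeq z12)
    qed
    ultimately show ?thesis using s1(2) s2(4) z12 by simp
  qed
qed

lemma layered_is_block:
  assumes lay: "layered (u @ z # v)" and dist: "distinct (map fst (u @ z # v))" and ne: "snd z \<noteq> []"
  shows "is_block (concat (map snd u)) (snd z) (concat (map snd v))"
  unfolding is_block_def
proof (intro conjI ballI)
  fix x assume "x \<in> set (concat (map snd u) @ concat (map snd v))"
  then obtain z' where z': "z' \<in> set u \<union> set v" "x \<in> set (snd z')" by auto
  have "fst z \<notin> fst ` (set u \<union> set v)" using dist by auto
  then have "fst z' \<noteq> fst z" using z'(1) by (metis imageI)
  then have "fst z' < fst z \<or> fst z < fst z'" by auto
  moreover have "z \<in> set (u @ z # v)" "z' \<in> set (u @ z # v)" using z'(1) by auto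
  ultimately show "(\<forall>y\<in>set (snd z). x < y) \<or> (\<forall>y\<in>set (snd z). y < x)"
    using lay z'(2) unfolding layered_def by blast
qed (rule ne)

text \<open>Each block of the second decomposition is an interval of the word, and not the whole
  word because there are two or more nonempty blocks; so it falls within one block over the simple
  quotient.\<close>

lemma blocks_refine_simple:
  assumes zs: "block_decomp zs" "simple_word (map fst zs)"
    and zs': "block_decomp zs'" "2 \<le> length zs'"
    and eq: "concat (map snd zs) = concat (map snd zs')" and z': "z' \<in> set zs'"
  shows "\<exists>z\<in>set zs. set (snd z') \<subseteq> set (snd z)"
proof -
  obtain u v where uv: "zs' = u @ z' # v" using z' by (meson split_list)
  have lay: "layered zs'" and dist: "distinct (map fst zs')" and ne: "\<And>z. z \<in> set zs' \<Longrightarrow> snd z \<noteq> []"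
    using zs'(1) by (force simp: block_decomp_def)+
  have "is_block (concat (map snd u)) (snd z') (concat (map snd v))"
    using layered_is_block lay dist ne z' unfolding uv by blast
  moreover have "concat (map snd zs) = concat (map snd u) @ snd z' @ concat (map snd v)"
    using eq uv by simp
  ultimately consider "concat (map snd u) = []" "concat (map snd v) = []"
    | "\<exists>z\<in>set zs. set (snd z') \<subseteq> set (snd z)"
    using interval_of_simple_inflation[OF zs] by blast
  then show ?thesis
  proof cases
    case 1
    then have "u = []" "v = []" using ne uv by (metis concat_eq_Nil_conv Un_iff empty_iff
          imageI last_in_set list.set_intros(2) set_append set_map)+
    then show ?thesis using zs'(2) uv by simp
  qed
qed

text \<open>Both first blocks contain the first entry of the word, so by distinctness the block
  covering one of them is the other. Mutual inclusion makes them equal, and the refinement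
  hypotheses pass to the remaining blocks.\<close>

lemma concat_partition_unique:
  "concat ws = concat ws' \<Longrightarrow> distinct (concat ws) \<Longrightarrow> [] \<notin> set ws \<Longrightarrow> [] \<notin> set ws' \<Longrightarrow>
    \<forall>w\<in>set ws. \<exists>w'\<in>set ws'. set w \<subseteq> set w' \<Longrightarrow> \<forall>w'\<in>set ws'. \<exists>w\<in>set ws. set w' \<subseteq> set w \<Longrightarrow> ws = ws'"
proof (induction ws arbitrary: ws')
  case Nil
  then show ?case by (cases ws') auto
next
  case (Cons w r)
  obtain w' r' where ws': "ws' = w' # r'" using Cons.prems(1,3) by (cases ws') auto
  have eq: "w @ concat r = w' @ concat r'" using Cons.prems(1) ws' by simp
  have d: "distinct (w @ concat r)" "distinct (w' @ concat r')" using Cons.prems(2) eq by auto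
  have wne: "w \<noteq> []" "w' \<noteq> []" using Cons.prems(3,4) ws' by auto
  have hd: "hd w = hd w'" using arg_cong[OF eq, of hd] wne by simp
  have hdm: "hd w \<in> set w" "hd w \<in> set w'" using wne hd hd_in_set by metis+
  have "set w \<subseteq> set w'"
  proof -
    obtain v where v: "v \<in> set ws'" "set w \<subseteq> set v" using Cons.prems(5) by auto
    then have "v = w'" using hdm d(2) ws' by auto
    then show ?thesis using v by simp
  qed
  moreover have "set w' \<subseteq> set w"
  proof -
    obtain v where v: "v \<in> set (w # r)" "set w' \<subseteq> set v" using Cons.prems(6) ws' by auto
    then have "v = w" using hdm d(1) by auto
    then show ?thesis using v by simp
  qed
  ultimately have "set w = set w'" by blast
  then have "length w = length w'" using d distinct_card by (metis distinct_append)
  then have w: "w = w'" "concat r = concat r'" using eq by auto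
  have "r = r'"
  proof (rule Cons.IH)
    show "\<forall>u\<in>set r. \<exists>u'\<in>set r'. set u \<subseteq> set u'"
    proof
      fix u assume u: "u \<in> set r"
      then obtain u' where u': "u' \<in> set ws'" "set u \<subseteq> set u'" using Cons.prems(5) by auto
      have "u \<noteq> []" using u Cons.prems(3) by auto
      then have hu: "hd u \<in> set u" by simp
      then have "hd u \<in> set (concat r)" using u by auto
      then have "hd u \<notin> set w" using d(1) by auto
      then have "u' \<noteq> w'" using u' hu w(1) by blast
      then show "\<exists>u'\<in>set r'. set u \<subseteq> set u'" using u' ws' by auto
    qed
    show "\<forall>u\<in>set r'. \<exists>u'\<in>set r. set u \<subseteq> set u'"
    proof
      fix u assume u: "u \<in> set r'"
      then have "u \<in> set ws'" using ws' by simp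
      then obtain u' where u': "u' \<in> set (w # r)" "set u \<subseteq> set u'" using Cons.prems(6) by blast
      have "u \<noteq> []" using u Cons.prems(4) ws' by auto
      then have hu: "hd u \<in> set u" by simp
      then have "hd u \<in> set (concat r')" using u by auto
      then have "hd u \<notin> set w'" using d(2) by auto
      then have "u' \<noteq> w" using u' hu w(1) by blast
      then show "\<exists>u'\<in>set r. set u \<subseteq> set u'" using u' by auto
    qed
  qed (use w Cons.prems ws' in auto)
  then show ?case using w ws' by simp
qed

section \<open>Canonical decompositions\<close>

definition decomposable :: "nat list \<Rightarrow> nat list \<Rightarrow> bool" where
  "decomposable q s \<longleftrightarrow> (\<exists>p r. is_perm p \<and> is_perm r \<and> s = inflate q [p, r])"

text \<open>A sum or skew sum of several parts can be cut at several places; indecomposability of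
  the first component selects the earliest cut. For simple quotients the cut is already
  forced.\<close>

definition canonical :: "nat list \<Rightarrow> nat list list \<Rightarrow> bool" where
  "canonical q ps \<longleftrightarrow> (q = [1, 2] \<or> q = [2, 1] \<or> simple_perm q) \<and> length ps = length q \<and>
     (\<forall>p\<in>set ps. is_perm p) \<and> (length q = 2 \<longrightarrow> \<not> decomposable q (hd ps))"

lemma simple_perm_length: "simple_perm q \<Longrightarrow> 4 \<le> length q"
  by (simp add: simple_perm_def)

lemma canonical_is_perm: "canonical q ps \<Longrightarrow> is_perm q"
  using is_perm_12 by (auto simp: canonical_def simple_perm_def)

lemma canonical_length: "canonical q ps \<Longrightarrow> 2 \<le> length q"
  by (auto simp: canonical_def dest: simple_perm_length)

section \<open>Sums and skew sums\<close>

lemma layered_pair: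
  "layered (zip [1, 2] [u, v]) \<longleftrightarrow> (\<forall>x\<in>set u. \<forall>y\<in>set v. x < y)"
  "layered (zip [2, 1] [u, v]) \<longleftrightarrow> (\<forall>x\<in>set u. \<forall>y\<in>set v. y < x)"
  by (auto simp: layered_def)

lemma decomposable_standardize:
  assumes q: "q = [1, 2] \<or> q = [2, 1]" and d: "distinct (u @ v)" and ne: "u \<noteq> []" "v \<noteq> []"
    and lay: "layered (zip q [u, v])"
  shows "standardize (u @ v) = inflate q [standardize u, standardize v]"
proof -
  have p: "is_perm q" using q is_perm_12 by auto
  have "standardize (concat [u, v]) = inflate (standardize q) (map standardize [u, v])"
    by (rule standardize_concat_eq_inflate) (use p q d ne lay in \<open>auto simp: is_perm_def\<close>)
  then show ?thesis using standardize_perm[OF p] by simp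
qed

lemma decomposable_iff:
  assumes q: "q = [1, 2] \<or> q = [2, 1]" and s: "is_perm s"
  shows "decomposable q s \<longleftrightarrow> (\<exists>u v. s = u @ v \<and> u \<noteq> [] \<and> v \<noteq> [] \<and> layered (zip q [u, v]))"
proof
  assume "decomposable q s"
  then obtain p r where pr: "is_perm p" "is_perm r" "s = inflate q [p, r]"
    by (auto simp: decomposable_def)
  have "is_perm q" using q is_perm_12 by auto
  then obtain ws where ws: "inflate q [p, r] = concat ws" "length ws = length q" "layered (zip q ws)"
    "[] \<notin> set ws"
    by (rule inflate_blocks[of q "[p, r]"]) (use q pr in auto)
  have "length ws = 2" using ws(2) q by auto
  then obtain u v where "ws = [u, v]" by (auto simp: length_Suc_conv numeral_eq_Suc)
  then show "\<exists>u v. s = u @ v \<and> u \<noteq> [] \<and> v \<noteq> [] \<and> layered (zip q [u, v])" using ws pr by auto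
next
  assume "\<exists>u v. s = u @ v \<and> u \<noteq> [] \<and> v \<noteq> [] \<and> layered (zip q [u, v])"
  then obtain u v where uv: "s = u @ v" "u \<noteq> []" "v \<noteq> []" "layered (zip q [u, v])" by blast
  have d: "distinct (u @ v)" using s uv by (simp add: is_perm_def)
  have "s = inflate q [standardize u, standardize v]"
    using decomposable_standardize[OF q d uv(2-4)] standardize_perm[OF s] uv(1) by simp
  moreover have "is_perm (standardize u)" "is_perm (standardize v)"
    using d uv by (auto intro: is_perm_standardize)
  ultimately show "decomposable q s" by (auto simp: decomposable_def)
qed

text \<open>Take the cut with the shortest first part. Were that part decomposable by the same
  quotient, its own first part would give a shorter cut of the whole word.\<close>

lemma decomposable_canonical:
  assumes q: "q = [1, 2] \<or> q = [2, 1]" and s: "is_perm s" and dec: "decomposable q s"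
  shows "\<exists>ps. canonical q ps \<and> s = inflate q ps"
proof -
  let ?P = "\<lambda>u. \<exists>v. s = u @ v \<and> u \<noteq> [] \<and> v \<noteq> [] \<and> layered (zip q [u, v])"
  obtain u0 where "?P u0" using dec decomposable_iff[OF q s] by blast
  then obtain u where "?P u" and least: "\<forall>u'. ?P u' \<longrightarrow> length u \<le> length u'"
    using ex_has_least_nat[of ?P u0 length] by blast
  then obtain v where uv: "s = u @ v" "u \<noteq> []" "v \<noteq> []" "layered (zip q [u, v])" by blast
  have d: "distinct (u @ v)" using s uv by (simp add: is_perm_def)
  have pu: "is_perm (standardize u)" and pv: "is_perm (standardize v)"
    using d uv by (auto intro: is_perm_standardize)
  have "\<not> decomposable q (standardize u)"
  proof
    assume "decomposable q (standardize u)"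
    then obtain u1 u2 where u12: "standardize u = u1 @ u2" "u1 \<noteq> []" "u2 \<noteq> []"
      "layered (zip q [u1, u2])"
      using decomposable_iff[OF q pu] by blast
    obtain f where f: "u = map f (standardize u)"
      "\<forall>x\<in>set (standardize u). \<forall>y\<in>set (standardize u). x < y \<longleftrightarrow> f x < f y"
      using order_iso_imp_map[OF order_iso_sym[OF order_iso_standardize]] by blast
    let ?u1 = "map f u1" and ?u2 = "map f u2"
    have u: "u = ?u1 @ ?u2" using f(1) u12(1) by simp
    have "layered (zip q [?u1, ?u2 @ v])"
      using q
    proof
      assume q: "q = [1, 2]"
      show ?thesis using f(2) u12(1,4) uv(4) u unfolding q layered_pair by auto
    next
      assume q: "q = [2, 1]"
      show ?thesis using f(2) u12(1,4) uv(4) u unfolding q layered_pair by auto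
    qed
    then have "?P ?u1" using uv(1,3) u u12 by (intro exI[of _ "?u2 @ v"]) auto
    then have "length u \<le> length ?u1" using least by blast
    then show False using u u12(3) by (metis add_le_same_cancel1 le_zero_eq length_0_conv
          length_append length_map)
  qed
  then have "canonical q [standardize u, standardize v]"
    using q pu pv by (auto simp: canonical_def)
  moreover have "s = inflate q [standardize u, standardize v]"
    using decomposable_standardize[OF q d uv(2-4)] standardize_perm[OF s] uv(1) by simp
  ultimately show ?thesis by blast
qed

text \<open>A decomposition into two blocks shows only that \<open>s\<close> is a sum or a skew sum,
  with no control over the first component; the canonical cut is then chosen anew. A simple label
  word yields the quotient by standardization.\<close>

theorem canonical_exists:
  assumes s: "is_perm s" "2 \<le> length s"
  shows "\<exists>q ps. canonical q ps \<and> s = inflate q ps"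
proof -
  have ds: "distinct s" using s by (simp add: is_perm_def)
  obtain zs where zs: "block_decomp zs" "concat (map snd zs) = s"
    "length zs = 2 \<or> simple_word (map fst zs)"
    using block_decomp_exists[OF ds s(2)] by blast
  have lay: "layered zs" and dist: "distinct (map fst zs)" and ne: "[] \<notin> set (map snd zs)"
    using zs by (auto simp: block_decomp_def)
  from zs(3) show ?thesis
  proof
    assume "length zs = 2"
    then obtain z z' where z: "zs = [z, z']" by (auto simp: length_Suc_conv numeral_eq_Suc)
    have "fst z < fst z' \<or> fst z' < fst z" using dist z by auto
    then have "layered (zip [1, 2] [snd z, snd z']) \<or> layered (zip [2, 1] [snd z, snd z'])"
    proof
      assume "fst z < fst z'"
      then have "\<forall>x\<in>set (snd z). \<forall>y\<in>set (snd z'). x < y"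
        using lay unfolding layered_def z by simp
      then show ?thesis unfolding layered_pair by (rule disjI1)
    next
      assume "fst z' < fst z"
      then have "\<forall>x\<in>set (snd z'). \<forall>y\<in>set (snd z). x < y"
        using lay unfolding layered_def z by simp
      then have "\<forall>x\<in>set (snd z). \<forall>y\<in>set (snd z'). y < x" by blast
      then show ?thesis unfolding layered_pair by (rule disjI2)
    qed
    then obtain q where q: "q = [1, 2] \<or> q = [2, 1]" "layered (zip q [snd z, snd z'])" by blast
    have "decomposable q s"
      unfolding decomposable_iff[OF q(1) s(1)] using zs(2) ne q(2) z
      by (intro exI[of _ "snd z"] exI[of _ "snd z'"]) auto
    then show ?thesis using decomposable_canonical[OF q(1) s(1)] by blast
  next
    assume sw: "simple_word (map fst zs)"
    let ?q = "standardize (map fst zs)" and ?ps = "map standardize (map snd zs)"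
    have l: "4 \<le> length zs" using sw by (simp add: simple_word_def)
    have "standardize (concat (map snd zs)) = inflate ?q ?ps"
      by (rule standardize_concat_eq_inflate)
        (use l dist lay ds zs(2) ne in \<open>auto simp: zip_map_fst_snd\<close>)
    then have "s = inflate ?q ?ps" using zs(2) standardize_perm[OF s(1)] by simp
    moreover have "simple_perm ?q"
    proof -
      have "map fst zs \<noteq> []" using l by auto
      then have "is_perm ?q" using dist by (simp add: is_perm_standardize)
      then show ?thesis
        using sw simple_word_order_iso order_iso_standardize simple_perm_iff by blast
    qed
    moreover have "is_perm p" if p: "p \<in> set ?ps" for p
    proof -
      obtain w where w: "w \<in> set (map snd zs)" "p = standardize w" using p by auto
      then have "distinct w" using ds unfolding zs(2)[symmetric] distinct_concat_iff by auto
      moreover have "w \<noteq> []" using w ne by blast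
      ultimately show ?thesis using w is_perm_standardize by blast
    qed
    ultimately show ?thesis using l
      by (intro exI[of _ ?q] exI[of _ ?ps]) (auto simp: canonical_def)
  qed
qed

text \<open>Simplicity of \<open>q\<close> puts every block over \<open>q'\<close> inside a block
  over \<open>q\<close>. Two blocks cannot cover the four or more blocks over \<open>q\<close>, so
  \<open>q'\<close> is simple as well; then the refinement holds in both directions and the cuttings
  agree.\<close>

lemma inflate_simple_unique:
  assumes q: "simple_perm q" and can: "canonical q ps" "canonical q' ps'"
    and eq: "inflate q ps = inflate q' ps'"
  shows "q = q' \<and> ps = ps'"
proof -
  obtain ws where ws: "inflate q ps = concat ws" "length ws = length q" "layered (zip q ws)"
    "ps = map standardize ws" "[] \<notin> set ws" "is_perm (inflate q ps)"
    by (rule inflate_blocks[of q ps]) (use can in \<open>auto simp: canonical_is_perm\<close>, auto simp: canonical_def)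
  obtain ws' where ws': "inflate q' ps' = concat ws'" "length ws' = length q'" "layered (zip q' ws')"
    "ps' = map standardize ws'" "[] \<notin> set ws'" "is_perm (inflate q' ps')"
    by (rule inflate_blocks[of q' ps']) (use can in \<open>auto simp: canonical_is_perm\<close>, auto simp: canonical_def)
  have pq: "is_perm q" "is_perm q'" using can canonical_is_perm by auto
  have d: "distinct (concat ws)" using ws by (simp add: is_perm_def)
  have bd: "block_decomp (zip q ws)" "block_decomp (zip q' ws')"
    using ws ws' pq by (auto simp: block_decomp_def is_perm_def)
  have ref: "\<exists>w\<in>set ws. set w' \<subseteq> set w" if "w' \<in> set ws'" for w'
  proof -
    have "w' \<in> snd ` set (zip q' ws')" using that ws'(2) by (metis map_snd_zip set_map)
    then obtain z' where "z' \<in> set (zip q' ws')" "w' = snd z'" by auto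
    then have "\<exists>z\<in>set (zip q ws). set w' \<subseteq> set (snd z)"
      using blocks_refine_simple[OF bd(1) _ bd(2)] ws ws' q eq canonical_length[OF can(2)]
      by (auto simp: simple_perm_iff)
    then show ?thesis by (metis prod.collapse set_zip_rightD)
  qed
  have "simple_perm q'"
  proof (rule ccontr)
    assume "\<not> simple_perm q'"
    then have "length ws' = 2" using ws'(2) can(2) by (auto simp: canonical_def)
    then obtain u v where uv: "ws' = [u, v]" by (auto simp: length_Suc_conv numeral_eq_Suc)
    obtain w1 w2 where w: "w1 \<in> set ws" "w2 \<in> set ws" "set u \<subseteq> set w1" "set v \<subseteq> set w2"
      using ref uv by (metis list.set_intros)
    have "distinct ws"
      using d ws(5) by (simp add: distinct_concat_iff)
    then have "card (set ws) = length q" using ws(2) distinct_card by metis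
    then have "\<not> set ws \<subseteq> {w1, w2}"
      using simple_perm_length[OF q] card_mono[of "{w1, w2}" "set ws"]
      by (auto simp: card_insert_if split: if_splits)
    then obtain w3 where w3: "w3 \<in> set ws" "w3 \<noteq> w1" "w3 \<noteq> w2" by blast
    then have "hd w3 \<in> set w3" using ws(5) by (metis hd_in_set)
    moreover have "set w3 \<inter> set w1 = {}" "set w3 \<inter> set w2 = {}"
      using d w w3 by (auto simp: distinct_concat_iff)
    moreover have "hd w3 \<in> set u \<union> set v"
    proof -
      have "hd w3 \<in> set (concat ws)" using calculation(1) w3(1) by auto
      also have "concat ws = u @ v" using ws(1) ws'(1) eq uv by simp
      finally show ?thesis by simp
    qed
    ultimately show False using w by blast
  qed
  have ref': "\<exists>w'\<in>set ws'. set w \<subseteq> set w'" if "w \<in> set ws" for w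
  proof -
    have "w \<in> snd ` set (zip q ws)" using that ws(2) by (metis map_snd_zip set_map)
    then obtain z where "z \<in> set (zip q ws)" "w = snd z" by auto
    then have "\<exists>z\<in>set (zip q' ws'). set w \<subseteq> set (snd z)"
      using blocks_refine_simple[OF bd(2) _ bd(1)] ws ws' \<open>simple_perm q'\<close> eq canonical_length[OF can(1)]
      by (auto simp: simple_perm_iff)
    then show ?thesis by (metis prod.collapse set_zip_rightD)
  qed
  have "ws = ws'"
    using concat_partition_unique[of ws ws'] ws ws' eq d ref ref' by auto
  then show ?thesis using quotient_eq_standardize ws ws' pq by metis
qed

text \<open>The first entry of the word lies in the first block and the last entry in the second
  block of either decomposition, so their order determines the quotient. Different cuts would split
  the longer first block.\<close>

lemma inflate_pair_unique:
  assumes q: "q = [1, 2] \<or> q = [2, 1]" "q' = [1, 2] \<or> q' = [2, 1]"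
    and can: "canonical q ps" "canonical q' ps'" and eq: "inflate q ps = inflate q' ps'"
  shows "q = q' \<and> ps = ps'"
proof -
  obtain ws where ws: "inflate q ps = concat ws" "length ws = length q" "layered (zip q ws)"
    "ps = map standardize ws" "[] \<notin> set ws" "is_perm (inflate q ps)"
    by (rule inflate_blocks[of q ps]) (use can in \<open>auto simp: canonical_is_perm\<close>, auto simp: canonical_def)
  obtain ws' where ws': "inflate q' ps' = concat ws'" "length ws' = length q'" "layered (zip q' ws')"
    "ps' = map standardize ws'" "[] \<notin> set ws'" "is_perm (inflate q' ps')"
    by (rule inflate_blocks[of q' ps']) (use can in \<open>auto simp: canonical_is_perm\<close>, auto simp: canonical_def)
  have "length ws = 2" "length ws' = 2" using q ws(2) ws'(2) by auto
  then obtain u v u' v' where uv: "ws = [u, v]" "ws' = [u', v']"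
    by (auto simp: length_Suc_conv numeral_eq_Suc)
  have ne: "u \<noteq> []" "v \<noteq> []" "u' \<noteq> []" "v' \<noteq> []" using uv ws(5) ws'(5) by auto
  have e: "u @ v = u' @ v'" using eq ws(1) ws'(1) uv by simp
  have d: "distinct (u @ v)" using ws(1,6) uv by (simp add: is_perm_def)
  have lay: "layered (zip q [u, v])" "layered (zip q' [u', v'])" using ws(3) ws'(3) uv by auto
  have qq: "q = q'"
  proof (rule ccontr)
    assume "q \<noteq> q'"
    have "hd u = hd u'" "last v = last v'"
      using arg_cong[OF e, of hd] arg_cong[OF e, of last] ne by simp_all
    then have m: "hd u \<in> set u" "last v \<in> set v" "hd u \<in> set u'" "last v \<in> set v'"
      using ne by (metis hd_in_set last_in_set)+
    have "q = [1, 2] \<and> q' = [2, 1] \<or> q = [2, 1] \<and> q' = [1, 2]" using q \<open>q \<noteq> q'\<close> by auto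
    then show False
    proof (elim disjE conjE)
      assume q: "q = [1, 2]" "q' = [2, 1]"
      show False using lay m unfolding q layered_pair by (meson less_asym)
    next
      assume q: "q = [2, 1]" "q' = [1, 2]"
      show False using lay m unfolding q layered_pair by (meson less_asym)
    qed
  qed
  \<comment> \<open>If \<open>a\<close> is a proper prefix of \<open>a'\<close>, the rest of
    \<open>a'\<close> belongs to \<open>b\<close>, so the cut after \<open>a\<close> decomposes
    \<open>a'\<close> by \<open>q\<close>.\<close>
  have no: False
    if "a @ b = a' @ b'" "length a < length a'" "a \<noteq> []" "layered (zip q [a, b])" "distinct (a @ b)"
      "\<not> decomposable q (standardize a')" for a b a' b'
  proof -
    have "a' = a @ drop (length a) a' \<and> b = drop (length a) a' @ b'"
      using that(1,2) by (auto simp: append_eq_append_conv2)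
    then obtain c where c: "a' = a @ c" "b = c @ b'" by blast
    have "c \<noteq> []" using c that(2) by auto
    moreover have "layered (zip q [a, c])"
      using q(1)
    proof
      assume q: "q = [1, 2]"
      show ?thesis using that(4) c unfolding q layered_pair by auto
    next
      assume q: "q = [2, 1]"
      show ?thesis using that(4) c unfolding q layered_pair by auto
    qed
    ultimately have "standardize a' = inflate q [standardize a, standardize c]"
      using decomposable_standardize[OF q(1), of a c] that(3,5) c by auto
    moreover have "is_perm (standardize a)" "is_perm (standardize c)"
      using that(3,5) \<open>c \<noteq> []\<close> c by (auto intro: is_perm_standardize)
    ultimately show False using that(6) by (auto simp: decomposable_def)
  qed
  have nd: "\<not> decomposable q (standardize u)" "\<not> decomposable q (standardize u')"
    using can ws(4) ws'(4) uv q qq by (auto simp: canonical_def)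
  have "length u = length u'"
    using no[OF e _ ne(1) lay(1) d nd(2)] no[OF e[symmetric] _ ne(3) _ _ nd(1)] lay(2) qq d e
    by (metis nat_neq_iff)
  then show ?thesis using e uv ws(4) ws'(4) qq by simp
qed

theorem canonical_unique:
  assumes "canonical q ps" "canonical q' ps'" "inflate q ps = inflate q' ps'"
  shows "q = q' \<and> ps = ps'"
proof (cases "simple_perm q \<or> simple_perm q'")
  case True
  then show ?thesis using inflate_simple_unique assms by metis
next
  case False
  then have "q = [1, 2] \<or> q = [2, 1]" "q' = [1, 2] \<or> q' = [2, 1]"
    using assms(1,2) unfolding canonical_def by blast+
  then show ?thesis using assms by (rule inflate_pair_unique)
qed

text \<open>By uniqueness the quotient alone decides indecomposability; this is why a sign on the
  left of an equation only removes one quotient from the right.\<close>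

lemma decomposable_inflate_canonical:
  assumes "canonical q ps" "r = [1, 2] \<or> r = [2, 1]"
  shows "decomposable r (inflate q ps) \<longleftrightarrow> q = r"
proof
  have p: "is_perm (inflate q ps)"
    using assms(1) canonical_is_perm by (intro is_perm_inflate) (auto simp: canonical_def)
  assume "decomposable r (inflate q ps)"
  then obtain ps' where "canonical r ps'" "inflate q ps = inflate r ps'"
    using decomposable_canonical[OF assms(2) p] by blast
  then show "q = r" using canonical_unique assms(1) by blast
next
  assume qr: "q = r"
  have c: "length ps = length q" "\<forall>p\<in>set ps. is_perm p"
    using assms(1) unfolding canonical_def by blast+
  then have "length ps = 2" using assms(2) qr by auto
  then obtain a b where ab: "ps = [a, b]" by (auto simp: length_Suc_conv numeral_eq_Suc)
  have "is_perm a" "is_perm b" using c(2) ab by auto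
  then show "decomposable r (inflate q ps)" unfolding decomposable_def qr ab by blast
qed

section \<open>Patterns in inflations\<close>

lemma subseq_concat_split:
  "subseq ys (concat ws) \<Longrightarrow> \<exists>vs. ys = concat vs \<and> list_all2 subseq vs ws"
proof (induction ws arbitrary: ys)
  case (Cons w ws)
  then obtain y1 y2 where y: "ys = y1 @ y2" "subseq y1 w" "subseq y2 (concat ws)"
    by (auto simp: subseq_append_iff)
  then obtain vs where "y2 = concat vs" "list_all2 subseq vs ws" using Cons.IH by blast
  then show ?case using y by (intro exI[of _ "y1 # vs"]) simp
qed simp

lemma subseq_concat_mono: "list_all2 subseq vs ws \<Longrightarrow> subseq (concat vs) (concat ws)"
  by (induction vs ws rule: list_all2_induct) (auto intro: list_emb_append_mono)

lemma layered_zip_subset: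
  assumes "layered (zip q ws)" "length ws = length q" "list_all2 (\<lambda>v w. set v \<subseteq> set w) vs ws"
  shows "layered (zip q vs)"
proof -
  have len: "length vs = length q" using assms by (auto dest: list_all2_lengthD)
  have sub: "set (vs ! i) \<subseteq> set (ws ! i)" if "i < length q" for i
    using assms(2,3) that by (auto simp: list_all2_conv_all_nth)
  show ?thesis using assms(1) sub unfolding layered_zip_nth[OF len] layered_zip_nth[OF assms(2)] by blast
qed

lemma layered_zip_map:
  assumes "layered (zip q vs)" "length vs = length q"
    "\<forall>x\<in>set (concat vs). \<forall>y\<in>set (concat vs). x < y \<longrightarrow> f x < f y"
  shows "layered (zip q (map (map f) vs))"
proof -
  have len: "length (map (map f) vs) = length q" using assms(2) by simp
  have mem: "x \<in> set (concat vs)" if "i < length q" "x \<in> set (vs ! i)" for i x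
    using that assms(2) by auto
  show ?thesis unfolding layered_zip_nth[OF len]
  proof (intro allI impI ballI)
    fix i j x y
    assume *: "i < length q" "j < length q" "q ! i < q ! j"
      "x \<in> set (map (map f) vs ! i)" "y \<in> set (map (map f) vs ! j)"
    then obtain x' y' where x': "x' \<in> set (vs ! i)" "x = f x'" "y' \<in> set (vs ! j)" "y = f y'"
      using assms(2) by auto
    then have "x' < y'" using assms(1) * unfolding layered_zip_nth[OF assms(2)] by blast
    then show "x < y" using assms(3) mem[OF *(1) x'(1)] mem[OF *(2) x'(3)] x' by blast
  qed
qed

lemma subseq_imp_set_subset: "subseq xs ys \<Longrightarrow> set xs \<subseteq> set ys"
  by (auto dest: list_emb_set)

text \<open>An occurrence is cut along the blocks and its pieces are written in the values of
  \<open>g\<close>. They inherit the layering; conversely, occurrences of the pieces in the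
  components are glued by it. Pieces may be empty, as an occurrence can miss blocks.\<close>

lemma pattern_inflate_iff:
  assumes "is_perm q" "length ps = length q" "\<forall>p\<in>set ps. is_perm p"
  shows "g \<preceq> inflate q ps \<longleftrightarrow> (\<exists>us. length us = length q \<and> concat us = g \<and> layered (zip q us) \<and>
     (\<forall>i<length q. us ! i \<preceq> ps ! i))"
proof -
  obtain ws where ws: "inflate q ps = concat ws" "length ws = length q" "layered (zip q ws)"
    "ps = map standardize ws" "is_perm (inflate q ps)"
    using assms by (rule inflate_blocks)
  have oi: "order_iso (ws ! i) (ps ! i)" if "i < length q" for i
    using that ws(2,4) order_iso_standardize by simp
  show ?thesis
  proof
    assume "g \<preceq> inflate q ps"
    then obtain ys where ys: "subseq ys (concat ws)" "order_iso g ys"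
      using ws(1) by (auto simp: pattern_of_def)
    obtain vs where vs: "ys = concat vs" "list_all2 subseq vs ws"
      using subseq_concat_split[OF ys(1)] by blast
    have lvs: "length vs = length q" using vs(2) ws(2) by (auto dest: list_all2_lengthD)
    obtain f where f: "g = map f ys" "\<forall>x\<in>set ys. \<forall>y\<in>set ys. x < y \<longleftrightarrow> f x < f y"
      using order_iso_imp_map[OF order_iso_sym[OF ys(2)]] by blast
    have "list_all2 (\<lambda>v w. set v \<subseteq> set w) vs ws"
      using vs(2) by (rule list_all2_mono) (rule subseq_imp_set_subset)
    then have "layered (zip q vs)" using layered_zip_subset ws by blast
    then have lay: "layered (zip q (map (map f) vs))"
      by (rule layered_zip_map) (use lvs f(2) vs(1) in auto)
    have "map (map f) vs ! i \<preceq> ps ! i" if i: "i < length q" for i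
    proof -
      have "subseq (vs ! i) (ws ! i)" using vs(2) i lvs by (auto simp: list_all2_conv_all_nth)
      then have "vs ! i \<preceq> ps ! i" using pattern_subseq pattern_order_iso oi[OF i] by blast
      moreover have "order_iso (vs ! i) (map f (vs ! i))"
      proof (rule order_iso_map)
        have "vs ! i \<in> set vs" using i lvs by simp
        then have "set (vs ! i) \<subseteq> set ys" using vs(1) by auto
        then show "x < y \<longleftrightarrow> f x < f y" if "x \<in> set (vs ! i)" "y \<in> set (vs ! i)" for x y
          using f(2) that by blast
      qed
      ultimately show ?thesis using pattern_order_iso_left i lvs by simp
    qed
    then show "\<exists>us. length us = length q \<and> concat us = g \<and> layered (zip q us) \<and>
     (\<forall>i<length q. us ! i \<preceq> ps ! i)"
      using lay lvs f(1) vs(1) by (intro exI[of _ "map (map f) vs"]) (simp add: map_concat)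
  next
    assume "\<exists>us. length us = length q \<and> concat us = g \<and> layered (zip q us) \<and>
     (\<forall>i<length q. us ! i \<preceq> ps ! i)"
    then obtain us where us: "length us = length q" "concat us = g" "layered (zip q us)"
      "\<forall>i<length q. us ! i \<preceq> ps ! i" by blast
    have "\<exists>v. subseq v (ws ! i) \<and> order_iso (us ! i) v" if "i < length q" for i
    proof -
      have "us ! i \<preceq> ws ! i" using us(4) that pattern_order_iso order_iso_sym[OF oi[OF that]] by blast
      then show ?thesis by (auto simp: pattern_of_def)
    qed
    then obtain v where v: "\<forall>i<length q. subseq (v i) (ws ! i) \<and> order_iso (us ! i) (v i)" by metis
    define vs where "vs = map v [0..<length q]"
    have sub: "list_all2 subseq vs ws" and iso: "list_all2 order_iso us vs"
      using v ws(2) us(1) by (auto simp: vs_def list_all2_conv_all_nth)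
    have "list_all2 (\<lambda>v w. set v \<subseteq> set w) vs ws"
      using sub by (rule list_all2_mono) (rule subseq_imp_set_subset)
    then have "layered (zip q vs)" using layered_zip_subset ws by blast
    then have "order_iso (concat us) (concat vs)"
      using layered_order_iso_concat[OF us(3) _ is_permD(1)[OF assms(1)] us(1) iso] by blast
    then show "g \<preceq> inflate q ps"
      using subseq_concat_mono[OF sub] us(2) ws(1) by (auto simp: pattern_of_def)
  qed
qed

lemma pattern_inflate_component:
  assumes "is_perm q" "length ps = length q" "\<forall>p\<in>set ps. is_perm p" "p \<in> set ps"
  shows "p \<preceq> inflate q ps"
proof -
  obtain ws where ws: "inflate q ps = concat ws" "ps = map standardize ws"
    using assms(1-3) by (rule inflate_blocks)
  obtain w where w: "w \<in> set ws" "p = standardize w" using assms(4) ws(2) by auto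
  obtain w1 w2 where "ws = w1 @ w # w2" using w(1) by (meson split_list)
  then have "subseq w (concat ws)" by (simp add: subseq_drop_many subseq_rev_drop_many)
  then show ?thesis
    using pattern_subseq pattern_order_iso_left order_iso_standardize ws(1) w(2) by metis
qed

lemma pattern_inflate_quotient:
  assumes "is_perm q" "length ps = length q" "\<forall>p\<in>set ps. is_perm p"
  shows "q \<preceq> inflate q ps"
proof -
  obtain ws where ws: "inflate q ps = concat ws" "length ws = length q" "layered (zip q ws)"
    "[] \<notin> set ws"
    using assms by (rule inflate_blocks)
  have "subseq (map hd ws) (concat ws)" using ws(4)
  proof (induction ws)
    case (Cons w ws)
    then have "w = [hd w] @ tl w" "subseq (map hd ws) (concat ws)" by auto
    then show ?case by (metis append_Cons append_Nil concat.simps(2) list.simps(9) subseq_Cons2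
          subseq_drop_many)
  qed simp
  then show ?thesis
    using quotient_eq_standardize[OF assms(1) ws(2-4)] ws(1) pattern_subseq pattern_order_iso_left
      order_iso_standardize by metis
qed

text \<open>An interval of an interval is an interval. This keeps the finite set of blocks stable
  when a pattern is split over the components of an inflation.\<close>

lemma block_of_normalized_block:
  assumes b: "is_perm b" and g: "g \<in> normalized_blocks b" "g = us @ xs @ vs" "is_block us xs vs"
  shows "standardize xs \<in> normalized_blocks b"
proof -
  obtain as ys cs where y: "g = standardize ys" "b = as @ ys @ cs" "is_block as ys cs"
    using g(1) unfolding normalized_blocks_eq[OF b] by blast
  obtain f where f: "ys = map f g" "\<forall>x\<in>set g. \<forall>y\<in>set g. x < y \<longleftrightarrow> f x < f y"
    using order_iso_imp_map[OF order_iso_sym[OF order_iso_standardize]] y(1) by blast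
  have blk: "is_block (map f us) (map f xs) (map f vs)"
    by (rule is_block_map) (use f(2) g in auto)
  have ys: "ys = map f us @ map f xs @ map f vs" using f(1) g(2) by simp
  have "is_block (as @ map f us) (map f xs) (map f vs @ cs)"
    using blk y(3) unfolding ys is_block_def by auto
  moreover have "b = (as @ map f us) @ map f xs @ (map f vs @ cs)" using y(2) ys by simp
  ultimately have "standardize (map f xs) \<in> normalized_blocks b"
    unfolding normalized_blocks_eq[OF b] by blast
  moreover have "order_iso xs (map f xs)" by (rule order_iso_map) (use f(2) g(2) in auto)
  ultimately show ?thesis using standardize_cong by simp
qed

lemma layered_block_normalized:
  assumes b: "is_perm b" and g: "concat us \<in> normalized_blocks b"
    and q: "distinct q" "length us = length q" "layered (zip q us)"
    and u: "u \<in> set us" "u \<noteq> []"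
  shows "standardize u \<in> normalized_blocks b"
proof -
  obtain i where i: "i < length us" "us ! i = u" using u(1) by (auto simp: in_set_conv_nth)
  define zs where "zs = zip q us"
  have lz: "length zs = length q" using q(2) by (simp add: zs_def)
  have split: "zs = take i zs @ zs ! i # drop (Suc i) zs"
    using i q(2) lz by (simp add: id_take_nth_drop)
  have snd: "snd (zs ! i) = u" using i q(2) by (simp add: zs_def)
  have us: "map snd zs = us" and qs: "map fst zs = q" using q(2) by (simp_all add: zs_def)
  have "is_block (concat (map snd (take i zs))) u (concat (map snd (drop (Suc i) zs)))"
    using layered_is_block[of "take i zs" "zs ! i" "drop (Suc i) zs"] q(1,3) u(2) snd qs
    unfolding split[symmetric] zs_def[symmetric] by simp
  moreover have "concat us = concat (map snd (take i zs)) @ u @ concat (map snd (drop (Suc i) zs))"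
    using arg_cong[OF split, of "\<lambda>zs. concat (map snd zs)"] snd us by simp
  ultimately show ?thesis using block_of_normalized_block[OF b g] by blast
qed

section \<open>The substitution closure\<close>

lemma inflate_one: "inflate [1] [p] = p"
  by (simp add: inflate_def cong: conj_cong)

locale substitution_class =
  fixes C :: "nat list set"
  assumes class_C: "perm_class C" and C12: "[1, 2] \<in> C" and C21: "[2, 1] \<in> C"
begin

lemma C_perm: "s \<in> C \<Longrightarrow> is_perm s"
  using class_C by (simp add: perm_class_def)

lemma C_closed: "s \<in> C \<Longrightarrow> is_perm p \<Longrightarrow> p \<preceq> s \<Longrightarrow> p \<in> C"
  using class_C unfolding perm_class_def by blast

lemma one_in_C: "[1] \<in> C"
proof (rule C_closed[OF C12])
  show "[1] \<preceq> [1, 2]" by (rule pattern_subseq) simp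
qed simp

lemma subst_pow_Suc_mono: "subst_pow C k \<subseteq> subst_pow C (Suc k)"
proof
  fix s assume "s \<in> subst_pow C k"
  then have "\<exists>t ps. s = inflate t ps \<and> t \<in> C \<and> length ps = length t \<and> set ps \<subseteq> subst_pow C k"
    using one_in_C inflate_one[of s] by (intro exI[of _ "[1]"] exI[of _ "[s]"]) auto
  then show "s \<in> subst_pow C (Suc k)" by simp
qed

lemma subst_pow_mono: "k \<le> m \<Longrightarrow> subst_pow C k \<subseteq> subst_pow C m"
  using lift_Suc_mono_le[of "subst_pow C"] subst_pow_Suc_mono by blast

lemma subst_pow_perm: "s \<in> subst_pow C k \<Longrightarrow> is_perm s"
proof (induction k arbitrary: s)
  case (Suc k)
  then obtain t ps where "s = inflate t ps" "t \<in> C" "length ps = length t" "set ps \<subseteq> subst_pow C k"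
    by auto
  then show ?case using Suc.IH C_perm is_perm_inflate by blast
qed (simp add: C_perm)

lemma closure_perm: "s \<in> subst_closure C \<Longrightarrow> is_perm s"
  by (auto simp: subst_closure_def subst_pow_perm)

lemma C_subset_closure: "C \<subseteq> subst_closure C"
  unfolding subst_closure_def using subst_pow.simps(1)[of C] by blast

lemma closure_inflate:
  assumes "q \<in> C" "length ps = length q" "set ps \<subseteq> subst_closure C"
  shows "inflate q ps \<in> subst_closure C"
proof -
  have "\<exists>k. set ps \<subseteq> subst_pow C k" using assms(3)
  proof (induction ps)
    case (Cons p ps)
    then obtain k m where "set ps \<subseteq> subst_pow C k" "p \<in> subst_pow C m"
      by (auto simp: subst_closure_def)
    then have "set (p # ps) \<subseteq> subst_pow C (max k m)"
      using subst_pow_mono[of k "max k m"] subst_pow_mono[of m "max k m"] by auto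
    then show ?case by blast
  qed simp
  then obtain k where "set ps \<subseteq> subst_pow C k" by blast
  then have "inflate q ps \<in> subst_pow C (Suc k)" using assms by auto
  then show ?thesis unfolding subst_closure_def by blast
qed

text \<open>A pattern of an inflation is itself an inflation: the blocks it meets give a pattern of
  the quotient, and its pieces are patterns of the components. Hence the level in the tower does not
  rise.\<close>

lemma subst_pow_closed: "s \<in> subst_pow C k \<Longrightarrow> is_perm p \<Longrightarrow> p \<preceq> s \<Longrightarrow> p \<in> subst_pow C k"
proof (induction k arbitrary: s p)
  case 0
  then show ?case using C_closed by simp
next
  case (Suc k)
  from Suc.prems(1) obtain t ps where t: "s = inflate t ps" "t \<in> C" "length ps = length t"
    "set ps \<subseteq> subst_pow C k" by auto
  have pt: "is_perm t" using C_perm t(2) .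
  have pps: "\<forall>p\<in>set ps. is_perm p" using t(4) subst_pow_perm by blast
  obtain us where us: "length us = length t" "concat us = p" "layered (zip t us)"
    "\<forall>i<length t. us ! i \<preceq> ps ! i"
    using Suc.prems(3) unfolding t(1) pattern_inflate_iff[OF pt t(3) pps] by blast
  \<comment> \<open>Blocks missed by the occurrence are dropped together with their labels, because
    the components of an inflation are nonempty.\<close>
  define zs where "zs = filter (\<lambda>z. snd z \<noteq> []) (zip t us)"
  have zip_zs: "zip (map fst zs) (map snd zs) = zs" by (simp add: zip_map_fst_snd)
  have sub: "subseq (map fst zs) t"
  proof -
    have "subseq (map fst zs) (map fst (zip t us))" unfolding zs_def by (rule subseq_map) simp
    then show ?thesis using us(1) by simp
  qed
  have con: "concat (map snd zs) = p"
  proof -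
    have "concat (map snd (filter (\<lambda>z. snd z \<noteq> []) z)) = concat (map snd z)"
      for z :: "(nat \<times> nat list) list"
      by (induction z) auto
    then show ?thesis using us(1,2) by (simp add: zs_def)
  qed
  have d: "distinct (map fst zs)"
    using sub pt by (metis is_permD(1) subseq_conv_nths distinct_nthsI)
  have ne: "[] \<notin> set (map snd zs)" by (auto simp: zs_def)
  have zne: "map fst zs \<noteq> []" using con Suc.prems(2) by (auto simp: is_perm_def)
  have "layered zs" using us(3) by (rule layered_mono) (auto simp: zs_def)
  then have "standardize p = inflate (standardize (map fst zs)) (map standardize (map snd zs))"
    using standardize_concat_eq_inflate[of "map fst zs" "map snd zs"] d zne ne con zip_zs Suc.prems(2)
    by (simp add: is_perm_def)
  then have p: "p = inflate (standardize (map fst zs)) (map standardize (map snd zs))"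
    using standardize_perm Suc.prems(2) by simp
  have "standardize (map fst zs) \<in> C"
  proof (rule C_closed[OF t(2)])
    show "is_perm (standardize (map fst zs))" using is_perm_standardize d zne by blast
    show "standardize (map fst zs) \<preceq> t"
      using pattern_order_iso_left[OF pattern_subseq[OF sub] order_iso_standardize] .
  qed
  moreover have "set (map standardize (map snd zs)) \<subseteq> subst_pow C k"
  proof
    fix r assume "r \<in> set (map standardize (map snd zs))"
    then obtain z where z: "z \<in> set zs" "r = standardize (snd z)" by auto
    then have "snd z \<noteq> []" "z \<in> set (zip t us)" by (auto simp: zs_def)
    then obtain i where i: "i < length t" "snd z = us ! i" using us(1) by (auto simp: set_zip)
    have "distinct (snd z)"
      using z(1) con Suc.prems(2) by (auto simp: is_perm_def distinct_concat_iff)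
    then have "is_perm r" using is_perm_standardize z(2) \<open>snd z \<noteq> []\<close> by blast
    moreover have "r \<preceq> ps ! i"
      using us(4) i z(2) pattern_order_iso_left order_iso_standardize by metis
    moreover have "ps ! i \<in> subst_pow C k" using t(3,4) i by (metis nth_mem subsetD)
    ultimately show "r \<in> subst_pow C k" using Suc.IH by blast
  qed
  ultimately have "\<exists>s ps. p = inflate s ps \<and> s \<in> C \<and> length ps = length s \<and> set ps \<subseteq> subst_pow C k"
    using p by (intro exI[of _ "standardize (map fst zs)"] exI[of _ "map standardize (map snd zs)"]) simp
  then show ?case by simp
qed

lemma closure_closed: "s \<in> subst_closure C \<Longrightarrow> is_perm p \<Longrightarrow> p \<preceq> s \<Longrightarrow> p \<in> subst_closure C"
  unfolding subst_closure_def using subst_pow_closed by blast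

text \<open>The blocks of an inflation are intervals, so in a simple permutation they are single
  entries, and the inflation equals its quotient, which lies in \<open>C\<close>. A quotient of size
  1 has the whole permutation as its block and is handled by induction.\<close>

lemma simple_in_subst_pow: "p \<in> subst_pow C k \<Longrightarrow> simple_perm p \<Longrightarrow> p \<in> C"
proof (induction k arbitrary: p)
  case (Suc k)
  from Suc.prems(1) obtain t ps where t: "p = inflate t ps" "t \<in> C" "length ps = length t"
    "set ps \<subseteq> subst_pow C k" by auto
  have pt: "is_perm t" using C_perm t(2) .
  have pps: "\<forall>p\<in>set ps. is_perm p" using t(4) subst_pow_perm by blast
  show ?case
  proof (cases "length t = 1")
    case True
    then have "t = [1]" using is_perm_length_1 pt by blast
    moreover obtain r where "ps = [r]" using True t(3) by (auto simp: length_Suc_conv)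
    ultimately have "p \<in> subst_pow C k" using t inflate_one by simp
    then show ?thesis using Suc by blast
  next
    case False
    obtain ws where ws: "inflate t ps = concat ws" "length ws = length t" "layered (zip t ws)"
      "ps = map standardize ws" "[] \<notin> set ws" "is_perm (inflate t ps)"
      using pt t(3) pps by (rule inflate_blocks)
    define zs where "zs = zip t ws"
    have z: "map fst zs = t" "map snd zs = ws" using ws(2) by (simp_all add: zs_def)
    have single: "length (snd z) = 1" if zz: "z \<in> set zs" for z
    proof -
      obtain u v where uv: "zs = u @ z # v" using zz by (meson split_list)
      have ne: "\<forall>w\<in>set zs. snd w \<noteq> []" using ws(5) unfolding z(2)[symmetric] by force
      have "layered (u @ z # v)" "distinct (map fst (u @ z # v))" "snd z \<noteq> []"
        using ws(3) z(1) pt ne zz uv unfolding zs_def[symmetric] by (auto simp: is_perm_def)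
      then have blk: "is_block (concat (map snd u)) (snd z) (concat (map snd v))"
        by (rule layered_is_block)
      have "p = concat (map snd u) @ snd z @ concat (map snd v)"
        using t(1) ws(1) z(2) uv by auto
      then consider "length (snd z) = 1" | "concat (map snd u) = []" "concat (map snd v) = []"
        using blk Suc.prems(2) unfolding simple_perm_iff simple_word_def by blast
      then show ?thesis
      proof cases
        case 2
        then have "u = []" "v = []" using ne uv by (cases u; cases v; auto)+
        then have "length zs = 1" using uv by simp
        then show ?thesis using False z(1) by (metis length_map)
      qed
    qed
    have "concat ws = map hd ws"
    proof -
      have "\<forall>w\<in>set ws. length w = 1" using single unfolding z(2)[symmetric] by auto
      then show ?thesis
      proof (induction ws)
        case (Cons w ws)
        then show ?case by (cases w) auto
      qed simp
    qed
    then have "t = standardize p"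
      using quotient_eq_standardize[OF pt ws(2,3,5)] t(1) ws(1) by simp
    then show ?thesis using t(2) Suc.prems(2) standardize_perm by (simp add: simple_perm_def)
  qed
qed simp

lemma simple_in_closure: "p \<in> subst_closure C \<Longrightarrow> simple_perm p \<Longrightarrow> p \<in> C"
  unfolding subst_closure_def using simple_in_subst_pow by blast

text \<open>Quotient and components are patterns of \<open>s\<close> and so stay in the closure; the
  quotient, if simple, even lies in \<open>C\<close>.\<close>

lemma closure_decomposition:
  assumes "s \<in> subst_closure C" "s \<noteq> [1]"
  obtains q ps where "canonical q ps" "s = inflate q ps" "q \<in> {[1, 2], [2, 1]} \<union> simples C"
    "set ps \<subseteq> subst_closure C"
proof -
  have s: "is_perm s" using closure_perm assms(1) .
  then have "length s \<noteq> 0" "length s \<noteq> 1" using is_perm_length_1 assms(2) by (auto simp: is_perm_def)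
  then have "2 \<le> length s" by linarith
  then obtain q ps where c: "canonical q ps" "s = inflate q ps" using canonical_exists[OF s] by blast
  have cp: "is_perm q" "length ps = length q" "\<forall>p\<in>set ps. is_perm p"
    using c(1) canonical_is_perm unfolding canonical_def by blast+
  have "set ps \<subseteq> subst_closure C"
    using closure_closed assms(1) pattern_inflate_component[OF cp] cp(3) c(2) by blast
  moreover have "q \<in> subst_closure C"
    using closure_closed assms(1) pattern_inflate_quotient[OF cp] cp(1) c(2) by blast
  then have "q \<in> {[1, 2], [2, 1]} \<union> simples C"
    using c(1) simple_in_closure unfolding canonical_def simples_def by blast
  ultimately show ?thesis using that c by blast
qed

lemma not_in_C_contains_basis:
  "is_perm s \<Longrightarrow> s \<notin> C \<Longrightarrow> \<exists>b\<in>class_basis C. b \<preceq> s"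
proof (induction "length s" arbitrary: s rule: less_induct)
  case less
  show ?case
  proof (cases "s \<in> class_basis C")
    case True
    then show ?thesis using pattern_subseq[of s s] by auto
  next
    case False
    then obtain p where p: "is_perm p" "p \<preceq> s" "p \<noteq> s" "p \<notin> C"
      using less.prems unfolding class_basis_def by blast
    have "length p < length s"
      using pattern_length[OF p(2)] pattern_length_eq[OF p(2)] p(1,3) less.prems(1) by fastforce
    then obtain b where "b \<in> class_basis C" "b \<preceq> p" using less.hyps p by blast
    then show ?thesis using pattern_trans p(2) by blast
  qed
qed

text \<open>Among the elements of the closure only non-simple basis elements can be contained: a
  simple one would itself be in the closure, hence in \<open>C\<close>, contrary to being a basis
  element.\<close>

lemma class_as_restriction:
  "C = {s \<in> subst_closure C. \<forall>b\<in>{b \<in> class_basis C. \<not> simple_perm b}. \<not> b \<preceq> s}" (is "_ = ?R")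
proof
  show "C \<subseteq> ?R"
    using C_subset_closure C_closed unfolding class_basis_def by blast
  show "?R \<subseteq> C"
  proof
    fix s assume s: "s \<in> ?R"
    show "s \<in> C"
    proof (rule ccontr)
      assume "s \<notin> C"
      then obtain b where b: "b \<in> class_basis C" "b \<preceq> s"
        using not_in_C_contains_basis closure_perm s by blast
      then have "simple_perm b" using s by blast
      moreover have "b \<in> subst_closure C"
        using closure_closed s b by (auto simp: class_basis_def)
      ultimately have "b \<in> C" using simple_in_closure by blast
      then show False using b(1) by (simp add: class_basis_def)
    qed
  qed
qed

end

section \<open>The algorithm\<close>

text \<open>Factors of a word are among its subsequences, so all factorizations into three parts are
  found by testing triples of subsequences, with operations that have computability rules.\<close>

definition block_triples :: "nat list \<Rightarrow> (nat list \<times> nat list \<times> nat list) list" where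
  "block_triples b = filter
     (\<lambda>t. b = fst t @ fst (snd t) @ snd (snd t) \<and> is_block (fst t) (fst (snd t)) (snd (snd t)))
     (List.product (subseqs b) (List.product (subseqs b) (subseqs b)))"

definition simple_test :: "nat list \<Rightarrow> bool" where
  "simple_test b \<longleftrightarrow> 3 < length b \<and> (\<forall>t\<in>set (block_triples b).
     length (fst (snd t)) = 1 \<or> fst t = [] \<and> snd (snd t) = [])"

text \<open>Repetitions are removed so that the subsequences of the result correspond one to one to
  subsets; otherwise restrictions and summands would be listed twice.\<close>

definition block_list :: "nat list list \<Rightarrow> nat list list" where
  "block_list Bs = remdups (concat (map
     (\<lambda>b. map (\<lambda>t. standardize (fst (snd t))) (block_triples b))
     (filter (\<lambda>b. \<not> simple_test b) Bs)))"

definition labellings :: "'a list \<Rightarrow> 'b list \<Rightarrow> ('a \<times> 'b) list list" where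
  "labellings ps X = foldr (\<lambda>p zss. concat (map (\<lambda>x. map (\<lambda>zs. (p, x) # zs) zss) X)) ps [[]]"

text \<open>Given an entry list of a quotient, each entry labelled with the set of those blocks that are
  contained in its component, decides whether the inflation contains \<open>g\<close>.\<close>

definition occurs :: "(nat \<times> nat list list) list \<Rightarrow> nat list \<Rightarrow> bool" where
  "occurs zs g \<longleftrightarrow> (\<exists>ts\<in>set (labellings zs (subseqs g)). concat (map snd ts) = g \<and>
     (\<forall>t\<in>set ts. snd t = [] \<or> standardize (snd t) \<in> set (snd (fst t))) \<and>
     layered (map (\<lambda>t. (fst (fst t), snd t)) ts))"

type_synonym rcode = "nat \<times> nat list list \<times> nat list list"

text \<open>The signs \<open>Unsigned\<close>, \<open>Plus\<close>, \<open>Minus\<close> are coded as 0, 1, 2. Only the first component of a sum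
  (the one at value 1) and of a skew sum (the one at value 2) carries a sign.\<close>

definition component_sign :: "nat list \<Rightarrow> nat \<Rightarrow> nat" where
  "component_sign q p = (if q = [1, 2] \<and> p = 1 then 1 else if q = [2, 1] \<and> p = 2 then 2 else 0)"

definition atom :: "nat list list \<Rightarrow> nat \<Rightarrow> nat list list \<Rightarrow> rcode" where
  "atom N d A = (d, filter (\<lambda>g. g \<notin> set A) N, A)"

text \<open>The given list of simple permutations may repeat elements, and a repeated nonempty
  summand would violate disjointness; hence \<open>remdups\<close>.\<close>

definition quotients :: "nat \<Rightarrow> nat list list \<Rightarrow> nat list list" where
  "quotients d Ss = filter (\<lambda>q. \<not> (d = 1 \<and> q = [1, 2]) \<and> \<not> (d = 2 \<and> q = [2, 1]))
     ([1, 2] # [2, 1] # remdups Ss)"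

text \<open>A tuple of atoms contributes wholly or not at all, since the atoms decide which blocks
  the inflation contains. Tuples with an unrealizable atom may be kept: their summand is
  empty.\<close>

definition candidates ::
  "nat list list \<Rightarrow> nat list list \<Rightarrow> rcode \<Rightarrow> (nat list \<times> (nat \<times> nat list list) list) list" where
  "candidates N Ss l = filter
     (\<lambda>c. (\<forall>g\<in>set (fst (snd l)). \<not> occurs (snd c) g) \<and> (\<forall>g\<in>set (snd (snd l)). occurs (snd c) g))
     (concat (map (\<lambda>q. map (\<lambda>zs. (q, zs)) (labellings q (subseqs N))) (quotients (fst l) Ss)))"

definition summand_code ::
  "nat list list \<Rightarrow> nat list \<times> (nat \<times> nat list list) list \<Rightarrow> nat list \<times> rcode list" where
  "summand_code N c =
     (fst c, map (\<lambda>z. atom N (component_sign (fst c) (fst z)) (snd z)) (snd c))"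

definition equation_code ::
  "nat list list \<Rightarrow> nat list list \<Rightarrow> rcode \<Rightarrow> rcode \<times> bool \<times> (nat list \<times> rcode list) list" where
  "equation_code N Ss l =
     (l, [1] \<notin> set (fst (snd l)) \<and> (\<forall>g\<in>set (snd (snd l)). g = [1]),
      map (summand_code N) (candidates N Ss l))"

text \<open>All signs and all pairs of subsets are taken, including contradictory pairs, which
  denote the empty set. So every atom on a right-hand side has its equation in advance.\<close>

definition restriction_codes :: "nat list list \<Rightarrow> rcode list" where
  "restriction_codes N = List.product [0, 1, 2] (List.product (subseqs N) (subseqs N))"

definition system_code ::
  "nat list list \<Rightarrow> nat list list \<Rightarrow> (rcode \<times> bool \<times> (nat list \<times> rcode list) list) list" where
  "system_code N Ss = map (equation_code N Ss) (restriction_codes N)"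

subsection \<open>Computability\<close>

lemma computable_standardize [comp_intros]:
  assumes "computable f" shows "computable (\<lambda>x. standardize (f x))"
proof -
  have "computable standardize" unfolding standardize_def by (intro comp_intros)
  from computable_compose[OF this assms] show ?thesis .
qed

lemma computable_layered [comp_intros]:
  assumes "computable f" shows "computable (\<lambda>x. layered (f x))"
proof -
  have "computable layered" unfolding layered_def by (intro comp_intros)
  from computable_compose[OF this assms] show ?thesis .
qed

lemma computable_is_block [comp_intros]:
  assumes "computable f" "computable g" "computable h"
  shows "computable (\<lambda>x. is_block (f x) (g x) (h x))"
proof (rule computable_compose3[OF _ assms])
  show "computable (\<lambda>p. is_block (fst p) (fst (snd p)) (snd (snd p)))"
    unfolding is_block_def by (intro comp_intros)
qed

lemma computable_block_triples [comp_intros]: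
  assumes "computable f" shows "computable (\<lambda>x. block_triples (f x))"
proof -
  have "computable block_triples" unfolding block_triples_def by (intro comp_intros)
  from computable_compose[OF this assms] show ?thesis .
qed

lemma computable_simple_test [comp_intros]:
  assumes "computable f" shows "computable (\<lambda>x. simple_test (f x))"
proof -
  have "computable simple_test" unfolding simple_test_def by (intro comp_intros)
  from computable_compose[OF this assms] show ?thesis .
qed

lemma computable_block_list [comp_intros]:
  assumes "computable f" shows "computable (\<lambda>x. block_list (f x))"
proof -
  have "computable block_list" unfolding block_list_def by (intro comp_intros)
  from computable_compose[OF this assms] show ?thesis .
qed

lemma computable_labellings [comp_intros]:
  assumes "computable f" "computable g" shows "computable (\<lambda>x. labellings (f x) (g x))"
proof (rule computable_compose2[OF _ assms])
  show "computable (\<lambda>p. labellings (fst p :: 'b list) (snd p :: 'c list))"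
    unfolding labellings_def by (intro comp_intros)
qed

lemma computable_occurs [comp_intros]:
  assumes "computable f" "computable g" shows "computable (\<lambda>x. occurs (f x) (g x))"
proof (rule computable_compose2[OF _ assms])
  show "computable (\<lambda>p. occurs (fst p) (snd p))"
    unfolding occurs_def by (intro comp_intros)
qed

lemma computable_component_sign [comp_intros]:
  assumes "computable f" "computable g" shows "computable (\<lambda>x. component_sign (f x) (g x))"
  unfolding component_sign_def by (intro comp_intros assms)

lemma computable_atom [comp_intros]:
  assumes "computable f" "computable g" "computable h"
  shows "computable (\<lambda>x. atom (f x) (g x) (h x))"
proof (rule computable_compose3[OF _ assms])
  show "computable (\<lambda>p. atom (fst p) (fst (snd p)) (snd (snd p)))"
    unfolding atom_def by (intro comp_intros)
qed

lemma computable_quotients [comp_intros]: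
  assumes "computable f" "computable g" shows "computable (\<lambda>x. quotients (f x) (g x))"
proof (rule computable_compose2[OF _ assms])
  show "computable (\<lambda>p. quotients (fst p) (snd p))"
    unfolding quotients_def by (intro comp_intros)
qed

lemma computable_candidates [comp_intros]:
  assumes "computable f" "computable g" "computable h"
  shows "computable (\<lambda>x. candidates (f x) (g x) (h x))"
proof (rule computable_compose3[OF _ assms])
  show "computable (\<lambda>p. candidates (fst p) (fst (snd p)) (snd (snd p)))"
    unfolding candidates_def by (intro comp_intros)
qed

lemma computable_summand_code [comp_intros]:
  assumes "computable f" "computable g" shows "computable (\<lambda>x. summand_code (f x) (g x))"
proof (rule computable_compose2[OF _ assms])
  show "computable (\<lambda>p. summand_code (fst p) (snd p))"
    unfolding summand_code_def by (intro comp_intros)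
qed

lemma computable_equation_code [comp_intros]:
  assumes "computable f" "computable g" "computable h"
  shows "computable (\<lambda>x. equation_code (f x) (g x) (h x))"
proof (rule computable_compose3[OF _ assms])
  show "computable (\<lambda>p. equation_code (fst p) (fst (snd p)) (snd (snd p)))"
    unfolding equation_code_def by (intro comp_intros)
qed

lemma computable_system_code: "computable (\<lambda>p. system_code (block_list (fst p)) (snd p))"
  unfolding system_code_def restriction_codes_def by (intro comp_intros)

text \<open>The two inputs are joined into one code by the pairing program; the prescribed coding of
  lists of permutations agrees with \<open>enc\<close>, which is the identity on numbers.\<close>

lemma system_code_program:
  "\<exists>alg. \<forall>Bs Ss. rec_eval alg [encode_perms Bs, encode_perms Ss] (enc (system_code (block_list Bs) Ss))"
proof -
  obtain r where r: "\<And>p. rec_eval r [enc p] (enc (system_code (block_list (fst p)) (snd p)))"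
    using computable_system_code unfolding computable_def by blast
  obtain rp where rp: "\<And>xs. length xs = 2 \<Longrightarrow> rec_eval rp xs (prod_encode (xs ! 0, xs ! 1))"
    using nat_computable_prod_encode unfolding nat_computable_def by blast
  have e: "encode_perms ps = enc ps" for ps :: "nat list list"
  proof -
    have "(enc :: nat \<Rightarrow> nat) = id" by (auto simp: enc_nat_def)
    moreover have "(enc :: nat list \<Rightarrow> nat) = list_encode"
      using calculation by (auto simp: enc_list_def)
    ultimately show ?thesis by (simp add: encode_perms_def enc_list_def)
  qed
  have "rec_eval (Comp r [rp]) [enc Bs, enc Ss] (enc (system_code (block_list Bs) Ss))"
    for Bs Ss :: "nat list list"
    using rp[of "[enc Bs, enc Ss]"] r[of "(Bs, Ss)"]
    by (intro rec_eval.comp[where zs = "[enc (Bs, Ss)]"]) (auto simp: enc_prod_def)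
  then show ?thesis unfolding e by blast
qed

subsection \<open>Decoding the output\<close>

definition restriction_of :: "rcode \<Rightarrow> restriction" where
  "restriction_of l = Restriction (decode_sign (fst l)) (set (fst (snd l))) (set (snd (snd l)))"

definition equation_of :: "rcode \<times> bool \<times> (nat list \<times> rcode list) list \<Rightarrow> equation" where
  "equation_of e = Equation (restriction_of (fst e)) (fst (snd e))
     (map (\<lambda>c. (fst c, map restriction_of (snd c))) (snd (snd e)))"

lemma list_decode_enc: "list_decode (enc xs) = map enc xs"
  by (simp add: enc_list_def)

lemma map_enc_nat [simp]: "map enc xs = xs" for xs :: "nat list"
  by (rule map_idI) (simp add: enc_nat_def)

lemma prod_decode_enc: "prod_decode (enc p) = (enc (fst p), enc (snd p))"
  by (simp add: enc_prod_def)

lemma decode_restriction_enc: "decode_restriction (enc l) = restriction_of l" for l :: rcode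
  by (simp add: decode_restriction_def restriction_of_def prod_decode_enc decode_perms_def
      list_decode_enc enc_nat_def image_image)

lemma decode_system_enc: "decode_system (enc es) = map equation_of es"
  by (simp add: decode_system_def decode_equation_def equation_of_def decode_summand_def
      prod_decode_enc list_decode_enc decode_restriction_enc enc_bool_def o_def enc_nat_def)

subsection \<open>Correctness\<close>

lemma set_block_triples:
  "(us, xs, vs) \<in> set (block_triples b) \<longleftrightarrow> b = us @ xs @ vs \<and> is_block us xs vs"
  unfolding block_triples_def
  by (auto intro: subseq_drop_many subseq_rev_drop_many)

lemma simple_test_iff: "is_perm b \<Longrightarrow> simple_test b \<longleftrightarrow> simple_perm b"
proof -
  assume b: "is_perm b"
  have "(\<forall>t\<in>set (block_triples b). length (fst (snd t)) = 1 \<or> fst t = [] \<and> snd (snd t) = []) \<longleftrightarrow>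
    (\<forall>us xs vs. b = us @ xs @ vs \<and> is_block us xs vs \<longrightarrow> length xs = 1 \<or> us = [] \<and> vs = [])"
    by (simp only: split_paired_Ball_Sigma split_paired_all Ball_def split_paired_All
        set_block_triples fst_conv snd_conv)
  moreover have "3 < length b \<longleftrightarrow> 4 \<le> length b" by linarith
  ultimately show ?thesis using b unfolding simple_test_def simple_perm_iff simple_word_def by simp
qed

lemma set_block_list:
  assumes "\<forall>b\<in>set Bs. is_perm b"
  shows "set (block_list Bs) = (\<Union>b\<in>{b \<in> set Bs. \<not> simple_perm b}. normalized_blocks b)"
proof -
  have "(\<lambda>t. standardize (fst (snd t))) ` set (block_triples b) = normalized_blocks b"
    if b: "b \<in> set Bs" for b
  proof -
    have "is_perm b" using assms b by blast
    show ?thesis unfolding normalized_blocks_eq[OF \<open>is_perm b\<close>]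
    proof (intro set_eqI iffI)
      fix d assume "d \<in> (\<lambda>t. standardize (fst (snd t))) ` set (block_triples b)"
      then obtain us xs vs where "(us, xs, vs) \<in> set (block_triples b)" "d = standardize xs" by auto
      then show "d \<in> {standardize xs | us xs vs. b = us @ xs @ vs \<and> is_block us xs vs}"
        unfolding set_block_triples by blast
    next
      fix d assume "d \<in> {standardize xs | us xs vs. b = us @ xs @ vs \<and> is_block us xs vs}"
      then obtain us xs vs where "(us, xs, vs) \<in> set (block_triples b)" "d = standardize xs"
        unfolding set_block_triples by blast
      then show "d \<in> (\<lambda>t. standardize (fst (snd t))) ` set (block_triples b)" by force
    qed
  qed
  moreover have "{b \<in> set Bs. \<not> simple_test b} = {b \<in> set Bs. \<not> simple_perm b}"
    using simple_test_iff assms by blast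
  ultimately show ?thesis unfolding block_list_def by auto
qed

section \<open>Labellings and the occurrence test\<close>

lemma set_labellings:
  "zs \<in> set (labellings ps X) \<longleftrightarrow> map fst zs = ps \<and> set (map snd zs) \<subseteq> set X"
proof (induction ps arbitrary: zs)
  case Nil
  then show ?case by (auto simp: labellings_def)
next
  case (Cons p ps)
  have "zs \<in> set (labellings (p # ps) X) \<longleftrightarrow>
    (\<exists>x\<in>set X. \<exists>zs'\<in>set (labellings ps X). zs = (p, x) # zs')"
    by (auto simp: labellings_def)
  then show ?case unfolding Bex_def Cons.IH by (cases zs) auto
qed

lemma distinct_labellings:
  fixes ps :: "'a list" and X :: "'b list"
  shows "distinct X \<Longrightarrow> distinct (labellings ps X)"
proof (induction ps)
  case Nil
  then show ?case by (simp add: labellings_def)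
next
  case (Cons p ps)
  have l: "labellings (p # ps) X = concat (map (\<lambda>x. map (\<lambda>zs. (p, x) # zs) (labellings ps X)) X)"
    by (simp add: labellings_def)
  have "distinct (concat (map (\<lambda>x. map (\<lambda>zs. (p, x) # zs) L) Y))" if "distinct L" "distinct Y"
    for L :: "('a \<times> 'b) list list" and Y :: "'b list"
    using that by (induction Y) (auto simp: distinct_map inj_on_def)
  then show ?case unfolding l using Cons by simp
qed

lemma distinct_concat_map_Pair:
  "distinct qs \<Longrightarrow> (\<And>q. distinct (f q)) \<Longrightarrow> distinct (concat (map (\<lambda>q. map (\<lambda>z. (q, z)) (f q)) qs))"
  by (induction qs) (auto simp: distinct_map inj_on_def)

lemma standardize_pattern_iff: "standardize u \<preceq> p \<longleftrightarrow> u \<preceq> p"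
  using pattern_order_iso_left order_iso_standardize order_iso_sym by blast

text \<open>The test differs from \<open>pattern_inflate_iff\<close> only in asking the recorded
  labels instead of the components. It gives the same answer because empty pieces are always
  contained and nonempty ones, by \<open>closed\<close>, standardize to members of \<open>N\<close>,
  on which labels and components agree.\<close>

lemma occurs_iff:
  assumes q: "is_perm q" "length ps = length q" "\<forall>p\<in>set ps. is_perm p"
    and zs: "map fst zs = q" "\<And>i d. i < length q \<Longrightarrow> d \<in> set N \<Longrightarrow> d \<in> set (snd (zs ! i)) \<longleftrightarrow> d \<preceq> ps ! i"
    "\<And>i. i < length q \<Longrightarrow> set (snd (zs ! i)) \<subseteq> set N"
    and closed: "\<And>us u. length us = length q \<Longrightarrow> layered (zip q us) \<Longrightarrow> concat us = g \<Longrightarrow>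
      u \<in> set us \<Longrightarrow> u \<noteq> [] \<Longrightarrow> standardize u \<in> set N"
  shows "occurs zs g \<longleftrightarrow> g \<preceq> inflate q ps"
proof
  assume "occurs zs g"
  then obtain ts where ts: "map fst ts = zs" "concat (map snd ts) = g"
    "\<forall>t\<in>set ts. snd t = [] \<or> standardize (snd t) \<in> set (snd (fst t))"
    "layered (map (\<lambda>t. (fst (fst t), snd t)) ts)"
    unfolding occurs_def Bex_def set_labellings by blast
  let ?us = "map snd ts"
  have len: "length ts = length q" using ts(1) zs(1) by (metis length_map)
  have "map (\<lambda>t. (fst (fst t), snd t)) ts = zip q ?us"
    unfolding zs(1)[symmetric] ts(1)[symmetric] by (rule nth_equalityI) auto
  then have lay: "layered (zip q ?us)" using ts(4) by simp
  have "?us ! i \<preceq> ps ! i" if i: "i < length q" for i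
  proof (cases "?us ! i = []")
    case True
    then show ?thesis by (simp add: pattern_subseq)
  next
    case False
    have "ts ! i \<in> set ts" using i len by simp
    moreover have "snd (ts ! i) = ?us ! i" "fst (ts ! i) = zs ! i" using i len ts(1) by auto
    ultimately have "standardize (?us ! i) \<in> set (snd (zs ! i))" using ts(3) False by metis
    then show ?thesis using zs(2,3)[OF i] standardize_pattern_iff by blast
  qed
  then show "g \<preceq> inflate q ps"
    unfolding pattern_inflate_iff[OF q] using lay ts(2) len by (intro exI[of _ ?us]) simp
next
  assume "g \<preceq> inflate q ps"
  then obtain us where us: "length us = length q" "concat us = g" "layered (zip q us)"
    "\<forall>i<length q. us ! i \<preceq> ps ! i"
    unfolding pattern_inflate_iff[OF q] by blast
  let ?ts = "zip zs us"
  have len: "length zs = length q" using zs(1) by (metis length_map)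
  have "subseq u g" if u: "u \<in> set us" for u
  proof -
    obtain u1 u2 where "us = u1 @ u # u2" using u by (meson split_list)
    then show ?thesis using us(2) by (auto simp: subseq_drop_many subseq_rev_drop_many)
  qed
  then have "?ts \<in> set (labellings zs (subseqs g))"
    unfolding set_labellings using len us(1) by auto
  moreover have "concat (map snd ?ts) = g" using us(1,2) len by simp
  moreover have "snd t = [] \<or> standardize (snd t) \<in> set (snd (fst t))" if t: "t \<in> set ?ts" for t
  proof (cases "snd t = []")
    case False
    obtain i where i: "i < length q" "t = (zs ! i, us ! i)" using t len us(1) by (auto simp: set_zip)
    have "us ! i \<in> set us" using i us(1) by simp
    then have "standardize (us ! i) \<in> set N" using closed us False i by simp
    moreover have "standardize (us ! i) \<preceq> ps ! i" using us(4) i standardize_pattern_iff by blast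
    ultimately show ?thesis using zs(2) i by simp
  qed simp
  moreover have "map (\<lambda>t. (fst (fst t), snd t)) ?ts = zip q us"
    unfolding zs(1)[symmetric] by (rule nth_equalityI) (auto simp: len us(1))
  ultimately show "occurs zs g" unfolding occurs_def using us(3)
    by (intro bexI[of _ ?ts]) auto
qed

lemma decode_sign_simps [simp]:
  "decode_sign 0 = Unsigned" "decode_sign 1 = Plus" "decode_sign (Suc 0) = Plus" "decode_sign 2 = Minus"
  by (simp_all add: decode_sign_def)

context substitution_class
begin

lemma signed_closure_iff:
  "s \<in> signed_closure C d \<longleftrightarrow> s \<in> subst_closure C \<and>
     (d = Plus \<longrightarrow> \<not> decomposable [1, 2] s) \<and> (d = Minus \<longrightarrow> \<not> decomposable [2, 1] s)"
  by (cases d) (simp_all add: oplus_indec_def ominus_indec_def decomposable_def)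

text \<open>Justifies \<open>component_sign\<close>: the sign on the first component of a sum or
  skew sum expresses exactly the indecomposability demanded by \<open>canonical\<close>, so
  canonicity becomes a componentwise membership.\<close>

lemma components_iff_canonical:
  assumes q: "q \<in> {[1, 2], [2, 1]} \<union> simples C" and len: "length ps = length q"
  shows "(\<forall>i<length q. ps ! i \<in> signed_closure C (decode_sign (component_sign q (q ! i)))) \<longleftrightarrow>
    canonical q ps \<and> set ps \<subseteq> subst_closure C"
proof -
  have all: "(\<forall>i<length q. ps ! i \<in> subst_closure C) \<longleftrightarrow> set ps \<subseteq> subst_closure C"
    using len by (auto simp: in_set_conv_nth subset_iff)
  have perm: "set ps \<subseteq> subst_closure C \<Longrightarrow> \<forall>p\<in>set ps. is_perm p" using closure_perm by blast
  consider "q = [1, 2]" | "q = [2, 1]" | "q \<in> simples C" using q by blast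
  then show ?thesis
  proof cases
    case 1
    then obtain a b where ab: "ps = [a, b]" using len by (auto simp: length_Suc_conv)
    show ?thesis using perm
      by (auto simp: 1 ab canonical_def component_sign_def signed_closure_iff less_Suc_eq)
  next
    case 2
    then obtain a b where ab: "ps = [a, b]" using len by (auto simp: length_Suc_conv)
    show ?thesis using perm
      by (auto simp: 2 ab canonical_def component_sign_def signed_closure_iff less_Suc_eq)
  next
    case 3
    then have s: "simple_perm q" by (simp add: simples_def)
    then have l: "4 \<le> length q" by (rule simple_perm_length)
    then have "q \<noteq> [1, 2]" "q \<noteq> [2, 1]" "length q \<noteq> 2" by auto
    then show ?thesis
      unfolding canonical_def signed_closure_iff using s perm len all by (auto simp: component_sign_def)
  qed
qed

end

text \<open>Finiteness of the basis and of the set of simple permutations enters through the lists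
  enumerating them.\<close>

locale class_input = substitution_class +
  fixes Bs Ss :: "nat list list"
  assumes Bs: "set Bs = class_basis C" and Ss: "set Ss = simples C"
begin

section \<open>The set of blocks and the atoms over it\<close>

definition N :: "nat list list" where "N = block_list Bs"

lemma basis_perm: "b \<in> set Bs \<Longrightarrow> is_perm b"
  unfolding Bs by (simp add: class_basis_def)

lemma set_N: "set N = (\<Union>b\<in>{b \<in> class_basis C. \<not> simple_perm b}. normalized_blocks b)"
  unfolding N_def Bs[symmetric] by (rule set_block_list) (use basis_perm in blast)

lemma distinct_N: "distinct N"
  by (simp add: N_def block_list_def)

lemma N_perm: "g \<in> set N \<Longrightarrow> is_perm g"
  unfolding set_N by (auto simp: normalized_blocks_def)

lemma N_closed:
  assumes "g \<in> set N" "distinct q" "length us = length q" "layered (zip q us)" "concat us = g"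
    "u \<in> set us" "u \<noteq> []"
  shows "standardize u \<in> set N"
proof -
  obtain b where b: "b \<in> class_basis C" "\<not> simple_perm b" "g \<in> normalized_blocks b"
    using assms(1) unfolding set_N by blast
  have "is_perm b" using b(1) by (simp add: class_basis_def)
  then have "standardize u \<in> normalized_blocks b"
    using layered_block_normalized assms b(3) by metis
  then show ?thesis unfolding set_N using b by blast
qed

text \<open>Subsequences of a list without repetition are canonical codes of its subsets; both the
  uniqueness of left-hand sides and the disjointness of summands rest on this.\<close>

lemma inj_set_subseqs: "inj_on set (set (subseqs N))"
  using distinct_set_subseqs[OF distinct_N] by (simp add: distinct_map)

lemma subseqs_set_exists: "X \<subseteq> set N \<Longrightarrow> \<exists>A\<in>set (subseqs N). set A = X"
  using subseqs_powset[of N] by (metis PowI imageE)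

lemma restriction_of_atom:
  assumes "A \<in> set (subseqs N)"
  shows "s \<in> restriction_set C (restriction_of (atom N d A)) \<longleftrightarrow>
    s \<in> signed_closure C (decode_sign d) \<and> (\<forall>g\<in>set N. g \<in> set A \<longleftrightarrow> g \<preceq> s)"
proof -
  have "set A \<subseteq> set N" using assms by (simp add: subseq_imp_set_subset)
  then show ?thesis by (auto simp: restriction_set_def restriction_of_def atom_def)
qed

definition summand_set :: "nat list \<times> (nat \<times> nat list list) list \<Rightarrow> nat list set" where
  "summand_set c = inflate_sets (fst c) (map (restriction_set C)
     (map restriction_of (snd (summand_code N c))))"

text \<open>Signs of the components amount to canonicity, and an atom fixes containment for every
  member of \<open>N\<close>; so a summand collects the canonical inflations whose components have
  the prescribed sets of contained blocks.\<close>

lemma summand_set_iff: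
  assumes q: "q \<in> {[1, 2], [2, 1]} \<union> simples C" and zs: "zs \<in> set (labellings q (subseqs N))"
  shows "s \<in> summand_set (q, zs) \<longleftrightarrow> (\<exists>ps. s = inflate q ps \<and> canonical q ps \<and>
    set ps \<subseteq> subst_closure C \<and> (\<forall>i<length q. \<forall>g\<in>set N. g \<in> set (snd (zs ! i)) \<longleftrightarrow> g \<preceq> ps ! i))"
proof -
  have z: "map fst zs = q" "set (map snd zs) \<subseteq> set (subseqs N)" using zs by (auto simp: set_labellings)
  have len: "length zs = length q" using z(1) by (metis length_map)
  have f: "fst (zs ! i) = q ! i" if "i < length q" for i using that len z(1) by (metis nth_map)
  have sn: "snd (zs ! i) \<in> set (subseqs N)" if "i < length q" for i
    using that len z(2) by (auto simp: subset_iff)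
  let ?Ds = "map (restriction_set C) (map restriction_of (snd (summand_code N (q, zs))))"
  have Ds: "list_all2 (\<in>) ps ?Ds \<longleftrightarrow> length ps = length q \<and>
     (\<forall>i<length q. ps ! i \<in> signed_closure C (decode_sign (component_sign q (q ! i)))) \<and>
     (\<forall>i<length q. \<forall>g\<in>set N. g \<in> set (snd (zs ! i)) \<longleftrightarrow> g \<preceq> ps ! i)" for ps
  proof -
    have "list_all2 (\<in>) ps ?Ds \<longleftrightarrow> length ps = length q \<and> (\<forall>i<length q. ps ! i \<in>
      restriction_set C (restriction_of (atom N (component_sign q (q ! i)) (snd (zs ! i)))))"
      using len f by (auto simp: list_all2_conv_all_nth summand_code_def)
    then show ?thesis using restriction_of_atom[OF sn] by auto
  qed
  have "list_all2 (\<in>) ps ?Ds \<longleftrightarrow> canonical q ps \<and> set ps \<subseteq> subst_closure C \<and>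
     (\<forall>i<length q. \<forall>g\<in>set N. g \<in> set (snd (zs ! i)) \<longleftrightarrow> g \<preceq> ps ! i)" for ps
    unfolding Ds using components_iff_canonical[OF q, of ps] by (auto simp: canonical_def)
  then show ?thesis unfolding summand_set_def inflate_sets_def by auto
qed

lemma occurs_summand:
  assumes "zs \<in> set (labellings q (subseqs N))" "canonical q ps"
    "\<forall>i<length q. \<forall>g\<in>set N. g \<in> set (snd (zs ! i)) \<longleftrightarrow> g \<preceq> ps ! i" "g \<in> set N"
  shows "occurs zs g \<longleftrightarrow> g \<preceq> inflate q ps"
proof (rule occurs_iff[where N = N])
  have z: "map fst zs = q" "set (map snd zs) \<subseteq> set (subseqs N)"
    using assms(1) by (auto simp: set_labellings)
  then show "map fst zs = q" by simp
  have len: "length zs = length q" using z(1) by (metis length_map)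
  show "set (snd (zs ! i)) \<subseteq> set N" if "i < length q" for i
  proof -
    have "snd (zs ! i) \<in> set (subseqs N)"
      using z(2) that len by (metis length_map nth_map nth_mem subsetD)
    then show ?thesis by (simp add: subseq_imp_set_subset)
  qed
  have p: "is_perm q" using assms(2) by (rule canonical_is_perm)
  then show "is_perm q" .
  show "length ps = length q" "\<forall>p\<in>set ps. is_perm p"
    using assms(2) unfolding canonical_def by blast+
  show "d \<in> set (snd (zs ! i)) \<longleftrightarrow> d \<preceq> ps ! i" if "i < length q" "d \<in> set N" for i d
    using assms(3) that by blast
  show "standardize u \<in> set N" if "length us = length q" "layered (zip q us)" "concat us = g"
    "u \<in> set us" "u \<noteq> []" for us u
    using N_closed[OF assms(4) is_permD(1)[OF p] that] .
qed

lemma set_quotients: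
  "q \<in> set (quotients d Ss) \<longleftrightarrow> q \<in> {[1, 2], [2, 1]} \<union> simples C \<and>
     \<not> (d = 1 \<and> q = [1, 2]) \<and> \<not> (d = 2 \<and> q = [2, 1])"
  unfolding quotients_def set_filter list.set set_remdups Ss by blast

lemma set_candidates:
  "c \<in> set (candidates N Ss l) \<longleftrightarrow> fst c \<in> set (quotients (fst l) Ss) \<and>
     snd c \<in> set (labellings (fst c) (subseqs N)) \<and>
     (\<forall>g\<in>set (fst (snd l)). \<not> occurs (snd c) g) \<and> (\<forall>g\<in>set (snd (snd l)). occurs (snd c) g)"
  unfolding candidates_def by (cases c) auto

lemma distinct_candidates: "distinct (candidates N Ss l)"
proof -
  have "\<not> simple_perm [1, 2]" "\<not> simple_perm [2, 1]" by (auto dest: simple_perm_length)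
  then have "[1, 2] \<notin> set Ss" "[2, 1] \<notin> set Ss" using Ss by (auto simp: simples_def)
  then have "distinct (quotients (fst l) Ss)" unfolding quotients_def by (intro distinct_filter) simp
  moreover have "distinct (subseqs N)" using distinct_set_subseqs[OF distinct_N] by (simp add: distinct_map)
  ultimately show ?thesis unfolding candidates_def
    by (intro distinct_filter distinct_concat_map_Pair distinct_labellings)
qed

lemma restriction_codes_iff:
  "l \<in> set (restriction_codes N) \<longleftrightarrow> fst l \<in> {0, 1, 2} \<and>
     fst (snd l) \<in> set (subseqs N) \<and> snd (snd l) \<in> set (subseqs N)"
  unfolding restriction_codes_def by (cases l) auto

text \<open>The permutation of size 1 is indecomposable, hence lies in the closure with every sign,
  and the only member of \<open>N\<close> that it can contain is itself.\<close>

lemma one_in_restriction_iff: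
  assumes "l \<in> set (restriction_codes N)"
  shows "[1] \<in> restriction_set C (restriction_of l) \<longleftrightarrow>
    [1] \<notin> set (fst (snd l)) \<and> (\<forall>g\<in>set (snd (snd l)). g = [1])"
proof -
  have sub: "set (fst (snd l)) \<subseteq> set N" "set (snd (snd l)) \<subseteq> set N"
    using assms unfolding restriction_codes_iff by (simp_all add: subseq_imp_set_subset)
  have pat: "g \<preceq> [1] \<longleftrightarrow> g = [1]" if g: "g \<in> set N" for g
  proof
    assume "g \<preceq> [1]"
    then have "length g \<le> 1" using pattern_length by fastforce
    moreover have "length g \<noteq> 0" using N_perm[OF g] by (simp add: is_perm_def)
    ultimately have "length g = 1" by linarith
    then show "g = [1]" using is_perm_length_1 N_perm[OF g] by blast
  qed (simp add: pattern_subseq)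
  have nd: "\<not> decomposable q [1]" if "q = [1, 2] \<or> q = [2, 1]" for q
    unfolding decomposable_iff[OF that is_perm_1(1)] by (auto simp: Cons_eq_append_conv)
  have "[1] \<in> signed_closure C d" for d
    unfolding signed_closure_iff using nd one_in_C C_subset_closure by blast
  then show ?thesis using sub pat unfolding restriction_set_def restriction_of_def by (auto 0 3)
qed

text \<open>Membership in a restriction is settled by the quotient, which decides the sign, and by
  the atoms of the components, which decide containment. So each candidate summand lies inside, and
  an element of size at least 2 lies in the summand of its own quotient and atoms.\<close>

lemma restriction_eq_union:
  assumes l: "l \<in> set (restriction_codes N)"
  shows "restriction_set C (restriction_of l) =
    (if [1] \<notin> set (fst (snd l)) \<and> (\<forall>g\<in>set (snd (snd l)). g = [1]) then {[1]} else {}) \<union>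
    (\<Union>c\<in>set (candidates N Ss l). summand_set c)" (is "?L = ?O \<union> ?U")
proof -
  have sub: "set (fst (snd l)) \<subseteq> set N" "set (snd (snd l)) \<subseteq> set N" and d: "fst l \<in> {0, 1, 2}"
    using l unfolding restriction_codes_iff by (simp_all add: subseq_imp_set_subset)
  have L: "s \<in> ?L \<longleftrightarrow> s \<in> signed_closure C (decode_sign (fst l)) \<and>
    (\<forall>g\<in>set (fst (snd l)). \<not> g \<preceq> s) \<and> (\<forall>g\<in>set (snd (snd l)). g \<preceq> s)" for s
    by (simp add: restriction_set_def restriction_of_def)
  have sgn: "decode_sign (fst l) = Plus \<longleftrightarrow> fst l = 1" "decode_sign (fst l) = Minus \<longleftrightarrow> fst l = 2"
    using d by auto
  have O: "?O = ?L \<inter> {[1]}" using one_in_restriction_iff[OF l] by auto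
  have U: "?U \<subseteq> ?L"
  proof
    fix s assume "s \<in> ?U"
    then obtain c where c: "c \<in> set (candidates N Ss l)" "s \<in> summand_set c" by blast
    obtain q zs where qz: "c = (q, zs)" by (cases c)
    have q: "q \<in> set (quotients (fst l) Ss)" and zs: "zs \<in> set (labellings q (subseqs N))"
      and oc: "\<forall>g\<in>set (fst (snd l)). \<not> occurs zs g" "\<forall>g\<in>set (snd (snd l)). occurs zs g"
      using c(1) unfolding set_candidates qz by auto
    have q': "q \<in> {[1, 2], [2, 1]} \<union> simples C" "\<not> (fst l = 1 \<and> q = [1, 2])" "\<not> (fst l = 2 \<and> q = [2, 1])"
      using q unfolding set_quotients by blast+
    obtain ps where ps: "s = inflate q ps" "canonical q ps" "set ps \<subseteq> subst_closure C"
      "\<forall>i<length q. \<forall>g\<in>set N. g \<in> set (snd (zs ! i)) \<longleftrightarrow> g \<preceq> ps ! i"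
      using c(2) unfolding qz summand_set_iff[OF q'(1) zs] by blast
    have "q \<in> C" using q'(1) C12 C21 by (auto simp: simples_def)
    moreover have "length ps = length q" using ps(2) unfolding canonical_def by blast
    ultimately have "s \<in> subst_closure C" using closure_inflate ps(1,3) by blast
    then have "s \<in> signed_closure C (decode_sign (fst l))"
      unfolding signed_closure_iff sgn ps(1) using decomposable_inflate_canonical[OF ps(2)] q'(2,3) by blast
    moreover have "occurs zs g \<longleftrightarrow> g \<preceq> s" if "g \<in> set N" for g
      using occurs_summand[OF zs ps(2,4) that] ps(1) by simp
    ultimately show "s \<in> ?L" unfolding L using oc sub by blast
  qed
  have "s \<in> ?O \<union> ?U" if s: "s \<in> ?L" for s
  proof (cases "s = [1]")
    case True
    then show ?thesis using s O by blast
  next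
    case False
    have sc: "s \<in> signed_closure C (decode_sign (fst l))" using s L by blast
    then have "s \<in> subst_closure C" using signed_closure_iff by blast
    then obtain q ps where qp: "canonical q ps" "s = inflate q ps" "q \<in> {[1, 2], [2, 1]} \<union> simples C"
      "set ps \<subseteq> subst_closure C" using False by (rule closure_decomposition)
    have len: "length ps = length q" using qp(1) unfolding canonical_def by blast
    \<comment> \<open>Each quotient entry is labelled with the members of \<open>N\<close> contained
      in the component of \<open>s\<close> there; filtering \<open>N\<close> makes the label a
      subsequence of \<open>N\<close>.\<close>
    define zs where "zs = zip q (map (\<lambda>p. filter (\<lambda>g. g \<preceq> p) N) ps)"
    have zs: "zs \<in> set (labellings q (subseqs N))"
      unfolding set_labellings zs_def using len by auto
    have prof: "\<forall>i<length q. \<forall>g\<in>set N. g \<in> set (snd (zs ! i)) \<longleftrightarrow> g \<preceq> ps ! i"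
      unfolding zs_def using len by auto
    have q: "q \<in> set (quotients (fst l) Ss)"
      using sc qp(3) unfolding set_quotients signed_closure_iff sgn qp(2)
      using decomposable_inflate_canonical[OF qp(1)] by blast
    have "occurs zs g \<longleftrightarrow> g \<preceq> s" if "g \<in> set N" for g
      using occurs_summand[OF zs qp(1) prof that] qp(2) by simp
    then have "(q, zs) \<in> set (candidates N Ss l)"
      unfolding set_candidates using q zs s sub unfolding L by auto
    moreover have "s \<in> summand_set (q, zs)"
      unfolding summand_set_iff[OF qp(3) zs] using qp prof by blast
    ultimately show ?thesis by blast
  qed
  then show ?thesis using U O by blast
qed

text \<open>A common element has one canonical decomposition, so quotients and components agree; the
  labels are then subsequences of \<open>N\<close> with the same sets of contained blocks, hence
  equal.\<close>

lemma summand_sets_disjoint: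
  assumes c: "c \<in> set (candidates N Ss l)" "c' \<in> set (candidates N Ss l)"
    and s: "s \<in> summand_set c" "s \<in> summand_set c'"
  shows "c = c'"
proof -
  obtain q zs q' zs' where qz: "c = (q, zs)" "c' = (q', zs')" by (cases c, cases c')
  have q: "q \<in> {[1, 2], [2, 1]} \<union> simples C" "q' \<in> {[1, 2], [2, 1]} \<union> simples C"
    and zs: "zs \<in> set (labellings q (subseqs N))" "zs' \<in> set (labellings q' (subseqs N))"
    using c unfolding qz set_candidates set_quotients fst_conv snd_conv by blast+
  obtain ps where ps: "s = inflate q ps" "canonical q ps"
      "\<forall>i<length q. \<forall>g\<in>set N. g \<in> set (snd (zs ! i)) \<longleftrightarrow> g \<preceq> ps ! i"
    using s(1) unfolding qz summand_set_iff[OF q(1) zs(1)] by blast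
  obtain ps' where ps': "s = inflate q' ps'" "canonical q' ps'"
      "\<forall>i<length q'. \<forall>g\<in>set N. g \<in> set (snd (zs' ! i)) \<longleftrightarrow> g \<preceq> ps' ! i"
    using s(2) unfolding qz summand_set_iff[OF q(2) zs(2)] by blast
  have eq: "q = q'" "ps = ps'" using canonical_unique ps ps' by metis+
  have z: "map fst zs = q" "set (map snd zs) \<subseteq> set (subseqs N)" "map fst zs' = q"
    "set (map snd zs') \<subseteq> set (subseqs N)" using zs eq by (auto simp: set_labellings)
  have len: "length zs = length q" "length zs' = length q" using z by (metis length_map)+
  have "zs = zs'"
  proof (rule nth_equalityI)
    fix i assume "i < length zs"
    then have i: "i < length q" using len by simp
    have mem: "snd (zs ! i) \<in> set (subseqs N)" "snd (zs' ! i) \<in> set (subseqs N)"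
      using z(2,4) i len by (metis length_map nth_map nth_mem subsetD)+
    then have "set (snd (zs ! i)) \<subseteq> set N" "set (snd (zs' ! i)) \<subseteq> set N"
      by (auto dest: subseq_imp_set_subset)
    then have "set (snd (zs ! i)) = set (snd (zs' ! i))" using ps(3) ps'(3) i eq by blast
    then have "snd (zs ! i) = snd (zs' ! i)" using inj_set_subseqs mem by (simp add: inj_on_eq_iff)
    moreover have "fst (zs ! i) = fst (zs' ! i)" using z(1,3) i len by (metis nth_map)
    ultimately show "zs ! i = zs' ! i" by (simp add: prod_eq_iff)
  qed (simp add: len)
  then show ?thesis using eq qz by simp
qed

lemma one_notin_summand_set:
  assumes "c \<in> set (candidates N Ss l)" shows "[1] \<notin> summand_set c"
proof
  assume s: "[1] \<in> summand_set c"
  obtain q zs where qz: "c = (q, zs)" by (cases c)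
  have q: "q \<in> {[1, 2], [2, 1]} \<union> simples C" and zs: "zs \<in> set (labellings q (subseqs N))"
    using assms unfolding qz set_candidates set_quotients fst_conv snd_conv by blast+
  obtain ps where ps: "[1] = inflate q ps" "canonical q ps"
    using s unfolding qz summand_set_iff[OF q zs] by blast
  have "length q \<le> length (inflate q ps)"
    using ps(2) canonical_is_perm unfolding canonical_def by (intro length_inflate_ge) blast+
  then show False using canonical_length[OF ps(2)] ps(1)[symmetric] by simp
qed

section \<open>The system and its properties\<close>

definition sys :: "equation list" where "sys = map equation_of (system_code N Ss)"

lemma sys_eq: "sys = map (\<lambda>l. equation_of (equation_code N Ss l)) (restriction_codes N)"
  by (simp add: sys_def system_code_def)

lemma rhs_sets_code:
  "rhs_sets C (equation_of (equation_code N Ss l)) =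
    (if [1] \<notin> set (fst (snd l)) \<and> (\<forall>g\<in>set (snd (snd l)). g = [1]) then {[1]} else {}) #
    map summand_set (candidates N Ss l)"
  unfolding rhs_sets_def equation_of_def equation_code_def
  by (simp add: summand_set_def summand_code_def o_def split_beta)

lemma lhs_code [simp]: "lhs (equation_of (equation_code N Ss l)) = restriction_of l"
  by (simp add: equation_of_def equation_code_def)

lemma equation_holds_code:
  assumes l: "l \<in> set (restriction_codes N)"
  shows "equation_holds C (equation_of (equation_code N Ss l))"
  unfolding equation_holds_def
proof (intro conjI allI impI)
  let ?e = "equation_of (equation_code N Ss l)"
  show "restriction_set C (lhs ?e) = \<Union> (set (rhs_sets C ?e))"
    unfolding rhs_sets_code lhs_code restriction_eq_union[OF l] by simp
  fix i j assume i: "i < length (rhs_sets C ?e)" and j: "j < length (rhs_sets C ?e)" and ij: "i \<noteq> j"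
  let ?cs = "candidates N Ss l"
  have two: "summand_set (?cs ! m) \<inter> summand_set (?cs ! n) = {}"
    if "m < length ?cs" "n < length ?cs" "m \<noteq> n" for m n
    using summand_sets_disjoint[of "?cs ! m" l "?cs ! n"] that distinct_candidates[of l]
    by (auto simp: nth_eq_iff_index_eq)
  have one: "X \<inter> summand_set (?cs ! n) = {}" if "n < length ?cs" "X \<subseteq> {[1]}" for X n
    using one_notin_summand_set[of "?cs ! n" l] that by auto
  show "rhs_sets C ?e ! i \<inter> rhs_sets C ?e ! j = {}"
  proof (cases i)
    case 0
    then obtain n where n: "j = Suc n" using ij by (cases j) auto
    then show ?thesis using one[of n] j 0 unfolding rhs_sets_code by auto
  next
    case (Suc m)
    show ?thesis
    proof (cases j)
      case 0
      then show ?thesis using one[of m] i Suc unfolding rhs_sets_code by auto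
    next
      case (Suc n)
      then show ?thesis using two[of m n] i j ij \<open>i = Suc m\<close> unfolding rhs_sets_code by simp
    qed
  qed
qed

lemma well_formed_code:
  assumes l: "l \<in> set (restriction_codes N)"
  shows "well_formed_equation C (equation_of (equation_code N Ss l))"
  unfolding well_formed_equation_def
proof (intro conjI ballI)
  let ?e = "equation_of (equation_code N Ss l)"
  show "has_one ?e \<longleftrightarrow> [1] \<in> restriction_set C (lhs ?e)"
    unfolding lhs_code one_in_restriction_iff[OF l] by (simp add: equation_of_def equation_code_def)
  fix pD assume "pD \<in> set (summands ?e)"
  then obtain c where c: "c \<in> set (candidates N Ss l)"
    "pD = (fst c, map restriction_of (snd (summand_code N c)))"
    by (auto simp: equation_of_def equation_code_def summand_code_def)
  have "fst c \<in> {[1, 2], [2, 1]} \<union> simples C" "snd c \<in> set (labellings (fst c) (subseqs N))"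
    using c(1) unfolding set_candidates set_quotients by blast+
  moreover have "length (snd c) = length (fst c)"
    using calculation(2) unfolding set_labellings by (metis length_map)
  ultimately show "case pD of (p, Ds) \<Rightarrow> (p = [1, 2] \<or> p = [2, 1] \<or> simple_perm p) \<and> length Ds = length p"
    using c(2) by (auto simp: summand_code_def simples_def)
qed

lemma rhs_restrictions_code:
  assumes "D \<in> rhs_restrictions (equation_of (equation_code N Ss l))"
  shows "D \<in> restriction_of ` set (restriction_codes N)"
proof -
  obtain c z where c: "c \<in> set (candidates N Ss l)" "z \<in> set (snd c)"
    "D = restriction_of (atom N (component_sign (fst c) (fst z)) (snd z))"
    using assms by (auto simp: rhs_restrictions_def equation_of_def equation_code_def summand_code_def)
  have A: "snd z \<in> set (subseqs N)"
    using c(1,2) unfolding set_candidates set_labellings by auto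
  \<comment> \<open>Restrictions store sets, so any subsequence with the same elements as the
    avoided list of the atom yields the same formal restriction.\<close>
  obtain E where E: "E \<in> set (subseqs N)" "set E = set (filter (\<lambda>g. g \<notin> set (snd z)) N)"
    using subseqs_set_exists[of "set (filter (\<lambda>g. g \<notin> set (snd z)) N)"] by auto
  let ?l = "(component_sign (fst c) (fst z), E, snd z)"
  have "?l \<in> set (restriction_codes N)"
    unfolding restriction_codes_iff using A E by (auto simp: component_sign_def)
  moreover have "D = restriction_of ?l" using c(3) E(2) by (simp add: restriction_of_def atom_def)
  ultimately show ?thesis by blast
qed

lemma lhs_sys: "map lhs sys = map restriction_of (restriction_codes N)"
  by (simp add: sys_eq)

lemma system_restrictions_sys: "system_restrictions sys = restriction_of ` set (restriction_codes N)"
  unfolding system_restrictions_def sys_eq using rhs_restrictions_code by auto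

text \<open>Passing from lists to sets and from numbers to signs loses nothing on the listed codes;
  this gives the uniqueness of the equation with a given left part.\<close>

lemma distinct_lhs_sys: "distinct (map lhs sys)"
proof -
  have "distinct (subseqs N)" using distinct_set_subseqs[OF distinct_N] by (simp add: distinct_map)
  then have "distinct (restriction_codes N)" unfolding restriction_codes_def
    by (intro distinct_product) auto
  moreover have "inj_on restriction_of (set (restriction_codes N))"
  proof (rule inj_onI)
    fix l l' assume l: "l \<in> set (restriction_codes N)" "l' \<in> set (restriction_codes N)"
      and eq: "restriction_of l = restriction_of l'"
    have "fst l = fst l'"
      using l eq unfolding restriction_codes_iff by (auto simp: restriction_of_def)
    moreover have "fst (snd l) = fst (snd l')" "snd (snd l) = snd (snd l')"
      using l eq inj_set_subseqs unfolding restriction_codes_iff inj_on_def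
      by (auto simp: restriction_of_def simp del: in_set_subseqs)
    ultimately show "l = l'" by (simp add: prod_eq_iff)
  qed
  ultimately show ?thesis unfolding lhs_sys by (simp add: distinct_map)
qed

text \<open>A permutation is an interval of itself, so all non-simple basis elements belong to
  \<open>N\<close>, and avoiding exactly these, without sign or required pattern, is one of the
  listed restrictions.\<close>

lemma class_in_sys: "\<exists>e\<in>set sys. restriction_set C (lhs e) = C"
proof -
  let ?B = "{b \<in> class_basis C. \<not> simple_perm b}"
  have "?B \<subseteq> set N"
  proof
    fix b assume b: "b \<in> ?B"
    then have p: "is_perm b" by (simp add: class_basis_def)
    then have "b = [] @ b @ [] \<and> is_block [] b []" by (simp add: is_block_def is_perm_def)
    then have "standardize b \<in> normalized_blocks b"
      unfolding normalized_blocks_eq[OF p] by blast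
    then show "b \<in> set N" unfolding set_N using b standardize_perm[OF p] by auto
  qed
  then obtain E where E: "E \<in> set (subseqs N)" "set E = ?B" using subseqs_set_exists by blast
  let ?l = "(0, E, [])"
  have "?l \<in> set (restriction_codes N)" unfolding restriction_codes_iff using E by simp
  moreover have "restriction_set C (restriction_of ?l) = C"
    using class_as_restriction E(2) by (simp add: restriction_set_def restriction_of_def)
  ultimately show ?thesis unfolding sys_eq by force
qed

theorem sys_correct:
  "(\<forall>e\<in>set sys. well_formed_equation C e \<and> equation_holds C e) \<and>
   (\<forall>D\<in>system_restrictions sys. avoided D \<union> required D \<subseteq>
      (\<Union>b\<in>{b \<in> class_basis C. \<not> simple_perm b}. normalized_blocks b)) \<and>
   (\<exists>e\<in>set sys. restriction_set C (lhs e) = C) \<and>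
   (\<forall>D\<in>system_restrictions sys. \<exists>!i. i < length sys \<and> lhs (sys ! i) = D) \<and>
   combinatorial_specification C sys"
proof -
  have 1: "\<forall>e\<in>set sys. well_formed_equation C e \<and> equation_holds C e"
    unfolding sys_eq using well_formed_code equation_holds_code by auto
  have 2: "avoided D \<union> required D \<subseteq> set N" if D: "D \<in> system_restrictions sys" for D
  proof -
    obtain l where "l \<in> set (restriction_codes N)" "D = restriction_of l"
      using D unfolding system_restrictions_sys by blast
    then show ?thesis unfolding restriction_codes_iff
      by (auto simp: restriction_of_def dest!: subseq_imp_set_subset)
  qed
  have 3: "\<exists>!i. i < length sys \<and> lhs (sys ! i) = D" if D: "D \<in> system_restrictions sys" for D
  proof -
    have "D \<in> set (map lhs sys)" using D unfolding system_restrictions_sys lhs_sys by simp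
    then have "\<exists>!i. i < length (map lhs sys) \<and> map lhs sys ! i = D"
      using distinct_lhs_sys by (rule distinct_Ex1[rotated])
    then show ?thesis by (metis length_map nth_map)
  qed
  have "\<forall>e\<in>set sys. rhs_restrictions e \<subseteq> lhs ` set sys"
  proof -
    have "lhs ` set sys = restriction_of ` set (restriction_codes N)"
      using lhs_sys by (metis set_map)
    then show ?thesis using rhs_restrictions_code unfolding sys_eq by auto
  qed
  then have "combinatorial_specification C sys"
    unfolding combinatorial_specification_def using 1 class_in_sys by (intro conjI)
  then show ?thesis using 1 2[unfolded set_N] 3 class_in_sys by (intro conjI ballI) auto
qed

end

text \<open>The program is fixed before the class and the lists, so it is uniform: its output
  depends on the two lists alone, in whatever order and with whatever repetitions they enumerate the
  sets.\<close>

theorem theorem6p4: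
  "\<exists>alg. \<forall>C Bs Ss.
     perm_class C \<and> [1, 2] \<in> C \<and> [2, 1] \<in> C \<and>
     set Bs = class_basis C \<and> set Ss = simples C \<longrightarrow>
     (\<exists>out sys. rec_eval alg [encode_perms Bs, encode_perms Ss] out \<and>
        sys = decode_system out \<and>
        (\<forall>e\<in>set sys. well_formed_equation C e \<and> equation_holds C e) \<and>
        (\<forall>D\<in>system_restrictions sys. avoided D \<union> required D \<subseteq>
           (\<Union>b\<in>{b \<in> class_basis C. \<not> simple_perm b}. normalized_blocks b)) \<and>
        (\<exists>e\<in>set sys. restriction_set C (lhs e) = C) \<and>
        (\<forall>D\<in>system_restrictions sys. \<exists>!i. i < length sys \<and> lhs (sys ! i) = D) \<and>
        combinatorial_specification C sys)"
proof -
  obtain alg where alg: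
    "\<And>Bs Ss. rec_eval alg [encode_perms Bs, encode_perms Ss] (enc (system_code (block_list Bs) Ss))"
    using system_code_program by blast
  show ?thesis
  proof (intro exI[of _ alg] allI impI)
    fix C Bs Ss
    assume *: "perm_class C \<and> [1, 2] \<in> C \<and> [2, 1] \<in> C \<and>
      set Bs = class_basis C \<and> set Ss = simples C"
    interpret class_input C Bs Ss by unfold_locales (use * in auto)
    let ?out = "enc (system_code (block_list Bs) Ss)"
    have "sys = decode_system ?out" by (simp add: decode_system_enc sys_def N_def)
    then show "\<exists>out sys. rec_eval alg [encode_perms Bs, encode_perms Ss] out \<and>
        sys = decode_system out \<and>
        (\<forall>e\<in>set sys. well_formed_equation C e \<and> equation_holds C e) \<and>
        (\<forall>D\<in>system_restrictions sys. avoided D \<union> required D \<subseteq>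
           (\<Union>b\<in>{b \<in> class_basis C. \<not> simple_perm b}. normalized_blocks b)) \<and>
        (\<exists>e\<in>set sys. restriction_set C (lhs e) = C) \<and>
        (\<forall>D\<in>system_restrictions sys. \<exists>!i. i < length sys \<and> lhs (sys ! i) = D) \<and>
        combinatorial_specification C sys"
      using alg sys_correct by (intro exI[of _ ?out] exI[of _ sys]) blast
  qed
qed

end
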